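(* Let $S$ be a topological monoid that is compact or discrete. Then $S$ is reflexive if and only if $S$ is an abelian topological inverse monoid whose idempotent semilattice $E=\{e\in S:ee=e\}$ is zero-dimensional.
   Context: All topological spaces are assumed Hausdorff. A monoid is a semigroup with a two-sided unit $1$; a topological monoid is a monoid endowed with a (Hausdorff) topology making the multiplication continuous. A semigroup $S$ is inverse if for each $x\in S$ there is a unique $x^{-1}\in S$ with $xx^{-1}x=x$ and $x^{-1}xx^{-1}=x^{-1}$; it is abelian if $xy=yx$ for all $x,y$. A topological inverse monoid is a monoid that is an inverse semigroup, endowed with a topology making both the multiplication and the inversion $x\mapsto x^{-1}$ continuous. In an inverse semigroup the set $E$ of idempotents is a semilattice (a commutative idempotent semigroup), called the idempotent semilattice; it carries the subspace topology. A topological space is zero-dimensional if its closed-and-open subsets form a base of the topology. A monoid homomorphism $h:S\to M$ is a function with $h(1)=1$ and $h(xy)=h(x)h(y)$ for all $x,y\in S$. Let $\dot{\mathbb T}=\{z\in\mathbb C:|z|\in\{0,1\}\}$, with the multiplication of complex numbers and the topology inherited from $\mathbb C$. For a topological monoid $S$, the dual inverse monoid $S^{\odot}$ is the set of all continuous monoid homomorphisms $S\to\dot{\mathbb T}$, endowed with pointwise multiplication and the compact-open topology; it is again a topological monoid, and $S^{\odot\odot}=(S^{\odot})^{\odot}$. The canonical homomorphism is $\delta_S:S\to S^{\odot\odot}$, $\delta_S(x)(h)=h(x)$ for $x\in S$, $h\in S^{\odot}$. A topological monoid $S$ is reflexive if $\delta_S$ is a topological isomorphism (a monoid isomorphism that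 is a homeomorphism). *)

theory Defs
  imports "HOL-Analysis.Analysis" "HOL-Algebra.Group"
begin

record 'a top_monoid = "'a monoid" +
  opens :: "'a topology"

locale topological_monoid = monoid S
  for S :: "('a, 'b) top_monoid_scheme" (structure) +
  assumes topspace_opens: "topspace (opens S) = carrier S"
    and Hausdorff_opens: "Hausdorff_space (opens S)"
    and continuous_mult:
      "continuous_map (prod_topology (opens S) (opens S)) (opens S) (\<lambda>(x, y). x \<otimes> y)"

definition is_semigroup_inverse :: "('a, 'b) monoid_scheme \<Rightarrow> 'a \<Rightarrow> 'a \<Rightarrow> bool" where
  "is_semigroup_inverse S x y \<longleftrightarrow>
     y \<in> carrier S \<and> x \<otimes>\<^bsub>S\<^esub> y \<otimes>\<^bsub>S\<^esub> x = x \<and> y \<otimes>\<^bsub>S\<^esub> x \<otimes>\<^bsub>S\<^esub> y = y"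

(* Not to be confused with m_inv, the two-sided inverse with respect to the unit. *)
definition semigroup_inverse :: "('a, 'b) monoid_scheme \<Rightarrow> 'a \<Rightarrow> 'a" where
  "semigroup_inverse S x = (THE y. is_semigroup_inverse S x y)"

locale topological_inverse_monoid = topological_monoid S
  for S :: "('a, 'b) top_monoid_scheme" (structure) +
  assumes unique_semigroup_inverse: "x \<in> carrier S \<Longrightarrow> \<exists>!y. is_semigroup_inverse S x y"
    and continuous_inversion: "continuous_map (opens S) (opens S) (semigroup_inverse S)"

definition idempotents :: "('a, 'b) monoid_scheme \<Rightarrow> 'a set" where
  "idempotents S = {e \<in> carrier S. e \<otimes>\<^bsub>S\<^esub> e = e}"

definition zero_dimensional_space :: "'a topology \<Rightarrow> bool" where
  "zero_dimensional_space X \<longleftrightarrow>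
     (\<forall>U. openin X U \<longrightarrow> (arbitrary union_of (\<lambda>V. openin X V \<and> closedin X V)) U)"

definition monoid_homs :: "('a, 'c) monoid_scheme \<Rightarrow> ('b, 'd) monoid_scheme \<Rightarrow> ('a \<Rightarrow> 'b) set" where
  "monoid_homs S M = {h \<in> hom S M. h \<one>\<^bsub>S\<^esub> = \<one>\<^bsub>M\<^esub>}"

(* A continuous map out of X is represented by its unique representative that is undefined
   outside topspace X, so that equality of representatives is equality of maps. *)
definition continuous_maps :: "'a topology \<Rightarrow> 'b topology \<Rightarrow> ('a \<Rightarrow> 'b) set" where
  "continuous_maps X Y = {f \<in> extensional (topspace X). continuous_map X Y f}"

definition compact_open_topology :: "'a topology \<Rightarrow> 'b topology \<Rightarrow> ('a \<Rightarrow> 'b) topology" where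
  "compact_open_topology X Y =
     topology_generated_by
       {{f \<in> continuous_maps X Y. f ` K \<subseteq> U} | K U. compactin X K \<and> openin Y U}"

lemma topspace_compact_open_topology [simp]:
  "topspace (compact_open_topology X Y) = continuous_maps X Y"
proof -
  have "\<exists>K U. continuous_maps X Y = {f \<in> continuous_maps X Y. f ` K \<subseteq> U}
          \<and> compactin X K \<and> openin Y U"
    by (rule exI[of _ "{}"], rule exI[of _ "{}"]) simp
  then show ?thesis
    unfolding compact_open_topology_def topology_generated_by_topspace by blast
qed

definition Tdot :: "complex top_monoid" where
  "Tdot = \<lparr>carrier = {z. cmod z \<in> {0, 1}}, mult = (*), one = 1,
           opens = top_of_set {z. cmod z \<in> {0, 1}}\<rparr>"

definition dual_carrier :: "('a, 'b) top_monoid_scheme \<Rightarrow> ('a \<Rightarrow> complex) set" where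
  "dual_carrier S = monoid_homs S Tdot \<inter> continuous_maps (opens S) (opens Tdot)"

definition dual_inverse_monoid ::
    "('a, 'b) top_monoid_scheme \<Rightarrow> ('a \<Rightarrow> complex) top_monoid" where
  "dual_inverse_monoid S =
     \<lparr>carrier = dual_carrier S,
      mult = (\<lambda>f g. \<lambda>x\<in>carrier S. f x \<otimes>\<^bsub>Tdot\<^esub> g x),
      one = (\<lambda>x\<in>carrier S. \<one>\<^bsub>Tdot\<^esub>),
      opens = subtopology (compact_open_topology (opens S) (opens Tdot)) (dual_carrier S)\<rparr>"

definition canonical_hom ::
    "('a, 'b) top_monoid_scheme \<Rightarrow> 'a \<Rightarrow> (('a \<Rightarrow> complex) \<Rightarrow> complex)" where
  "canonical_hom S x = (\<lambda>h\<in>carrier (dual_inverse_monoid S). h x)"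

definition topological_isomorphism ::
    "('a, 'c) top_monoid_scheme \<Rightarrow> ('b, 'd) top_monoid_scheme \<Rightarrow> ('a \<Rightarrow> 'b) \<Rightarrow> bool" where
  "topological_isomorphism S M h \<longleftrightarrow>
     h \<in> monoid_homs S M \<and> bij_betw h (carrier S) (carrier M) \<and>
     homeomorphic_map (opens S) (opens M) h"

definition reflexive :: "('a, 'b) top_monoid_scheme \<Rightarrow> bool" where
  "reflexive S \<longleftrightarrow>
     topological_isomorphism S (dual_inverse_monoid (dual_inverse_monoid S)) (canonical_hom S)"

end

theory Submission
  imports Defs
begin

text \<open>In an abelian inverse monoid every \<open>x\<close> lies in the maximal subgroup at the idempotent
  \<open>supp x = x x\<inverse>\<close>. If the idempotents are zero-dimensional, then every idempotent is a limit of
  smaller idempotents \<open>f\<close> with clopen \<open>{s. f \<le> supp s}\<close>, and a character \<open>c\<close> of the maximal subgroup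
  at \<open>f\<close> extends to a continuous homomorphism, \<open>s \<mapsto> c (f s)\<close> on that set and \<open>0\<close> outside it. Hence the
  canonical homomorphism is injective as soon as characters of abelian groups separate points: in
  the discrete case by Zorn's lemma, in the compact case by an extremal problem in which a finitely
  additive invariant mean (on all bounded functions) replaces Haar measure.

  Surjectivity rests on the same means. Powers of a nonnegative trigonometric polynomial concentrate
  near its maximum; comparing their means shows that a homomorphism of a group of characters is
  approximated by evaluations, and that a homomorphism which is continuous for the topology of
  pointwise convergence is an evaluation.\<close>

section \<open>Invariant means on commutative monoids\<close>

text \<open>Characters of a monoid may vanish, so each group argument first moves to a place where
  they do not. For finitely many characters this is the submonoid on which the product of those not
  killed by the given homomorphism is nonzero; for a homomorphism continuous for pointwise
  convergence it is the filter above one idempotent. There, characters and points are paired by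
  unimodular numbers, and the two surjectivity statements rest on the same peak estimates with the
  sides of the pairing exchanged. A mean on all bounded functions exists on every commutative
  monoid; the price is that it need not commute with pointwise limits or with a second mean, and the
  extremal problem is arranged to avoid both. The topologies are tame because the dual of a compact
  monoid is discrete and that of a discrete one is compact. For the converse, a conjugated
  evaluation is again a homomorphism on the dual, hence an evaluation, and the point found is the
  semigroup inverse; on idempotents characters take only the values 0 and 1, so a compact
  semilattice of idempotents is zero-dimensional.\<close>

definition bounded_fun_on :: "'a set \<Rightarrow> ('a \<Rightarrow> complex) \<Rightarrow> bool" where
  "bounded_fun_on A f \<longleftrightarrow> (\<exists>C. \<forall>x\<in>A. cmod (f x) \<le> C)"

lemma bounded_fun_onI: "(\<And>x. x \<in> A \<Longrightarrow> cmod (f x) \<le> C) \<Longrightarrow> bounded_fun_on A f"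
  unfolding bounded_fun_on_def by blast

lemma bounded_fun_onE:
  assumes "bounded_fun_on A f"
  obtains C where "C \<ge> 0" "\<And>x. x \<in> A \<Longrightarrow> cmod (f x) \<le> C"
proof -
  obtain C where "\<forall>x\<in>A. cmod (f x) \<le> C" using assms unfolding bounded_fun_on_def by blast
  then have "\<And>x. x \<in> A \<Longrightarrow> cmod (f x) \<le> max C 0" by force
  then show thesis using that[of "max C 0"] by simp
qed

lemma bounded_fun_on_const [simp]: "bounded_fun_on A (\<lambda>_. c)"
  by (rule bounded_fun_onI[of _ _ "cmod c"]) simp

lemma bounded_fun_on_add [intro]:
  assumes "bounded_fun_on A f" "bounded_fun_on A g"
  shows "bounded_fun_on A (\<lambda>x. f x + g x)"
proof -
  obtain C where C: "\<And>x. x \<in> A \<Longrightarrow> cmod (f x) \<le> C" using assms(1) by (rule bounded_fun_onE) blast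
  obtain D where D: "\<And>x. x \<in> A \<Longrightarrow> cmod (g x) \<le> D" using assms(2) by (rule bounded_fun_onE) blast
  show ?thesis
    by (rule bounded_fun_onI[of _ _ "C + D"]) (meson C D norm_triangle_mono)
qed

lemma bounded_fun_on_mult [intro]:
  assumes "bounded_fun_on A f" "bounded_fun_on A g"
  shows "bounded_fun_on A (\<lambda>x. f x * g x)"
proof -
  obtain C where C: "C \<ge> 0" "\<And>x. x \<in> A \<Longrightarrow> cmod (f x) \<le> C" using assms(1) by (rule bounded_fun_onE) blast
  obtain D where D: "\<And>x. x \<in> A \<Longrightarrow> cmod (g x) \<le> D" using assms(2) by (rule bounded_fun_onE) blast
  show ?thesis
    by (rule bounded_fun_onI[of _ _ "C * D"]) (simp add: norm_mult C D mult_mono)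
qed

lemma bounded_fun_on_cnj [intro]: "bounded_fun_on A f \<Longrightarrow> bounded_fun_on A (\<lambda>x. cnj (f x))"
  unfolding bounded_fun_on_def by simp

lemma bounded_fun_on_uminus [intro]: "bounded_fun_on A f \<Longrightarrow> bounded_fun_on A (\<lambda>x. - f x)"
  unfolding bounded_fun_on_def by simp

lemma bounded_fun_on_diff [intro]:
  "bounded_fun_on A f \<Longrightarrow> bounded_fun_on A g \<Longrightarrow> bounded_fun_on A (\<lambda>x. f x - g x)"
  using bounded_fun_on_add[of A f "\<lambda>x. - g x"] by auto

lemma bounded_fun_on_sum [intro]:
  "(\<And>i. i \<in> I \<Longrightarrow> bounded_fun_on A (f i)) \<Longrightarrow> bounded_fun_on A (\<lambda>x. \<Sum>i\<in>I. f i x)"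
  by (induction I rule: infinite_finite_induct) auto

lemma bounded_fun_on_power [intro]: "bounded_fun_on A f \<Longrightarrow> bounded_fun_on A (\<lambda>x. f x ^ n)"
  by (induction n) auto

lemma bounded_fun_on_comp [intro]:
  "bounded_fun_on A f \<Longrightarrow> (\<And>x. x \<in> A \<Longrightarrow> g x \<in> A) \<Longrightarrow> bounded_fun_on A (\<lambda>x. f (g x))"
  unfolding bounded_fun_on_def by auto

text \<open>The value at unbounded functions is pinned to \<open>0\<close> so that the means form a compact subset of
  a product of discs.\<close>

definition is_mean_on :: "'a set \<Rightarrow> (('a \<Rightarrow> complex) \<Rightarrow> complex) \<Rightarrow> bool" where
  "is_mean_on A L \<longleftrightarrow>
     (\<forall>f C. (\<forall>x\<in>A. cmod (f x) \<le> C) \<longrightarrow> cmod (L f) \<le> C) \<and>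
     (\<forall>f. \<not> bounded_fun_on A f \<longrightarrow> L f = 0) \<and>
     (\<forall>f g. bounded_fun_on A f \<longrightarrow> bounded_fun_on A g \<longrightarrow> L (\<lambda>x. f x + g x) = L f + L g) \<and>
     (\<forall>f c. bounded_fun_on A f \<longrightarrow> L (\<lambda>x. c * f x) = c * L f) \<and>
     (\<forall>f. bounded_fun_on A f \<longrightarrow> (\<forall>x\<in>A. 0 \<le> Re (f x)) \<longrightarrow> 0 \<le> Re (L f)) \<and>
     L (\<lambda>_. 1) = 1"

lemma is_mean_onD:
  assumes "is_mean_on A L"
  shows is_mean_on_bound: "\<And>f C. (\<And>x. x \<in> A \<Longrightarrow> cmod (f x) \<le> C) \<Longrightarrow> cmod (L f) \<le> C"
    and is_mean_on_unbounded: "\<And>f. \<not> bounded_fun_on A f \<Longrightarrow> L f = 0"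
    and is_mean_on_add:
      "\<And>f g. bounded_fun_on A f \<Longrightarrow> bounded_fun_on A g \<Longrightarrow> L (\<lambda>x. f x + g x) = L f + L g"
    and is_mean_on_scale: "\<And>f c. bounded_fun_on A f \<Longrightarrow> L (\<lambda>x. c * f x) = c * L f"
    and is_mean_on_Re_nonneg:
      "\<And>f. bounded_fun_on A f \<Longrightarrow> (\<And>x. x \<in> A \<Longrightarrow> 0 \<le> Re (f x)) \<Longrightarrow> 0 \<le> Re (L f)"
    and is_mean_on_one: "L (\<lambda>_. 1) = 1"
  using assms unfolding is_mean_on_def by (elim conjE; simp)+

section \<open>Compactness of the set of means\<close>

lemma compact_PiE_UNIV:
  fixes C :: "'a \<Rightarrow> 'b::topological_space set"
  assumes "\<And>i. compact (C i)"
  shows "compact {f. \<forall>i. f i \<in> C i}"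
proof -
  have "compactin (product_topology (\<lambda>_. euclidean) UNIV) (PiE UNIV C)"
    unfolding compactin_PiE using assms by simp
  moreover have "PiE UNIV C = {f. \<forall>i. f i \<in> C i}" by (auto simp: PiE_def)
  ultimately show ?thesis by (simp add: euclidean_product_topology)
qed

lemma continuous_on_eval: "continuous_on S (\<lambda>f. f x)"
  by (rule continuous_on_subset[OF continuous_on_product_coordinates]) simp

text \<open>Each clause of \<open>is_mean_on\<close> compares finitely many evaluations of
  \<open>L\<close>, so it is closed for pointwise convergence, and Tychonoff applies to a product of
  discs.\<close>

lemma compact_means: "compact (Collect (is_mean_on A))"
proof -
  \<comment> \<open>Any bound of \<open>f\<close> serves as the radius of its disc; at unbounded
    \<open>f\<close> the radius is 0.\<close>
  define b where "b f = (if bounded_fun_on A f then SOME C. \<forall>x\<in>A. cmod (f x) \<le> C else 0)" for f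
  have b: "\<forall>x\<in>A. cmod (f x) \<le> b f" if "bounded_fun_on A f" for f
    using that someI_ex[of "\<lambda>C. \<forall>x\<in>A. cmod (f x) \<le> C"] unfolding b_def bounded_fun_on_def by auto
  have compact_box: "compact {L. \<forall>f. L f \<in> cball (0::complex) (b f)}"
    by (rule compact_PiE_UNIV) simp
  have closed_means: "closed (Collect (is_mean_on A))"
  proof -
    have all_imp: "closed {L. \<forall>f. P f \<longrightarrow> Q L f}" if "\<And>f. closed {L. Q L f}"
      for P and Q :: "(('a \<Rightarrow> complex) \<Rightarrow> complex) \<Rightarrow> _ \<Rightarrow> bool"
      by (rule closed_Collect_all, rule closed_Collect_imp[OF open_Collect_const that])
    have 1: "closed {L. \<forall>f C. (\<forall>x\<in>A. cmod (f x) \<le> C) \<longrightarrow> cmod ((L :: ('a \<Rightarrow> complex) \<Rightarrow> complex) f) \<le> C}"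
      by (rule closed_Collect_all, rule all_imp, rule closed_Collect_le;
          intro continuous_on_norm continuous_on_const continuous_on_eval)
    have 2: "closed {L. \<forall>f. \<not> bounded_fun_on A f \<longrightarrow> (L :: ('a \<Rightarrow> complex) \<Rightarrow> complex) f = 0}"
      by (rule all_imp, rule closed_Collect_eq; intro continuous_on_const continuous_on_eval)
    have 3: "closed {L. \<forall>f. bounded_fun_on A f \<longrightarrow> (\<forall>g. bounded_fun_on A g \<longrightarrow>
        (L :: ('a \<Rightarrow> complex) \<Rightarrow> complex) (\<lambda>x. f x + g x) = L f + L g)}"
      by (rule all_imp, rule all_imp, rule closed_Collect_eq; intro continuous_on_add continuous_on_eval)
    have 4: "closed {L. \<forall>f c. bounded_fun_on A f \<longrightarrow> (L :: ('a \<Rightarrow> complex) \<Rightarrow> complex) (\<lambda>x. c * f x) = c * L f}"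
      by (rule closed_Collect_all, rule all_imp, rule closed_Collect_eq;
          intro continuous_on_mult continuous_on_const continuous_on_eval)
    have 5: "closed {L. \<forall>f. bounded_fun_on A f \<longrightarrow> (\<forall>x\<in>A. 0 \<le> Re (f x)) \<longrightarrow>
        0 \<le> Re ((L :: ('a \<Rightarrow> complex) \<Rightarrow> complex) f)}"
      by (rule all_imp, rule closed_Collect_imp[OF open_Collect_const], rule closed_Collect_le;
          intro continuous_on_Re continuous_on_const continuous_on_eval)
    have 6: "closed {L. (L :: ('a \<Rightarrow> complex) \<Rightarrow> complex) (\<lambda>_. 1) = 1}"
      by (rule closed_Collect_eq; intro continuous_on_const continuous_on_eval)
    show ?thesis
      using closed_Int[OF 1 closed_Int[OF 2 closed_Int[OF 3 closed_Int[OF 4 closed_Int[OF 5 6]]]]]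
      unfolding is_mean_on_def Collect_conj_eq by simp
  qed
  have subset: "Collect (is_mean_on A) \<subseteq> {L. \<forall>f. L f \<in> cball (0::complex) (b f)}"
  proof clarsimp
    fix L f assume L: "is_mean_on A L"
    show "cmod (L f) \<le> b f"
    proof (cases "bounded_fun_on A f")
      case True
      show ?thesis by (rule is_mean_on_bound[OF L]) (use b[OF True] in blast)
    next
      case False
      then have "L f = 0" by (rule is_mean_on_unbounded[OF L])
      then show ?thesis using False by (simp add: b_def)
    qed
  qed
  show ?thesis
    using compact_Int_closed[OF compact_box closed_means] unfolding Int_absorb1[OF subset] .
qed

lemma compact_fip_ball:
  assumes "compact K" and "\<And>i. i \<in> I \<Longrightarrow> closed (D i)"
    and "\<And>J. finite J \<Longrightarrow> J \<subseteq> I \<Longrightarrow> \<exists>x\<in>K. \<forall>i\<in>J. x \<in> D i"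
  shows "\<exists>x\<in>K. \<forall>i\<in>I. x \<in> D i"
proof -
  have "K \<inter> \<Inter>(D ` I) \<noteq> {}"
  proof (rule compact_imp_fip[OF assms(1)])
    show "closed T" if "T \<in> D ` I" for T using that assms(2) by auto
    fix F assume "finite F" "F \<subseteq> D ` I"
    then obtain J where "J \<subseteq> I" "finite J" "F = D ` J" by (meson finite_subset_image)
    then show "K \<inter> \<Inter>F \<noteq> {}" using assms(3)[of J] by auto
  qed
  then show ?thesis by auto
qed

text \<open>Stated for monoids because the later instances are, besides compact groups, a submonoid
  on which some character is nonzero and a monoid of characters.\<close>

locale invariant_mean = comm_monoid G for G :: "('a, 'b) monoid_scheme" (structure) +
  fixes M :: "('a \<Rightarrow> complex) \<Rightarrow> complex"
  assumes is_mean: "is_mean_on (carrier G) M"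
    and mean_translate:
      "k \<in> carrier G \<Longrightarrow> bounded_fun_on (carrier G) f \<Longrightarrow> M (\<lambda>x. f (k \<otimes> x)) = M f"

section \<open>Averages along orbits\<close>

definition cesaro :: "('a, 'b) monoid_scheme \<Rightarrow> 'a \<Rightarrow> nat \<Rightarrow> ('a \<Rightarrow> complex) \<Rightarrow> 'a \<Rightarrow> complex" where
  "cesaro G k n f x = (\<Sum>i<n. f (k [^]\<^bsub>G\<^esub> i \<otimes>\<^bsub>G\<^esub> x)) / of_nat n"

context comm_monoid
begin

lemma cesaro_bound:
  assumes "\<And>x. x \<in> carrier G \<Longrightarrow> cmod (f x) \<le> C" "k \<in> carrier G" "n > 0" "x \<in> carrier G"
  shows "cmod (cesaro G k n f x) \<le> C"
proof -
  have "cmod (\<Sum>i<n. f (k [^] i \<otimes> x)) \<le> (\<Sum>i<n. C)"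
    by (rule sum_norm_le) (simp add: assms)
  then show ?thesis using assms(3) unfolding cesaro_def by (simp add: norm_divide field_simps)
qed

lemma bounded_cesaro:
  assumes "bounded_fun_on (carrier G) f" "k \<in> carrier G" "n > 0"
  shows "bounded_fun_on (carrier G) (cesaro G k n f)"
  using assms(1) cesaro_bound[OF _ assms(2,3)] by (metis bounded_fun_onE bounded_fun_onI)

text \<open>The two sums telescope: only the terms with exponents 0 and \<open>n\<close> survive,
  each of size at most \<open>C\<close>.\<close>

lemma cesaro_translate_diff:
  assumes f: "\<And>x. x \<in> carrier G \<Longrightarrow> cmod (f x) \<le> C" and k: "k \<in> carrier G" and n: "n > 0"
    and x: "x \<in> carrier G"
  shows "cmod (cesaro G k n (\<lambda>x. f (k \<otimes> x)) x - cesaro G k n f x) \<le> 2 * C / n"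
proof -
  have "(\<Sum>i<n. f (k \<otimes> (k [^] i \<otimes> x))) = (\<Sum>i<n. f (k [^] Suc i \<otimes> x))"
    using k x by (intro sum.cong refl) (simp add: m_ac)
  then have "(\<Sum>i<n. f (k \<otimes> (k [^] i \<otimes> x))) - (\<Sum>i<n. f (k [^] i \<otimes> x))
      = f (k [^] n \<otimes> x) - f (k [^] (0::nat) \<otimes> x)"
    by (simp only: flip: sum_subtractf) (rule sum_lessThan_telescope)
  moreover have "cmod (f (k [^] n \<otimes> x) - f (k [^] (0::nat) \<otimes> x)) \<le> 2 * C"
  proof -
    have "cmod (f (k [^] n \<otimes> x)) \<le> C" "cmod (f (k [^] (0::nat) \<otimes> x)) \<le> C"
      by (rule f; use k x in simp)+
    then show ?thesis by norm
  qed
  ultimately show ?thesis using n unfolding cesaro_def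
    by (simp add: norm_divide divide_right_mono flip: diff_divide_distrib)
qed

text \<open>Cesaro averaging is linear, positive and unital and does not enlarge bounds, so its
  transpose maps means to means; the case distinction restores the value 0 at unbounded
  functions.\<close>

lemma mean_comp_cesaro:
  assumes L: "is_mean_on (carrier G) L" and k: "k \<in> carrier G" and n: "n > 0"
  shows "is_mean_on (carrier G) (\<lambda>f. if bounded_fun_on (carrier G) f then L (cesaro G k n f) else 0)"
proof -
  have add: "cesaro G k n (\<lambda>x. f x + g x) = (\<lambda>x. cesaro G k n f x + cesaro G k n g x)" for f g
    unfolding cesaro_def by (simp add: sum.distrib add_divide_distrib)
  have scale: "cesaro G k n (\<lambda>x. c * f x) = (\<lambda>x. c * cesaro G k n f x)" for c f
    unfolding cesaro_def by (simp add: sum_distrib_left)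
  have pos: "0 \<le> Re (cesaro G k n f x)" if "\<forall>x\<in>carrier G. 0 \<le> Re (f x)" "x \<in> carrier G" for f x
    unfolding cesaro_def using that k by (simp add: Re_divide_of_nat sum_nonneg)
  have one: "cesaro G k n (\<lambda>_. 1) = (\<lambda>_. 1)"
    unfolding cesaro_def using n by simp
  show ?thesis
    unfolding is_mean_on_def
  proof (intro conjI allI impI)
    fix f C assume "\<forall>x\<in>carrier G. cmod (f x) \<le> C"
    then show "cmod (if bounded_fun_on (carrier G) f then L (cesaro G k n f) else 0) \<le> C"
      using is_mean_on_bound[OF L cesaro_bound[of f C k n]] k n bounded_fun_onI[of "carrier G" f C]
      by auto
  next
    fix f assume "bounded_fun_on (carrier G) f" "\<forall>x\<in>carrier G. 0 \<le> Re (f x)"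
    then show "0 \<le> Re (if bounded_fun_on (carrier G) f then L (cesaro G k n f) else 0)"
      using is_mean_on_Re_nonneg[OF L, of "cesaro G k n f"] pos[of f] bounded_cesaro[of f k n] k n by simp
  next
    fix f g assume fg: "bounded_fun_on (carrier G) f" "bounded_fun_on (carrier G) g"
    then show "(if bounded_fun_on (carrier G) (\<lambda>x. f x + g x) then L (cesaro G k n (\<lambda>x. f x + g x)) else 0) =
        (if bounded_fun_on (carrier G) f then L (cesaro G k n f) else 0) +
        (if bounded_fun_on (carrier G) g then L (cesaro G k n g) else 0)"
      using is_mean_on_add[OF L bounded_cesaro[OF fg(1) k n] bounded_cesaro[OF fg(2) k n]]
        bounded_fun_on_add[OF fg] by (simp only: add if_True)
  next
    fix f c assume f: "bounded_fun_on (carrier G) f"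
    then show "(if bounded_fun_on (carrier G) (\<lambda>x. c * f x) then L (cesaro G k n (\<lambda>x. c * f x)) else 0) =
        c * (if bounded_fun_on (carrier G) f then L (cesaro G k n f) else 0)"
      using is_mean_on_scale[OF L bounded_cesaro[OF f k n]]
        bounded_fun_on_mult[OF bounded_fun_on_const f] by (simp only: scale if_True)
  qed (use is_mean_on_one[OF L] in \<open>simp_all add: one\<close>)
qed

text \<open>Markov-Kakutani: finitely many conditions of approximate invariance are met by applying
  Cesaro averages one after another, and compactness of the set of means yields one functional that
  satisfies them all.\<close>

theorem invariant_mean_exists: "\<exists>M. invariant_mean G M"
proof -
  define I where "I = carrier G \<times> {n::nat. n > 0}"
  \<comment> \<open>\<open>D (k, n)\<close> asks for invariance under \<open>k\<close> up to
    \<open>2 * C / n\<close>, a closed condition that averages of length \<open>n\<close> satisfy;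
    all \<open>n\<close> together give exact invariance.\<close>
  define D where "D = (\<lambda>(k, n::nat). {L :: ('a \<Rightarrow> complex) \<Rightarrow> complex.
    \<forall>f C. (\<forall>x\<in>carrier G. cmod (f x) \<le> C) \<longrightarrow> cmod (L (\<lambda>x. f (k \<otimes> x)) - L f) \<le> 2 * C / n})"
  have "\<exists>L\<in>Collect (is_mean_on (carrier G)). \<forall>i\<in>I. L \<in> D i"
  proof (rule compact_fip_ball[OF compact_means])
    show "closed (D i)" if "i \<in> I" for i
    proof -
      obtain k n where "i = (k, n)" by fastforce
      then show ?thesis
        unfolding D_def
        by (auto intro!: closed_Collect_all closed_Collect_imp open_Collect_const closed_Collect_le continuous_on_norm continuous_on_diff
              continuous_on_const continuous_on_eval)
    qed
    fix J assume "finite J" "J \<subseteq> I"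
    then show "\<exists>L\<in>Collect (is_mean_on (carrier G)). \<forall>i\<in>J. L \<in> D i"
    proof (induction J rule: finite_induct)
      case empty
      \<comment> \<open>The averaging starts from evaluation at the unit.\<close>
      have "is_mean_on (carrier G) (\<lambda>f. if bounded_fun_on (carrier G) f then f \<one> else 0)"
        unfolding is_mean_on_def by (auto intro: bounded_fun_onI)
      then show ?case by blast
    next
      case (insert i J)
      then obtain L where L: "is_mean_on (carrier G) L" "\<forall>i\<in>J. L \<in> D i" by auto
      obtain k n where i: "i = (k, n)" "k \<in> carrier G" "n > 0" using insert.prems unfolding I_def by fastforce
      define L' where "L' f = (if bounded_fun_on (carrier G) f then L (cesaro G k n f) else 0)" for f
      have L': "is_mean_on (carrier G) L'"
        using mean_comp_cesaro[OF L(1) i(2,3)] unfolding L'_def .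
      have Ldiff: "L f - L g = L (\<lambda>x. f x - g x)"
        if "bounded_fun_on (carrier G) f" "bounded_fun_on (carrier G) g" for f g
      proof -
        have "bounded_fun_on (carrier G) (\<lambda>x. (-1) * g x)"
          using that(2) by (intro bounded_fun_on_mult) auto
        then have "L (\<lambda>x. f x + (-1) * g x) = L f + L (\<lambda>x. (-1) * g x)"
          by (rule is_mean_on_add[OF L(1) that(1)])
        also have "L (\<lambda>x. (-1) * g x) = (-1) * L g"
          by (rule is_mean_on_scale[OF L(1) that(2)])
        finally show ?thesis by simp
      qed
      have shift: "bounded_fun_on (carrier G) (\<lambda>x. f (j \<otimes> x))"
        if "bounded_fun_on (carrier G) f" "j \<in> carrier G" for f j
        using that by auto
      have "L' \<in> D i"
        unfolding i(1) D_def
      proof (clarsimp)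
        fix f C assume f: "\<forall>x\<in>carrier G. cmod (f x) \<le> C"
        then have b: "bounded_fun_on (carrier G) f" by (auto intro: bounded_fun_onI)
        have "L' (\<lambda>x. f (k \<otimes> x)) - L' f
            = L (\<lambda>x. cesaro G k n (\<lambda>x. f (k \<otimes> x)) x - cesaro G k n f x)"
          unfolding L'_def using b shift[OF b i(2)] bounded_cesaro[OF _ i(2,3)] by (simp add: Ldiff)
        moreover have "cmod (L (\<lambda>x. cesaro G k n (\<lambda>x. f (k \<otimes> x)) x - cesaro G k n f x)) \<le> 2 * C / n"
          using f by (intro is_mean_on_bound[OF L(1)] cesaro_translate_diff i(2,3)) auto
        ultimately show "cmod (L' (\<lambda>x. f (k \<otimes> x)) - L' f) \<le> 2 * C / n" by simp
      qed
      \<comment> \<open>Commutativity: averaging along \<open>k\<close> commutes with translation by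
        \<open>k'\<close>, and the average of \<open>f\<close> keeps the bound \<open>C\<close>, so
        the earlier condition survives the new averaging.\<close>
      moreover have "L' \<in> D j" if jJ: "j \<in> J" for j
      proof -
        obtain k' m where j: "j = (k', m)" "k' \<in> carrier G" "m > 0"
          using insert.prems jJ unfolding I_def by (cases j) auto
        show ?thesis
          unfolding j(1) D_def
        proof (clarsimp)
          fix f C assume f: "\<forall>x\<in>carrier G. cmod (f x) \<le> C"
          then have b: "bounded_fun_on (carrier G) f" by (auto intro: bounded_fun_onI)
          define c where "c = cesaro G k n f"
          have 1: "cmod (L (\<lambda>x. c (k' \<otimes> x)) - L c) \<le> 2 * C / m"
            using L(2) jJ cesaro_bound[OF _ i(2,3), of f C] f unfolding j(1) D_def c_def by auto
          have bb: "bounded_fun_on (carrier G) (cesaro G k n (\<lambda>x. f (k' \<otimes> x)))"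
            "bounded_fun_on (carrier G) (\<lambda>x. c (k' \<otimes> x))"
            unfolding c_def using b bounded_cesaro[OF _ i(2,3)] shift j(2) by simp_all
          have "cesaro G k n (\<lambda>x. f (k' \<otimes> x)) x = c (k' \<otimes> x)" if "x \<in> carrier G" for x
            unfolding cesaro_def c_def using i(2) j(2) that by (simp add: m_lcomm)
          then have "cmod (L (\<lambda>x. cesaro G k n (\<lambda>x. f (k' \<otimes> x)) x - c (k' \<otimes> x))) \<le> 0"
            by (intro is_mean_on_bound[OF L(1)]) simp
          then have "L (cesaro G k n (\<lambda>x. f (k' \<otimes> x))) = L (\<lambda>x. c (k' \<otimes> x))"
            using Ldiff[OF bb] by simp
          then show "cmod (L' (\<lambda>x. f (k' \<otimes> x)) - L' f) \<le> 2 * C / m"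
            using 1 b shift[OF b j(2)] unfolding L'_def c_def by simp
        qed
      qed
      ultimately show ?case using L' by auto
    qed
  qed
  then obtain L where L: "is_mean_on (carrier G) L" "\<forall>i\<in>I. L \<in> D i" by auto
  have "L (\<lambda>x. f (k \<otimes> x)) = L f" if k: "k \<in> carrier G" and b: "bounded_fun_on (carrier G) f" for k f
  proof -
    obtain C where C: "\<And>x. x \<in> carrier G \<Longrightarrow> cmod (f x) \<le> C" using b by (rule bounded_fun_onE) blast
    have "\<forall>n\<ge>1. cmod (L (\<lambda>x. f (k \<otimes> x)) - L f) \<le> 2 * C / real n"
      using L(2) k C unfolding I_def D_def by auto
    moreover have "(\<lambda>n. 2 * C / real n) \<longlonglongrightarrow> 0"
      by (rule lim_const_over_n)
    ultimately have "cmod (L (\<lambda>x. f (k \<otimes> x)) - L f) \<le> 0"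
      by (intro LIMSEQ_le_const) auto
    then show ?thesis by simp
  qed
  then have "invariant_mean G L"
    using L(1) by unfold_locales auto
  then show ?thesis by blast
qed

end

context invariant_mean
begin

abbreviation "bdd \<equiv> bounded_fun_on (carrier G)"

lemma mean_add: "bdd f \<Longrightarrow> bdd g \<Longrightarrow> M (\<lambda>x. f x + g x) = M f + M g"
  by (rule is_mean_on_add[OF is_mean])

lemma mean_scale: "bdd f \<Longrightarrow> M (\<lambda>x. c * f x) = c * M f"
  by (rule is_mean_on_scale[OF is_mean])

lemma mean_const [simp]: "M (\<lambda>_. c) = c"
  using mean_scale[of "\<lambda>_. 1" c] is_mean_on_one[OF is_mean] by simp

lemma mean_bound: "(\<And>x. x \<in> carrier G \<Longrightarrow> cmod (f x) \<le> C) \<Longrightarrow> cmod (M f) \<le> C"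
  by (rule is_mean_on_bound[OF is_mean])

lemma mean_Re_nonneg: "bdd f \<Longrightarrow> (\<And>x. x \<in> carrier G \<Longrightarrow> 0 \<le> Re (f x)) \<Longrightarrow> 0 \<le> Re (M f)"
  by (rule is_mean_on_Re_nonneg[OF is_mean])

lemma mean_uminus: "bdd f \<Longrightarrow> M (\<lambda>x. - f x) = - M f"
  using mean_scale[of f "-1"] by simp

lemma mean_diff: "bdd f \<Longrightarrow> bdd g \<Longrightarrow> M (\<lambda>x. f x - g x) = M f - M g"
  using mean_add[of f "\<lambda>x. - g x"] by (simp add: mean_uminus bounded_fun_on_uminus)

lemma mean_Re_mono:
  assumes "bdd f" "bdd g" "\<And>x. x \<in> carrier G \<Longrightarrow> Re (f x) \<le> Re (g x)"
  shows "Re (M f) \<le> Re (M g)"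
  using mean_Re_nonneg[OF bounded_fun_on_diff[OF assms(2,1)]] assms by (simp add: mean_diff)

lemma mean_sum:
  "(\<And>i. i \<in> I \<Longrightarrow> bdd (f i)) \<Longrightarrow> M (\<lambda>x. \<Sum>i\<in>I. f i x) = (\<Sum>i\<in>I. M (f i))"
  by (induction I rule: infinite_finite_induct) (auto simp: mean_add bounded_fun_on_sum)

lemma mean_cong:
  assumes "\<And>x. x \<in> carrier G \<Longrightarrow> f x = g x"
  shows "M f = M g"
proof (cases "bdd f")
  case True
  then have g: "bdd g" using assms unfolding bounded_fun_on_def by auto
  have "cmod (M (\<lambda>x. f x - g x)) \<le> 0" by (rule mean_bound) (simp add: assms)
  then show ?thesis using mean_diff[OF True g] by simp
next
  case False
  then have "\<not> bdd g" using assms unfolding bounded_fun_on_def by auto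
  then show ?thesis using False is_mean_on_unbounded[OF is_mean] by simp
qed

lemma mean_real:
  assumes "bdd f" "\<And>x. x \<in> carrier G \<Longrightarrow> Im (f x) = 0"
  shows "Im (M f) = 0"
proof -
  \<comment> \<open>\<open>\<i> * f\<close> and its negative have real part 0 on the carrier, so
    positivity bounds \<open>Im (M f)\<close> from both sides.\<close>
  have "0 \<le> Re (M (\<lambda>x. \<i> * f x))" "0 \<le> Re (M (\<lambda>x. (-\<i>) * f x))"
    using assms by (auto intro!: mean_Re_nonneg bounded_fun_on_mult simp del: mult_minus_left)
  then show ?thesis
    unfolding mean_scale[OF assms(1)] by simp
qed

lemma mean_cnj:
  assumes "bdd f"
  shows "M (\<lambda>x. cnj (f x)) = cnj (M f)"
proof -
  have b: "bdd (\<lambda>x. cnj (f x))" using assms by auto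
  \<comment> \<open>\<open>f + cnj f\<close> and \<open>\<i> * (f - cnj f)\<close> are real-valued;
    that their means are real gives the imaginary and the real part of the claim.\<close>
  have 1: "Im (M (\<lambda>x. f x + cnj (f x))) = 0"
    by (rule mean_real) (use assms b in auto)
  have 2: "Im (M (\<lambda>x. \<i> * (f x - cnj (f x)))) = 0"
    by (rule mean_real) (use assms b in auto)
  have "Im (M f) + Im (M (\<lambda>x. cnj (f x))) = 0" using 1 assms b by (simp add: mean_add)
  moreover have "Re (M f) - Re (M (\<lambda>x. cnj (f x))) = 0"
    using 2 assms b by (simp add: mean_diff mean_scale bounded_fun_on_diff)
  ultimately show ?thesis by (simp add: complex_eq_iff)
qed

end

section \<open>Approximation by characters\<close>

text \<open>A unimodular pairing between \<open>X\<close> and \<open>G\<close>. It is used with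
  characters as indices and points as arguments, and again with these roles exchanged;
  \<open>mul\<close> and \<open>cj\<close> are the operations on the index side, and inverses in
  \<open>G\<close> are provided up to the pairing.\<close>

locale character_family = invariant_mean G M
  for G :: "('a, 'b) monoid_scheme" (structure) and M +
  fixes X :: "'i set" and ev :: "'i \<Rightarrow> 'a \<Rightarrow> complex"
    and mul :: "'i \<Rightarrow> 'i \<Rightarrow> 'i" and cj :: "'i \<Rightarrow> 'i"
  assumes X_nonempty: "X \<noteq> {}"
    and mul_closed: "i \<in> X \<Longrightarrow> j \<in> X \<Longrightarrow> mul i j \<in> X"
    and cj_closed: "i \<in> X \<Longrightarrow> cj i \<in> X"
    and ev_mul: "i \<in> X \<Longrightarrow> j \<in> X \<Longrightarrow> y \<in> carrier G \<Longrightarrow> ev (mul i j) y = ev i y * ev j y"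
    and ev_cj: "i \<in> X \<Longrightarrow> y \<in> carrier G \<Longrightarrow> ev (cj i) y = cnj (ev i y)"
    and norm_ev: "i \<in> X \<Longrightarrow> y \<in> carrier G \<Longrightarrow> cmod (ev i y) = 1"
    and ev_mult: "i \<in> X \<Longrightarrow> y \<in> carrier G \<Longrightarrow> z \<in> carrier G \<Longrightarrow> ev i (y \<otimes> z) = ev i y * ev i z"
    and ev_inverse: "y \<in> carrier G \<Longrightarrow> \<exists>z\<in>carrier G. \<forall>i\<in>X. ev i z = cnj (ev i y)"
begin

text \<open>A nonnegative trigonometric polynomial whose powers concentrate where all \<open>c i * ev i y\<close>
  are close to \<open>1\<close>.\<close>

definition peak :: "'i set \<Rightarrow> ('i \<Rightarrow> complex) \<Rightarrow> 'a \<Rightarrow> real" where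
  "peak A c y = (\<Sum>i\<in>A. (1 + Re (c i * ev i y)) / 2) / card A"

lemma bdd_ev: "i \<in> X \<Longrightarrow> bdd (ev i)"
  by (rule bounded_fun_onI[of _ _ 1]) (simp add: norm_ev)

lemma peak_term_range:
  assumes "i \<in> X" "y \<in> carrier G" "cmod (c i) = 1"
  shows "0 \<le> (1 + Re (c i * ev i y)) / 2" "(1 + Re (c i * ev i y)) / 2 \<le> 1"
proof -
  have "cmod (c i * ev i y) = 1" using assms by (simp add: norm_mult norm_ev)
  then show "0 \<le> (1 + Re (c i * ev i y)) / 2" "(1 + Re (c i * ev i y)) / 2 \<le> 1"
    using abs_Re_le_cmod[of "c i * ev i y"] by auto
qed

context
  fixes A assumes A: "finite A" "A \<noteq> {}" "A \<subseteq> X"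
begin

lemma peak_nonneg:
  assumes "\<And>i. i \<in> A \<Longrightarrow> cmod (c i) = 1" "y \<in> carrier G"
  shows "0 \<le> peak A c y"
  unfolding peak_def using A assms peak_term_range by (intro divide_nonneg_nonneg sum_nonneg) auto

text \<open>For |z| = 1 one has |z - 1|^2 = 2 - 2 Re z, so an index at distance at least
  \<open>e\<close> from 1 lowers its summand by e^2/4; the other summands are at most 1.\<close>

lemma peak_le:
  assumes "\<And>i. i \<in> A \<Longrightarrow> cmod (c i) = 1" "y \<in> carrier G"
    and j: "j \<in> A" "0 \<le> e" "e \<le> cmod (c j * ev j y - 1)"
  shows "peak A c y \<le> 1 - e\<^sup>2 / (4 * card A)"
proof -
  define z where "z = c j * ev j y"
  have z: "cmod z = 1" using assms A norm_ev by (auto simp: z_def norm_mult)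
  have "(cmod (z - 1))\<^sup>2 = (cmod z)\<^sup>2 - 2 * Re z + 1"
    unfolding cmod_power2 by (simp add: power2_eq_square algebra_simps)
  moreover have "e\<^sup>2 \<le> (cmod (z - 1))\<^sup>2" using j unfolding z_def by (intro power_mono) auto
  ultimately have t: "(1 + Re z) / 2 \<le> 1 - e\<^sup>2 / 4" using z by simp
  have "(\<Sum>i\<in>A. (1 + Re (c i * ev i y)) / 2)
      = (1 + Re z) / 2 + (\<Sum>i\<in>A - {j}. (1 + Re (c i * ev i y)) / 2)"
    using A j by (simp add: z_def sum.remove)
  also have "\<dots> \<le> (1 - e\<^sup>2 / 4) + (\<Sum>i\<in>A - {j}. 1)"
    by (intro add_mono t sum_mono peak_term_range) (use A assms in auto)
  also have "\<dots> = card A - e\<^sup>2 / 4"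
    using A j card_gt_0_iff[of A] by (simp add: card_Diff_singleton of_nat_diff Suc_leI)
  finally show ?thesis
    unfolding peak_def using A card_gt_0_iff[of A] by (simp add: field_simps)
qed

lemma peak_le_1:
  assumes "\<And>i. i \<in> A \<Longrightarrow> cmod (c i) = 1" "y \<in> carrier G"
  shows "peak A c y \<le> 1"
  using peak_le[OF assms, where e = 0] A by auto

text \<open>\<open>1 - Re z\<close> is at most |z - 1|. This linear estimate will be set against
  \<open>peak_le\<close>: with a suitable \<open>d\<close>, points near 1 lose at most
  \<open>d/2\<close> and far points at least \<open>d\<close>.\<close>

lemma peak_ge:
  assumes "y \<in> carrier G" "\<And>j. j \<in> A \<Longrightarrow> cmod (ev j y - 1) \<le> e"
  shows "1 - e / 2 \<le> peak A (\<lambda>_. 1) y"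
proof -
  have "1 - e / 2 \<le> (1 + Re (ev i y)) / 2" if "i \<in> A" for i
    using assms(2)[OF that] abs_Re_le_cmod[of "ev i y - 1"] by simp
  then have "(\<Sum>i\<in>A. 1 - e / 2) \<le> (\<Sum>i\<in>A. (1 + Re (1 * ev i y)) / 2)"
    by (intro sum_mono) simp
  then show ?thesis
    unfolding peak_def using A card_gt_0_iff[of A] by (simp add: field_simps)
qed

lemma bdd_peak:
  assumes "\<And>i. i \<in> A \<Longrightarrow> cmod (c i) = 1"
  shows "bdd (\<lambda>y. of_real (peak A c y))"
  using peak_nonneg[OF assms] peak_le_1[OF assms] by (intro bounded_fun_onI[of _ _ 1]) simp

text \<open>Writing the real part as half of \<open>z + cnj z\<close> turns multiplication by
  \<open>peak\<close> into shifts of the index \<open>h\<close> by \<open>i\<close> and by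
  \<open>cj i\<close>; the denominator collects two halvings and the averaging over
  \<open>A\<close>.\<close>

lemma mean_peak_mult:
  assumes w: "bdd w" and h: "h \<in> X"
  shows "M (\<lambda>y. ev h y * (of_real (peak A c y) * w y)) =
    (\<Sum>i\<in>A. 2 * M (\<lambda>y. ev h y * w y) + c i * M (\<lambda>y. ev (mul h i) y * w y)
        + cnj (c i) * M (\<lambda>y. ev (mul h (cj i)) y * w y)) / (4 * card A)"
proof -
  define n where "n = 1 / complex_of_real (4 * card A)"
  have b: "bdd (\<lambda>y. ev j y * w y)" if "j \<in> X" for j
    using bdd_ev[OF that] w by auto
  have iX: "i \<in> X" if "i \<in> A" for i using that A by auto
  have b': "bdd (\<lambda>y. c * (ev j y * w y))" if "j \<in> X" for j c
    using b[OF that] by auto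
  have b'': "bdd (\<lambda>y. 2 * (ev h y * w y) + c i * (ev (mul h i) y * w y)
      + cnj (c i) * (ev (mul h (cj i)) y * w y))" if "i \<in> A" for i
    by (intro bounded_fun_on_add b' mul_closed cj_closed iX h that)
  have "M (\<lambda>y. ev h y * (of_real (peak A c y) * w y)) =
     M (\<lambda>y. n * (\<Sum>i\<in>A. 2 * (ev h y * w y) + c i * (ev (mul h i) y * w y)
      + cnj (c i) * (ev (mul h (cj i)) y * w y)))"
  proof (rule mean_cong)
    fix y assume y: "y \<in> carrier G"
    have "complex_of_real (peak A c y) = n * (\<Sum>i\<in>A. 2 + c i * ev i y + cnj (c i) * cnj (ev i y))"
    proof -
      have "2 + c i * ev i y + cnj (c i) * cnj (ev i y) = 4 * complex_of_real ((1 + Re (c i * ev i y)) / 2)" for i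
        using complex_add_cnj[of "c i * ev i y"] by (simp add: add.assoc)
      then have "(\<Sum>i\<in>A. 2 + c i * ev i y + cnj (c i) * cnj (ev i y))
          = 4 * complex_of_real (\<Sum>i\<in>A. (1 + Re (c i * ev i y)) / 2)"
        by (simp only: of_real_sum sum_distrib_left)
      then show ?thesis unfolding peak_def n_def of_real_divide by simp
    qed
    then show "ev h y * (of_real (peak A c y) * w y) = n * (\<Sum>i\<in>A. 2 * (ev h y * w y)
        + c i * (ev (mul h i) y * w y) + cnj (c i) * (ev (mul h (cj i)) y * w y))"
      using iX h y by (simp add: ev_mul ev_cj cj_closed sum_distrib_left sum_distrib_right algebra_simps cong: sum.cong)
  qed
  also have "\<dots> = n * (\<Sum>i\<in>A. M (\<lambda>y. 2 * (ev h y * w y) + c i * (ev (mul h i) y * w y)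
      + cnj (c i) * (ev (mul h (cj i)) y * w y)))"
    using b'' by (subst mean_scale) (auto simp: mean_sum)
  also have "\<dots> = n * (\<Sum>i\<in>A. 2 * M (\<lambda>y. ev h y * w y) + c i * M (\<lambda>y. ev (mul h i) y * w y)
        + cnj (c i) * M (\<lambda>y. ev (mul h (cj i)) y * w y))"
    using b b' iX h by (intro arg_cong[where f = "\<lambda>x. n * x"] sum.cong refl)
      (simp add: mean_add mean_scale bounded_fun_on_add mul_closed cj_closed)
  finally show ?thesis unfolding n_def by simp
qed

text \<open>If the coefficients of \<open>w\<close> and \<open>w'\<close> against all
  \<open>ev h\<close> differ by the twist \<open>cnj (\<phi> h)\<close>, they still do after
  multiplication by the two peaks, since the factor \<open>cnj (\<phi> i)\<close> supplies the twist
  of the shifted index.\<close>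

lemma mean_peak_twist:
  assumes \<phi>_mul: "\<And>i j. i \<in> X \<Longrightarrow> j \<in> X \<Longrightarrow> \<phi> (mul i j) = \<phi> i * \<phi> j"
    and \<phi>_cj: "\<And>i. i \<in> X \<Longrightarrow> \<phi> (cj i) = cnj (\<phi> i)"
    and \<phi>_norm: "\<And>i. i \<in> X \<Longrightarrow> cmod (\<phi> i) = 1"
    and w: "bdd w" "bdd w'"
    and eq: "\<And>h. h \<in> X \<Longrightarrow> M (\<lambda>y. ev h y * w y) = cnj (\<phi> h) * M (\<lambda>y. ev h y * w' y)"
  shows "M (\<lambda>y. of_real (peak A (\<lambda>_. 1) y ^ m) * w y)
    = M (\<lambda>y. of_real (peak A (\<lambda>i. cnj (\<phi> i)) y ^ m) * w' y)"
proof -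
  have \<phi>A: "cmod (cnj (\<phi> i)) = 1" if "i \<in> A" for i using that A \<phi>_norm by auto
  \<comment> \<open>The induction carries all \<open>h\<close>, since each factor
    \<open>peak\<close> shifts the index.\<close>
  have *: "\<forall>h\<in>X. M (\<lambda>y. ev h y * (of_real (peak A (\<lambda>_. 1) y ^ m) * w y))
    = cnj (\<phi> h) * M (\<lambda>y. ev h y * (of_real (peak A (\<lambda>i. cnj (\<phi> i)) y ^ m) * w' y))"
  proof (induction m)
    case 0
    then show ?case using eq by simp
  next
    case (Suc m)
    define u where "u y = of_real (peak A (\<lambda>_. 1) y ^ m) * w y" for y
    define v where "v y = of_real (peak A (\<lambda>i. cnj (\<phi> i)) y ^ m) * w' y" for y
    have u: "bdd u" and v: "bdd v"
      unfolding u_def v_def of_real_power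
      using bdd_peak[of "\<lambda>_. 1"] bdd_peak[of "\<lambda>i. cnj (\<phi> i)"] \<phi>A w by auto
    have IH: "M (\<lambda>y. ev h y * u y) = cnj (\<phi> h) * M (\<lambda>y. ev h y * v y)" if "h \<in> X" for h
      using Suc that unfolding u_def v_def by simp
    show ?case
    proof
      fix h assume h: "h \<in> X"
      have "M (\<lambda>y. ev h y * (of_real (peak A (\<lambda>_. 1) y) * u y)) =
         cnj (\<phi> h) * M (\<lambda>y. ev h y * (of_real (peak A (\<lambda>i. cnj (\<phi> i)) y) * v y))"
        unfolding mean_peak_mult[OF u h] mean_peak_mult[OF v h] times_divide_eq_right sum_distrib_left
      proof (intro arg_cong[where f = "\<lambda>x. x / _"] sum.cong refl)
        fix i assume "i \<in> A"
        then have i: "i \<in> X" using A by auto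
        show "2 * M (\<lambda>y. ev h y * u y) + 1 * M (\<lambda>y. ev (mul h i) y * u y) +
            cnj 1 * M (\<lambda>y. ev (mul h (cj i)) y * u y) =
          cnj (\<phi> h) * (2 * M (\<lambda>y. ev h y * v y) + cnj (\<phi> i) * M (\<lambda>y. ev (mul h i) y * v y) +
            cnj (cnj (\<phi> i)) * M (\<lambda>y. ev (mul h (cj i)) y * v y))"
          unfolding IH[OF h] IH[OF mul_closed[OF h i]] IH[OF mul_closed[OF h cj_closed[OF i]]]
            \<phi>_mul[OF h i] \<phi>_mul[OF h cj_closed[OF i]] \<phi>_cj[OF i]
          by (simp only: complex_cnj_mult complex_cnj_cnj complex_cnj_one) (simp only: ring_distribs mult_ac mult_1)
      qed
      then show "M (\<lambda>y. ev h y * (of_real (peak A (\<lambda>_. 1) y ^ Suc m) * w y))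
        = cnj (\<phi> h) * M (\<lambda>y. ev h y * (of_real (peak A (\<lambda>i. cnj (\<phi> i)) y ^ Suc m) * w' y))"
        unfolding u_def v_def by (simp add: mult.assoc)
    qed
  qed
  obtain i where i: "i \<in> X" using X_nonempty by auto
  \<comment> \<open>An index with \<open>ev h = 1\<close> on the carrier and
    \<open>\<phi> h = 1\<close> reads off the plain means.\<close>
  define h where "h = mul i (cj i)"
  have h: "h \<in> X" "\<phi> h = 1" and evh: "\<And>y. y \<in> carrier G \<Longrightarrow> ev h y = 1"
    unfolding h_def using i
    by (simp_all add: mul_closed cj_closed \<phi>_mul \<phi>_cj \<phi>_norm ev_mul ev_cj norm_ev complex_norm_square[symmetric])
  have e: "M (\<lambda>y. ev h y * f y) = M f" for f by (rule mean_cong) (simp add: evh)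
  show ?thesis using *[rule_format, OF h(1)] h(2) unfolding e by simp
qed

text \<open>Pigeonhole: finitely many cells cover \<open>G\<close>, one of them has positive mean,
  and translating by an inverse of one of its points moves it into the neighbourhood of 1.\<close>

lemma mean_Bohr_pos:
  assumes "d > 0"
  shows "0 < Re (M (\<lambda>y. if \<forall>i\<in>A. cmod (ev i y - 1) < d then 1 else 0))"
proof -
  let ?ind = "\<lambda>P y. if P y then 1 else 0 :: complex"
  have bi: "bdd (?ind P)" for P by (rule bounded_fun_onI[of _ _ 1]) simp
  \<comment> \<open>Radius \<open>d/2\<close>, so that two points of one cell have values less than
    \<open>d\<close> apart.\<close>
  obtain T where T: "finite T" "sphere (0::complex) 1 \<subseteq> (\<Union>t\<in>T. ball t (d/2))"
    using compact_imp_seq_compact[OF compact_sphere, THEN seq_compact_imp_totally_bounded] assms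
    by (metis half_gt_zero)
  define cell where "cell y = (\<lambda>i\<in>A. SOME t. t \<in> T \<and> dist t (ev i y) < d/2)" for y
  have cell: "cell y i \<in> T \<and> dist (cell y i) (ev i y) < d/2" if "i \<in> A" "y \<in> carrier G" for i y
  proof -
    have "ev i y \<in> sphere 0 1" using that A norm_ev by auto
    with T(2) have "ev i y \<in> (\<Union>t\<in>T. ball t (d/2))" by blast
    then have "\<exists>t. t \<in> T \<and> dist t (ev i y) < d/2" by (simp add: Bex_def)
    from someI_ex[OF this] show ?thesis using that(1) unfolding cell_def by simp
  qed
  define R where "R = cell ` carrier G"
  have "R \<subseteq> PiE A (\<lambda>_. T)"
    unfolding R_def using cell by (auto simp: PiE_def extensional_def) (simp add: cell_def)
  then have fR: "finite R" using finite_PiE[OF A(1)] T(1) finite_subset by metis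
  have "M (\<lambda>y. \<Sum>t\<in>R. ?ind (\<lambda>y. cell y = t) y) = M (\<lambda>_. 1)"
    by (rule mean_cong) (use fR in \<open>simp add: R_def\<close>)
  then have "(\<Sum>t\<in>R. M (?ind (\<lambda>y. cell y = t))) = 1"
    using bi by (simp add: mean_sum)
  then have "(\<Sum>t\<in>R. Re (M (?ind (\<lambda>y. cell y = t)))) = 1"
    using Re_sum[of "\<lambda>t. M (?ind (\<lambda>y. cell y = t))" R] by simp
  then obtain t where t: "t \<in> R" "0 < Re (M (?ind (\<lambda>y. cell y = t)))"
    by (metis (no_types, lifting) not_less sum_nonpos zero_less_one)
  then obtain y0 where y0: "y0 \<in> carrier G" "t = cell y0" unfolding R_def by auto
  obtain z where z: "z \<in> carrier G" "\<forall>i\<in>X. ev i z = cnj (ev i y0)" using ev_inverse[OF y0(1)] by auto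
  let ?U = "\<lambda>y. \<forall>i\<in>A. cmod (ev i y - 1) < d"
  have "Re (M (?ind (\<lambda>y. cell y = t))) \<le> Re (M (\<lambda>y. ?ind ?U (z \<otimes> y)))"
  proof (rule mean_Re_mono)
    show "bdd (\<lambda>y. ?ind ?U (z \<otimes> y))" by (rule bounded_fun_onI[of _ _ 1]) simp
    fix y assume y: "y \<in> carrier G"
    have "?U (z \<otimes> y)" if "cell y = t"
    proof
      fix i assume i: "i \<in> A"
      then have iX: "i \<in> X" using A by auto
      have "dist (cell y i) (ev i y) < d/2" "dist (cell y i) (ev i y0) < d/2"
        using cell[OF i y] cell[OF i y0(1)] that y0(2) by auto
      then have 1: "cmod (ev i y - ev i y0) < d"
        unfolding dist_norm by norm
      have "ev i (z \<otimes> y) - 1 = cnj (ev i y0) * (ev i y - ev i y0)"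
        using iX y z norm_ev[OF iX y0(1)] complex_norm_square[of "ev i y0"]
        by (simp add: ev_mult algebra_simps)
      then show "cmod (ev i (z \<otimes> y) - 1) < d" using 1 norm_ev[OF iX y0(1)] by (simp add: norm_mult)
    qed
    then show "Re (?ind (\<lambda>y. cell y = t) y) \<le> Re (?ind ?U (z \<otimes> y))" by simp
  qed (rule bi)
  also have "M (\<lambda>y. ?ind ?U (z \<otimes> y)) = M (?ind ?U)"
    by (rule mean_translate[OF z(1)]) (rule bi)
  finally show ?thesis using t(2) by simp
qed

text \<open>\<open>c\<close> is the mean of the neighbourhood itself, hence independent of
  \<open>m\<close>; on it \<open>peak\<close> is at least \<open>1 - d/2\<close>, which
  \<open>d \<le> 2\<close> keeps nonnegative.\<close>

lemma mean_peak_lower: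
  assumes "d > 0" "d \<le> 2"
  obtains c where "c > 0" "\<And>m. c * (1 - d/2) ^ m \<le> Re (M (\<lambda>y. of_real (peak A (\<lambda>_. 1) y ^ m) *
      (if \<forall>i\<in>A. cmod (ev i y - 1) < d then 1 else 0)))"
proof -
  let ?ind = "\<lambda>y. if \<forall>i\<in>A. cmod (ev i y - 1) < d then 1 else 0 :: complex"
  have bi: "bdd ?ind" by (rule bounded_fun_onI[of _ _ 1]) simp
  have "Re (M ?ind) * (1 - d/2) ^ m \<le> Re (M (\<lambda>y. of_real (peak A (\<lambda>_. 1) y ^ m) * ?ind y))" for m
  proof -
    have "Re (M ?ind) * (1 - d/2) ^ m = Re (M (\<lambda>y. of_real ((1 - d/2) ^ m) * ?ind y))"
      unfolding mean_scale[OF bi] by (simp add: mult.commute)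
    also have "\<dots> \<le> Re (M (\<lambda>y. of_real (peak A (\<lambda>_. 1) y ^ m) * ?ind y))"
    proof (rule mean_Re_mono)
      show "bdd (\<lambda>y. of_real (peak A (\<lambda>_. 1) y ^ m) * ?ind y)"
        unfolding of_real_power using bdd_peak[of "\<lambda>_. 1"] bi by auto
      fix y assume y: "y \<in> carrier G"
      show "Re (of_real ((1 - d/2) ^ m) * ?ind y) \<le> Re (of_real (peak A (\<lambda>_. 1) y ^ m) * ?ind y)"
        using peak_ge[OF y, of d] assms power_mono[of "1 - d/2" "peak A (\<lambda>_. 1) y" m] by force
    qed (use bi in auto)
    finally show ?thesis .
  qed
  then show thesis using that mean_Bohr_pos[OF assms(1)] by blast
qed

end

lemma power_ratio_eventually_small:
  fixes c q r :: real
  assumes "0 < c" "0 \<le> q" "q < r"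
  shows "\<exists>m. q ^ m < c * r ^ m"
proof -
  have "(\<lambda>m. (q / r) ^ m) \<longlonglongrightarrow> 0"
    using assms by (intro LIMSEQ_power_zero) simp
  then have "\<forall>\<^sub>F m in sequentially. (q / r) ^ m < c"
    using assms(1) order_tendstoD(2) by blast
  then obtain m where "(q / r) ^ m < c"
    by (auto simp: eventually_sequentially)
  then show ?thesis using assms by (auto simp: power_divide field_simps intro!: exI[of _ m])
qed

text \<open>If no point came within \<open>e\<close>, the twisted peak would be at most
  \<open>1 - d\<close> everywhere and the means of its powers would decay like
  \<open>(1 - d) ^ m\<close>. By \<open>mean_peak_twist\<close> they equal the means of the powers
  of the untwisted peak, which decay no faster than \<open>c * (1 - d/2) ^ m\<close>.\<close>

theorem character_approximation:
  assumes \<phi>_mul: "\<And>i j. i \<in> X \<Longrightarrow> j \<in> X \<Longrightarrow> \<phi> (mul i j) = \<phi> i * \<phi> j"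
    and \<phi>_cj: "\<And>i. i \<in> X \<Longrightarrow> \<phi> (cj i) = cnj (\<phi> i)"
    and \<phi>_norm: "\<And>i. i \<in> X \<Longrightarrow> cmod (\<phi> i) = 1"
    and \<phi>_triv: "\<And>i. i \<in> X \<Longrightarrow> (\<And>y. y \<in> carrier G \<Longrightarrow> ev i y = 1) \<Longrightarrow> \<phi> i = 1"
    and A: "finite A" "A \<subseteq> X" and e: "e > 0"
  shows "\<exists>y\<in>carrier G. \<forall>i\<in>A. cmod (ev i y - \<phi> i) < e"
proof (cases "A = {}")
  case False
  show ?thesis
  proof (rule ccontr)
    assume "\<not> ?thesis"
    then have far: "\<exists>i\<in>A. e \<le> cmod (ev i y - \<phi> i)" if "y \<in> carrier G" for y
      using that by (meson not_less)
    define n where "n = card A"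
    have n: "n \<ge> 1" unfolding n_def using A False by (simp add: Suc_leI card_gt_0_iff)
    define e' where "e' = min e 1"
    have e': "0 < e'" "e' \<le> 1" "e' \<le> e" unfolding e'_def using e by auto
    \<comment> \<open>The loss in \<open>peak_le\<close> at distance \<open>e'\<close>; the same
      number is the radius at which \<open>peak_ge\<close> loses only \<open>d/2\<close>.\<close>
    define d where "d = e'\<^sup>2 / (4 * n)"
    have d: "0 < d" "d \<le> 1"
      using e' n power_le_one[of e' 2] unfolding d_def by (auto simp: field_simps)
    \<comment> \<open>Starting point of the twist: a nontrivial \<open>ev h\<close> has mean 0 by
      invariance, and a trivial one has \<open>\<phi> h = 1\<close>.\<close>
    have mono: "M (\<lambda>y. ev h y * 1) = cnj (\<phi> h) * M (\<lambda>y. ev h y * 1)" if h: "h \<in> X" for h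
    proof (cases "\<forall>y\<in>carrier G. ev h y = 1")
      case True
      then show ?thesis using \<phi>_triv[OF h] by simp
    next
      case False
      then obtain k where k: "k \<in> carrier G" "ev h k \<noteq> 1" by auto
      have "M (ev h) = M (\<lambda>y. ev h (k \<otimes> y))" using mean_translate[OF k(1) bdd_ev[OF h]] by simp
      also have "\<dots> = M (\<lambda>y. ev h k * ev h y)" by (rule mean_cong) (simp add: ev_mult h k)
      also have "\<dots> = ev h k * M (ev h)" by (rule mean_scale[OF bdd_ev[OF h]])
      finally show ?thesis using k(2) by simp
    qed
    have eq: "M (\<lambda>y. of_real (peak A (\<lambda>_. 1) y ^ m) * 1)
        = M (\<lambda>y. of_real (peak A (\<lambda>i. cnj (\<phi> i)) y ^ m) * 1)" for m
      by (rule mean_peak_twist[OF A(1) False A(2) \<phi>_mul \<phi>_cj \<phi>_norm]) (use mono in auto)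
    have c\<phi>: "cmod (cnj (\<phi> i)) = 1" if "i \<in> A" for i using that A \<phi>_norm by auto
    have up: "cmod (M (\<lambda>y. of_real (peak A (\<lambda>i. cnj (\<phi> i)) y ^ m) * 1)) \<le> (1 - d) ^ m" for m
    proof (rule mean_bound)
      fix y assume y: "y \<in> carrier G"
      obtain i where i: "i \<in> A" "e \<le> cmod (ev i y - \<phi> i)" using far[OF y] by auto
      have iX: "i \<in> X" using i A by auto
      have "cnj (\<phi> i) * ev i y - 1 = cnj (\<phi> i) * (ev i y - \<phi> i)"
        using \<phi>_norm[OF iX] complex_norm_square[of "\<phi> i"] by (simp add: algebra_simps)
      then have "e' \<le> cmod (cnj (\<phi> i) * ev i y - 1)"
        using \<phi>_norm[OF iX] i(2) e' by (simp add: norm_mult)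
      then have "peak A (\<lambda>i. cnj (\<phi> i)) y \<le> 1 - d"
        unfolding d_def n_def using peak_le[OF A(1) False A(2), of "\<lambda>i. cnj (\<phi> i)"] c\<phi> y i(1) e' by simp
      then show "cmod (of_real (peak A (\<lambda>i. cnj (\<phi> i)) y ^ m) * 1) \<le> (1 - d) ^ m"
        using peak_nonneg[OF A(1) False A(2), of "\<lambda>i. cnj (\<phi> i)"] c\<phi> y by (simp add: power_mono norm_power)
    qed
    obtain c where c: "c > 0" "\<And>m. c * (1 - d/2) ^ m \<le> Re (M (\<lambda>y. of_real (peak A (\<lambda>_. 1) y ^ m) *
      (if \<forall>i\<in>A. cmod (ev i y - 1) < d then 1 else 0)))"
      using mean_peak_lower[OF A(1) False A(2), of d] d by auto
    have "Re (M (\<lambda>y. of_real (peak A (\<lambda>_. 1) y ^ m) *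
      (if \<forall>i\<in>A. cmod (ev i y - 1) < d then 1 else 0))) \<le> Re (M (\<lambda>y. of_real (peak A (\<lambda>_. 1) y ^ m) * 1))" for m
    proof (rule mean_Re_mono)
      have b: "bdd (\<lambda>y. of_real (peak A (\<lambda>_. 1) y))" using bdd_peak[OF A(1) False A(2), of "\<lambda>_. 1"] by simp
      show "bdd (\<lambda>y. of_real (peak A (\<lambda>_. 1) y ^ m) * 1)" unfolding of_real_power using b by auto
      have "bdd (\<lambda>y. if \<forall>i\<in>A. cmod (ev i y - 1) < d then 1 else 0)" by (rule bounded_fun_onI[of _ _ 1]) simp
      then show "bdd (\<lambda>y. of_real (peak A (\<lambda>_. 1) y ^ m) * (if \<forall>i\<in>A. cmod (ev i y - 1) < d then 1 else 0))"
        unfolding of_real_power using b by auto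
      fix y assume "y \<in> carrier G"
      then show "Re (of_real (peak A (\<lambda>_. 1) y ^ m) * (if \<forall>i\<in>A. cmod (ev i y - 1) < d then 1 else 0))
          \<le> Re (of_real (peak A (\<lambda>_. 1) y ^ m) * 1)"
        using peak_nonneg[OF A(1) False A(2), of "\<lambda>_. 1" y] by simp
    qed
    note lower = order_trans[OF c(2) this]
    have "c * (1 - d/2) ^ m \<le> (1 - d) ^ m" for m
      using order_trans[OF lower complex_Re_le_cmod] order_trans[OF _ up] unfolding eq by blast
    moreover have "\<exists>m. (1 - d) ^ m < c * (1 - d/2) ^ m"
      by (rule power_ratio_eventually_small) (use c d in auto)
    ultimately show False using not_less by metis
  qed
qed auto

text \<open>If \<open>\<psi>\<close> differs from every \<open>ev i\<close>, it is orthogonal to all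
  of them, hence to all powers of the peak; yet these concentrate where \<open>Re (\<psi> y)\<close>
  is at least 1/2.\<close>

theorem character_of_Bohr_continuous:
  assumes \<psi>_mult: "\<And>y z. y \<in> carrier G \<Longrightarrow> z \<in> carrier G \<Longrightarrow> \<psi> (y \<otimes> z) = \<psi> y * \<psi> z"
    and \<psi>_norm: "\<And>y. y \<in> carrier G \<Longrightarrow> cmod (\<psi> y) = 1"
    and A: "finite A" "A \<subseteq> X" and e: "e > 0"
    and near: "\<And>y. y \<in> carrier G \<Longrightarrow> (\<And>i. i \<in> A \<Longrightarrow> cmod (ev i y - 1) < e) \<Longrightarrow> 1/2 \<le> Re (\<psi> y)"
  shows "\<exists>i\<in>X. \<forall>y\<in>carrier G. \<psi> y = ev i y"
proof (rule ccontr)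
  assume none: "\<not> ?thesis"
  have b\<psi>: "bdd \<psi>" by (rule bounded_fun_onI[of _ _ 1]) (simp add: \<psi>_norm)
  \<comment> \<open>Translation by a point where \<open>\<psi>\<close> differs from
    \<open>cnj (ev h)\<close> multiplies this mean by a number other than 1; \<open>cj h\<close> is
    the index with the conjugate values.\<close>
  have zero: "M (\<lambda>y. ev h y * \<psi> y) = 0" if h: "h \<in> X" for h
  proof -
    have "\<exists>k\<in>carrier G. \<psi> k \<noteq> ev (cj h) k" using none cj_closed[OF h] by blast
    then obtain k where k: "k \<in> carrier G" "\<psi> k \<noteq> cnj (ev h k)" using ev_cj[OF h] by auto
    have ne: "ev h k * \<psi> k \<noteq> 1"
    proof
      assume "ev h k * \<psi> k = 1"
      then have "cnj (ev h k) * (ev h k * \<psi> k) = cnj (ev h k)" by simp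
      moreover have "cnj (ev h k) * ev h k = 1"
        using complex_norm_square[of "ev h k"] norm_ev[OF h k(1)] by (simp add: mult.commute)
      ultimately show False using k(2) by (metis mult.assoc mult_1)
    qed
    have b: "bdd (\<lambda>y. ev h y * \<psi> y)" using bdd_ev[OF h] b\<psi> by auto
    have "M (\<lambda>y. ev h y * \<psi> y) = M (\<lambda>y. ev h (k \<otimes> y) * \<psi> (k \<otimes> y))"
      using mean_translate[OF k(1) b] by simp
    also have "\<dots> = M (\<lambda>y. (ev h k * \<psi> k) * (ev h y * \<psi> y))"
      by (rule mean_cong) (simp add: ev_mult \<psi>_mult h k)
    also have "\<dots> = (ev h k * \<psi> k) * M (\<lambda>y. ev h y * \<psi> y)" by (rule mean_scale[OF b])
    finally show ?thesis using ne by simp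
  qed
  obtain i0 where "i0 \<in> X" using X_nonempty by auto
  \<comment> \<open>\<open>A\<close> may be empty, while a peak is taken over a nonempty index
    set.\<close>
  define B where "B = insert i0 A"
  have B: "finite B" "B \<noteq> {}" "B \<subseteq> X" "A \<subseteq> B" unfolding B_def using A \<open>i0 \<in> X\<close> by auto
  define n where "n = card B"
  have n: "n \<ge> 1" unfolding n_def using B by (simp add: Suc_leI card_gt_0_iff)
  define e' where "e' = min e 1"
  have e': "0 < e'" "e' \<le> 1" "e' \<le> e" unfolding e'_def using e by auto
  define d where "d = e'\<^sup>2 / (4 * n)"
  have d: "0 < d" "d \<le> 1" "d \<le> e'"
  proof -
    show "0 < d" "d \<le> 1" using e' n power_le_one[of e' 2] unfolding d_def by (auto simp: field_simps)
    have "e' * e' \<le> e' * 1" using e' by (intro mult_left_mono) auto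
    moreover have "e' * 1 \<le> e' * (4 * n)" using e' n by (intro mult_left_mono) auto
    ultimately show "d \<le> e'" using n unfolding d_def by (simp add: power2_eq_square field_simps)
  qed
  \<comment> \<open>The twist lemma with trivial \<open>\<phi>\<close> and
    \<open>w' = 0\<close>.\<close>
  have eq: "M (\<lambda>y. of_real (peak B (\<lambda>_. 1) y ^ m) * \<psi> y) = 0" for m
    using mean_peak_twist[OF B(1-3), of "\<lambda>_. 1" \<psi> "\<lambda>_. 0"] b\<psi> zero by simp
  let ?ind = "\<lambda>y. if \<forall>i\<in>B. cmod (ev i y - 1) < d then 1 else 0 :: complex"
  obtain c where c: "c > 0" "\<And>m. c * (1 - d/2) ^ m \<le> Re (M (\<lambda>y. of_real (peak B (\<lambda>_. 1) y ^ m) * ?ind y))"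
    using mean_peak_lower[OF B(1-3), of d] d by auto
  have "c / 2 * (1 - d/2) ^ m \<le> (1 - d) ^ m" for m
  proof -
    have b: "bdd (\<lambda>y. of_real (peak B (\<lambda>_. 1) y ^ m))"
      unfolding of_real_power using bdd_peak[OF B(1-3), of "\<lambda>_. 1"] by auto
    have bi: "bdd ?ind" by (rule bounded_fun_onI[of _ _ 1]) simp
    have b2: "bdd (\<lambda>y. of_real (peak B (\<lambda>_. 1) y ^ m) * ?ind y)" using b bi by auto
    \<comment> \<open>Pointwise comparison: within \<open>e'\<close> the factor
      \<open>Re (\<psi> y)\<close> is at least 1/2; elsewhere the indicator vanishes because
      \<open>d \<le> e'\<close>, and the power of the peak is at most
      \<open>(1 - d) ^ m\<close>.\<close>
    have "Re (M (\<lambda>y. (1/2) * (of_real (peak B (\<lambda>_. 1) y ^ m) * ?ind y) - of_real ((1 - d) ^ m)))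
      \<le> Re (M (\<lambda>y. of_real (peak B (\<lambda>_. 1) y ^ m) * \<psi> y))"
    proof (rule mean_Re_mono)
      fix y assume y: "y \<in> carrier G"
      define F where "F = peak B (\<lambda>_. 1) y"
      have F: "0 \<le> F" "F \<le> 1"
        unfolding F_def using peak_nonneg[OF B(1-3) _ y] peak_le_1[OF B(1-3) _ y] by auto
      have q: "0 \<le> (1 - d) ^ m" "0 \<le> F ^ m" using d F by auto
      show "Re ((1/2) * (of_real (peak B (\<lambda>_. 1) y ^ m) * ?ind y) - of_real ((1 - d) ^ m))
        \<le> Re (of_real (peak B (\<lambda>_. 1) y ^ m) * \<psi> y)"
      proof (cases "\<forall>i\<in>B. cmod (ev i y - 1) < e'")
        case True
        have "1/2 \<le> Re (\<psi> y)" by (rule near[OF y]) (use True B(4) e' in force)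
        then have "F ^ m * (1/2) \<le> F ^ m * Re (\<psi> y)" using q by (intro mult_left_mono) auto
        then show ?thesis using q unfolding F_def[symmetric] by auto
      next
        case False
        then obtain i where i: "i \<in> B" "e' \<le> cmod (ev i y - 1)" by (auto simp: not_less)
        then have "F \<le> 1 - d"
          unfolding F_def d_def n_def using peak_le[OF B(1-3), of "\<lambda>_. 1" y i e'] y e' by simp
        then have "F ^ m \<le> (1 - d) ^ m" using F by (intro power_mono) auto
        moreover have "\<bar>F ^ m * Re (\<psi> y)\<bar> \<le> F ^ m * 1"
          unfolding abs_mult using q abs_Re_le_cmod[of "\<psi> y"] \<psi>_norm[OF y]
          by (intro mult_mono) auto
        moreover have "?ind y = 0" using i d(3) by force
        ultimately show ?thesis unfolding F_def[symmetric] by simp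
      qed
    qed (intro bounded_fun_on_diff bounded_fun_on_mult bounded_fun_on_const b b2 b\<psi>)+
    then have "Re (M (\<lambda>y. (1/2) * (of_real (peak B (\<lambda>_. 1) y ^ m) * ?ind y) - of_real ((1 - d) ^ m))) \<le> 0"
      unfolding eq by simp
    moreover have "M (\<lambda>y. (1/2) * (of_real (peak B (\<lambda>_. 1) y ^ m) * ?ind y) - of_real ((1 - d) ^ m))
        = (1/2) * M (\<lambda>y. of_real (peak B (\<lambda>_. 1) y ^ m) * ?ind y) - of_real ((1 - d) ^ m)"
      unfolding mean_diff[OF bounded_fun_on_mult[OF bounded_fun_on_const b2] bounded_fun_on_const]
        mean_scale[OF b2] mean_const ..
    ultimately show ?thesis using c(2)[of m] by simp
  qed
  moreover have "\<exists>m. (1 - d) ^ m < c / 2 * (1 - d/2) ^ m"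
    by (rule power_ratio_eventually_small) (use c d in auto)
  ultimately show False using not_less by metis
qed

end

section \<open>Characters of compact abelian groups\<close>

text \<open>Tube lemma: the complement is the projection of a closed set along the compact
  factor.\<close>

lemma openin_forall_compact_space:
  assumes "compact_space Y" "openin (prod_topology X Y) W"
  shows "openin X {x \<in> topspace X. \<forall>y\<in>topspace Y. (x, y) \<in> W}"
proof -
  have "closedin X (fst ` (topspace (prod_topology X Y) - W))"
    using Abstract_Topological_Spaces.closed_map_fst[OF assms(1)] assms(2)
    unfolding closed_map_def by blast
  then have "openin X (topspace X - fst ` (topspace (prod_topology X Y) - W))" by blast
  also have "topspace X - fst ` (topspace (prod_topology X Y) - W)
      = {x \<in> topspace X. \<forall>y\<in>topspace Y. (x, y) \<in> W}"
    by (auto simp: image_iff) force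
  finally show ?thesis .
qed

lemma compact_space_indexed_cover:
  assumes "compact_space X" "\<And>i. i \<in> I \<Longrightarrow> openin X (U i)" "topspace X \<subseteq> (\<Union>i\<in>I. U i)"
  obtains J where "finite J" "J \<subseteq> I" "topspace X \<subseteq> (\<Union>i\<in>J. U i)"
proof -
  have "\<exists>F. finite F \<and> F \<subseteq> U ` I \<and> topspace X \<subseteq> \<Union>F"
    using assms(1)[unfolded compact_space_alt, rule_format, of "U ` I"] assms(2,3) by auto
  then obtain F where F: "finite F" "F \<subseteq> U ` I" "topspace X \<subseteq> \<Union>F" by blast
  obtain J where "J \<subseteq> I" "finite J" "F = U ` J"
    using finite_subset_image[OF F(1,2)] by blast
  then show thesis using that[of J] F(3) by simp
qed

lemma continuous_map_euclidean_compose: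
  assumes "continuous_map X euclidean f" "continuous_on UNIV g"
  shows "continuous_map X euclidean (\<lambda>x. g (f x))"
  using continuous_map_compose[OF assms(1), of euclidean g] assms(2) by (simp add: o_def)

lemma continuous_map_complex_mult:
  fixes f g :: "'a \<Rightarrow> complex"
  assumes "continuous_map X euclidean f" "continuous_map X euclidean g"
  shows "continuous_map X euclidean (\<lambda>x. f x * g x)"
  using assms by (simp add: continuous_map_atin tendsto_mult)

lemma continuous_map_complexI:
  fixes f :: "'a \<Rightarrow> complex"
  assumes "\<And>x e. x \<in> topspace X \<Longrightarrow> e > 0 \<Longrightarrow> \<exists>U. openin X U \<and> x \<in> U \<and> (\<forall>y\<in>U. cmod (f y - f x) < e)"
  shows "continuous_map X euclidean f"
  unfolding continuous_map_def
proof (intro conjI allI impI)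
  show "f \<in> topspace X \<rightarrow> topspace euclidean" by simp
  fix V :: "complex set" assume "openin euclidean V"
  then have V: "open V" by simp
  show "openin X {x \<in> topspace X. f x \<in> V}"
  proof (subst openin_subopen, intro ballI)
    fix x assume x: "x \<in> {x \<in> topspace X. f x \<in> V}"
    then obtain e where e: "e > 0" "ball (f x) e \<subseteq> V" using V open_contains_ball by blast
    obtain U where U: "openin X U" "x \<in> U" "\<forall>y\<in>U. cmod (f y - f x) < e"
      using assms[of x e] x e(1) by auto
    then have "U \<subseteq> {x \<in> topspace X. f x \<in> V}"
      using e(2) openin_subset[OF U(1)] by (auto simp: dist_norm norm_minus_commute subset_iff)
    then show "\<exists>U. openin X U \<and> x \<in> U \<and> U \<subseteq> {x \<in> topspace X. f x \<in> V}" using U by blast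
  qed
qed

lemma openin_continuous_less:
  fixes f :: "'a \<Rightarrow> real"
  assumes "continuous_map X euclidean f"
  shows "openin X {x \<in> topspace X. f x < c}" "openin X {x \<in> topspace X. c < f x}"
  using openin_continuous_map_preimage[OF assms, of "{..<c}"]
    openin_continuous_map_preimage[OF assms, of "{c<..}"] by auto

lemma closed_pointwise_le:
  fixes f g :: "'i \<Rightarrow> 'z::topological_space \<Rightarrow> real"
  assumes "\<And>i. continuous_on UNIV (f i)" "\<And>i. continuous_on UNIV (g i)"
  shows "closed {z. \<forall>i. P i \<longrightarrow> f i z \<le> g i z}"
  by (rule closed_Collect_all, rule closed_Collect_imp[OF open_Collect_const],
      rule closed_Collect_le; rule assms)

lemma closed_pointwise_eq:
  fixes f g :: "'i \<Rightarrow> 'z::topological_space \<Rightarrow> complex"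
  assumes "\<And>i. continuous_on UNIV (f i)" "\<And>i. continuous_on UNIV (g i)"
  shows "closed {z. \<forall>i. P i \<longrightarrow> f i z = g i z}"
  by (rule closed_Collect_all, rule closed_Collect_imp[OF open_Collect_const],
      rule closed_Collect_eq; rule assms)

lemma continuous_on_fst_eval: "continuous_on S (\<lambda>z. fst z x)"
  by (rule continuous_on_compose2[of UNIV "\<lambda>f. f x" S fst, OF continuous_on_eval
        continuous_on_fst[OF continuous_on_id]]) simp

lemma continuous_on_snd_eval: "continuous_on S (\<lambda>z. snd z x)"
  by (rule continuous_on_compose2[of UNIV "\<lambda>f. f x" S snd, OF continuous_on_eval
        continuous_on_snd[OF continuous_on_id]]) simp

section \<open>Uniform closeness of translates in a compact group\<close>

locale compact_abelian_group = comm_group G for G :: "('a, 'b) monoid_scheme" (structure) +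
  fixes T :: "'a topology"
  assumes topspace_T: "topspace T = carrier G"
    and compact_T: "compact_space T"
    and Hausdorff_T: "Hausdorff_space T"
    and continuous_mult_T: "continuous_map (prod_topology T T) T (\<lambda>(x, y). x \<otimes> y)"
    and continuous_inv_T: "continuous_map T T (\<lambda>x. inv x)"
begin

lemma continuous_map_mult_comp:
  assumes "continuous_map Z T f" "continuous_map Z T g"
  shows "continuous_map Z T (\<lambda>z. f z \<otimes> g z)"
  using continuous_map_compose[OF continuous_map_pairedI[OF assms] continuous_mult_T] by (simp add: o_def)

lemma continuous_map_inv_comp:
  assumes "continuous_map Z T f"
  shows "continuous_map Z T (\<lambda>z. inv (f z))"
  using continuous_map_compose[OF assms continuous_inv_T] by (simp add: o_def)

lemma continuous_map_translate:
  "c \<in> carrier G \<Longrightarrow> continuous_map T T (\<lambda>x. c \<otimes> x)"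
  "c \<in> carrier G \<Longrightarrow> continuous_map T T (\<lambda>x. x \<otimes> c)"
  by (intro continuous_map_mult_comp; simp add: topspace_T continuous_map_id[unfolded id_def])+

lemma finite_translates_cover:
  assumes U: "openin T U" "u \<in> U"
  obtains C where "finite C" "C \<subseteq> carrier G" "\<And>y. y \<in> carrier G \<Longrightarrow> \<exists>c\<in>C. c \<otimes> y \<in> U"
proof -
  have u: "u \<in> carrier G" using U openin_subset topspace_T by blast
  define V where "V c = {y \<in> topspace T. c \<otimes> y \<in> U}" for c
  have "openin T (V c)" if "c \<in> carrier G" for c
    unfolding V_def by (rule openin_continuous_map_preimage[OF continuous_map_translate(1)[OF that] U(1)])
  moreover have "topspace T \<subseteq> \<Union> (V ` carrier G)"
  proof
    fix y assume y: "y \<in> topspace T"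
    then have "y \<in> V (u \<otimes> inv y)" using u U(2) unfolding V_def topspace_T by (simp add: m_assoc)
    then show "y \<in> \<Union> (V ` carrier G)" using y u topspace_T by auto
  qed
  ultimately obtain C where C: "finite C" "C \<subseteq> carrier G" "topspace T \<subseteq> \<Union> (V ` C)"
    using compact_space_indexed_cover[OF compact_T, of "carrier G" V] by metis
  show thesis by (rule that[OF C(1,2)]) (use C(3) in \<open>auto simp: V_def topspace_T\<close>)
qed

text \<open>The modulus of continuity that \<open>conv k p\<close> inherits from \<open>k\<close>,
  whatever the bounded function \<open>p\<close> is.\<close>

definition near :: "('a \<Rightarrow> complex) \<Rightarrow> real \<Rightarrow> 'a \<Rightarrow> 'a \<Rightarrow> bool" where
  "near k e x x' \<longleftrightarrow> (\<forall>z\<in>carrier G. cmod (k (x' \<otimes> z) - k (x \<otimes> z)) \<le> e)"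

lemma near_neighbourhood:
  assumes k: "continuous_map T euclidean k" and x: "x \<in> carrier G" and e: "e > 0"
  obtains U where "openin T U" "x \<in> U" "\<And>y. y \<in> U \<Longrightarrow> near k e x y"
proof -
  define W where "W = {w \<in> topspace (prod_topology T T). cmod (k (fst w \<otimes> snd w) - k (x \<otimes> snd w)) < e}"
  have "continuous_map (prod_topology T T) euclidean (\<lambda>w. k (fst w \<otimes> snd w))"
    "continuous_map (prod_topology T T) euclidean (\<lambda>w. k (x \<otimes> snd w))"
    by (rule continuous_map_compose[OF _ k, unfolded o_def];
        intro continuous_map_mult_comp continuous_map_fst continuous_map_snd; simp add: topspace_T x)+
  then have "openin (prod_topology T T) W"
    unfolding W_def by (intro openin_continuous_less continuous_map_norm continuous_map_diff)
  from openin_forall_compact_space[OF compact_T this]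
  show thesis
    by (rule that) (use x e in \<open>auto simp: W_def topspace_T near_def\<close>)
qed

text \<open>Total boundedness for the pseudometric behind \<open>near\<close>; for an equicontinuous
  family, values on \<open>R\<close> control values on the whole group.\<close>

lemma near_finite_net:
  assumes k: "continuous_map T euclidean k" and e: "e > 0"
  obtains R where "finite R" "R \<subseteq> carrier G" "\<And>x. x \<in> carrier G \<Longrightarrow> \<exists>r\<in>R. near k e r x"
proof -
  have "\<forall>x\<in>carrier G. \<exists>U. openin T U \<and> x \<in> U \<and> (\<forall>y\<in>U. near k e x y)"
    using near_neighbourhood[OF k _ e] by metis
  then obtain U where U: "\<And>x. x \<in> carrier G \<Longrightarrow> openin T (U x) \<and> x \<in> U x \<and> (\<forall>y\<in>U x. near k e x y)"
    by metis
  have "topspace T \<subseteq> \<Union> (U ` carrier G)" using U topspace_T by auto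
  then obtain R where R: "finite R" "R \<subseteq> carrier G" "topspace T \<subseteq> \<Union> (U ` R)"
    using compact_space_indexed_cover[OF compact_T, of "carrier G" U] U by metis
  show thesis
  proof (rule that[OF R(1,2)])
    fix x assume "x \<in> carrier G"
    then obtain r where "r \<in> R" "x \<in> U r" using R(3) topspace_T by blast
    then show "\<exists>r\<in>R. near k e r x" using U R(2) by blast
  qed
qed

end

locale compact_abelian_group_mean = compact_abelian_group G T + invariant_mean G M
  for G :: "('a, 'b) monoid_scheme" (structure) and T M
begin

lemma bdd_indicator: "bdd (\<lambda>y. if P y then 1 else 0)"
  by (rule bounded_fun_onI[of _ _ 1]) simp

lemma bdd_translate: "bdd f \<Longrightarrow> c \<in> carrier G \<Longrightarrow> bdd (\<lambda>x. f (c \<otimes> x))"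
  by (rule bounded_fun_on_comp) auto

lemma mean_translate_right: "c \<in> carrier G \<Longrightarrow> bdd f \<Longrightarrow> M (\<lambda>x. f (x \<otimes> c)) = M f"
  using mean_translate[of c f] mean_cong[of "\<lambda>x. f (x \<otimes> c)" "\<lambda>x. f (c \<otimes> x)"] by (simp add: m_comm)

text \<open>All translates of \<open>f\<close> have the same mean, so taking means in the covering
  inequality multiplies it by their number.\<close>

lemma mean_cover_lower:
  assumes C: "finite C" "C \<subseteq> carrier G" and f: "bdd f" and g: "bdd g"
    and le: "\<And>y. y \<in> carrier G \<Longrightarrow> Re (g y) \<le> (\<Sum>c\<in>C. Re (f (c \<otimes> y)))"
  shows "Re (M g) \<le> card C * Re (M f)"
proof -
  have b: "bdd (\<lambda>y. f (c \<otimes> y))" if "c \<in> C" for c using bdd_translate[OF f] that C by auto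
  have "Re (M g) \<le> Re (M (\<lambda>y. \<Sum>c\<in>C. f (c \<otimes> y)))"
    by (rule mean_Re_mono[OF g]) (use le b in \<open>auto simp: Re_sum\<close>)
  also have "M (\<lambda>y. \<Sum>c\<in>C. f (c \<otimes> y)) = (\<Sum>c\<in>C. M (\<lambda>y. f (c \<otimes> y)))"
    using b by (rule mean_sum)
  also have "\<dots> = (\<Sum>c\<in>C. M f)"
    by (intro sum.cong refl mean_translate f) (use C in auto)
  finally show ?thesis by simp
qed

text \<open>Finitely many translates of \<open>U\<close> cover the group; this plays the part of the
  full support of Haar measure.\<close>

lemma mean_indicator_pos:
  assumes U: "openin T U" "u \<in> U"
  shows "0 < Re (M (\<lambda>y. if y \<in> U then 1 else 0))"
proof -
  obtain C where C: "finite C" "C \<subseteq> carrier G" "\<And>y. y \<in> carrier G \<Longrightarrow> \<exists>c\<in>C. c \<otimes> y \<in> U"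
    using finite_translates_cover[OF U] by blast
  have "Re (M (\<lambda>_. 1)) \<le> card C * Re (M (\<lambda>y. if y \<in> U then 1 else 0))"
  proof (rule mean_cover_lower[OF C(1,2) bdd_indicator bounded_fun_on_const])
    fix y assume "y \<in> carrier G"
    then obtain c where "c \<in> C" "c \<otimes> y \<in> U" using C(3) by blast
    then show "Re 1 \<le> (\<Sum>c\<in>C. Re (if c \<otimes> y \<in> U then 1 else 0))"
      using member_le_sum[of c C "\<lambda>c. Re (if c \<otimes> y \<in> U then 1 else 0)"] C(1) by simp
  qed
  then have "1 \<le> card C * Re (M (\<lambda>y. if y \<in> U then 1 else 0))" by simp
  then show ?thesis
    using mult_nonneg_nonpos[of "real (card C)" "Re (M (\<lambda>y. if y \<in> U then 1 else 0))"] by linarith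
qed

lemma bdd_continuous:
  assumes "continuous_map T euclidean f"
  shows "bdd f"
proof -
  have "compactin euclidean (f ` topspace T)"
    using image_compactin[OF _ assms] compact_T unfolding compact_space_def by blast
  then have "bounded (f ` carrier G)" using compact_imp_bounded topspace_T by simp
  then show ?thesis unfolding bounded_iff bounded_fun_on_def by auto
qed

section \<open>Mean squares, the squared L2 seminorm of the mean\<close>

definition msq :: "('a \<Rightarrow> complex) \<Rightarrow> real" where
  "msq f = Re (M (\<lambda>x. of_real ((cmod (f x))\<^sup>2)))"

lemma bdd_msq: "bdd f \<Longrightarrow> bdd (\<lambda>x. of_real ((cmod (f x))\<^sup>2))"
  using bounded_fun_on_mult[of "carrier G" f "\<lambda>x. cnj (f x)"]
  by (auto simp: complex_norm_square[symmetric])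

lemma msq_nonneg: "bdd f \<Longrightarrow> 0 \<le> msq f"
  unfolding msq_def by (rule mean_Re_nonneg[OF bdd_msq]) auto

lemma msq_cong: "(\<And>x. x \<in> carrier G \<Longrightarrow> f x = g x) \<Longrightarrow> msq f = msq g"
  unfolding msq_def by (intro arg_cong[where f = Re] mean_cong) simp

lemma msq_scale: "bdd f \<Longrightarrow> msq (\<lambda>x. c * f x) = (cmod c)\<^sup>2 * msq f"
  unfolding msq_def by (simp add: norm_mult power_mult_distrib mean_scale[OF bdd_msq[unfolded of_real_power]])

text \<open>The modulus of \<open>f\<close> exceeds half of |f x| on a nonempty open set, which has
  positive mean.\<close>

lemma msq_pos:
  assumes f: "continuous_map T euclidean f" and x: "x \<in> carrier G" "f x \<noteq> 0"
  shows "0 < msq f"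
proof -
  define U where "U = {y \<in> topspace T. cmod (f x) / 2 < cmod (f y)}"
  define r where "r = (cmod (f x) / 2)\<^sup>2"
  have r: "r > 0" unfolding r_def using x(2) by simp
  have "openin T U"
    unfolding U_def by (intro openin_continuous_less(2) continuous_map_norm f)
  moreover have "x \<in> U" unfolding U_def using x by (simp add: topspace_T)
  ultimately have U: "openin T U" "x \<in> U" .
  have "0 < r * Re (M (\<lambda>y. if y \<in> U then 1 else 0))"
    using mean_indicator_pos[OF U] r by simp
  also have "\<dots> = Re (M (\<lambda>y. of_real r * (if y \<in> U then 1 else 0)))"
    unfolding mean_scale[OF bdd_indicator] by simp
  also have "\<dots> \<le> msq f"
    unfolding msq_def
  proof (rule mean_Re_mono[OF bounded_fun_on_mult[OF bounded_fun_on_const bdd_indicator] bdd_msq[OF bdd_continuous[OF f]]])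
    fix y assume "y \<in> carrier G"
    show "Re (of_real r * (if y \<in> U then 1 else 0)) \<le> Re (of_real ((cmod (f y))\<^sup>2))"
      unfolding r_def U_def by (auto intro!: power_mono simp del: of_real_power)
  qed
  finally show ?thesis .
qed

text \<open>Continuous characters come from an extremal problem. The pairs \<open>(p, k * p)\<close> of a positive definite
  function and its convolution with a fixed continuous function generate a pointwise compact set once
  \<open>p\<close> is normalised by \<open>p 1 = 1\<close>; no continuity of \<open>p\<close> is required, while the second components are
  equicontinuous. At a maximiser of a strictly convex function of the second component, the first
  component is multiplicative.\<close>

definition conv :: "('a \<Rightarrow> complex) \<Rightarrow> ('a \<Rightarrow> complex) \<Rightarrow> 'a \<Rightarrow> complex" where
  "conv k p x = M (\<lambda>y. k (x \<otimes> inv y) * p y)"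

text \<open>The convolution is stored as a second component because a finitely additive mean need
  not respect pointwise limits: nothing guarantees that it is still \<open>conv k p\<close> in the
  closure, but the bounds and the symmetries used later are kept.\<close>

definition pd_cone :: "('a \<Rightarrow> complex) \<Rightarrow> (('a \<Rightarrow> complex) \<times> ('a \<Rightarrow> complex)) set" where
  "pd_cone k = {(p, q). \<exists>g. bdd g \<and>
     p = (\<lambda>x. if x \<in> carrier G then M (\<lambda>y. g (x \<otimes> y) * cnj (g y)) else 0) \<and>
     q = (\<lambda>x. if x \<in> carrier G then conv k p x else 0)}"

text \<open>If \<open>p\<close> is the autocorrelation of \<open>g\<close> and |c| = 1, this is the
  autocorrelation of \<open>g y + c * g (b \<otimes> y)\<close>. The pieces for \<open>c\<close> and
  \<open>-c\<close> add up to \<open>4 * p\<close>, so they decompose \<open>p\<close> inside the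
  cone.\<close>

definition split_fun :: "complex \<Rightarrow> 'a \<Rightarrow> ('a \<Rightarrow> complex) \<Rightarrow> 'a \<Rightarrow> complex" where
  "split_fun c b p x =
     (if x \<in> carrier G then 2 * p x + c * p (x \<otimes> b) + cnj c * p (x \<otimes> inv b) else 0)"

lemma bdd_pd:
  assumes "bdd g"
  shows "bdd (\<lambda>x. if x \<in> carrier G then M (\<lambda>y. g (x \<otimes> y) * cnj (g y)) else 0)"
proof -
  obtain C where C: "\<And>x. x \<in> carrier G \<Longrightarrow> cmod (g x) \<le> C" using assms by (rule bounded_fun_onE) blast
  have C0: "0 \<le> C" using C[OF one_closed] norm_ge_zero order_trans by blast
  show ?thesis
    by (rule bounded_fun_onI[of _ _ "C * C"])
      (auto intro!: mean_bound mult_mono C C0 simp: norm_mult)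
qed

lemma bdd_conv_integrand:
  assumes "bdd k" "bdd p" "x \<in> carrier G"
  shows "bdd (\<lambda>y. k (x \<otimes> inv y) * p y)"
  by (intro bounded_fun_on_mult assms(2) bounded_fun_on_comp[OF assms(1)]) (use assms(3) in auto)

text \<open>Expanding the autocorrelation of \<open>g'\<close> gives two diagonal terms equal to
  \<open>p x\<close>, because \<open>c * cnj c = 1\<close>, and two cross terms that are translates
  of \<open>p\<close>; convolution commutes with translation.\<close>

lemma pd_cone_split:
  assumes k: "bdd k" and c: "cmod c = 1" and b: "b \<in> carrier G" and z: "(p, q) \<in> pd_cone k"
  shows "(split_fun c b p, split_fun c b q) \<in> pd_cone k"
proof -
  from z obtain g where g: "bdd g"
    and p: "p = (\<lambda>x. if x \<in> carrier G then M (\<lambda>y. g (x \<otimes> y) * cnj (g y)) else 0)"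
    and q: "q = (\<lambda>x. if x \<in> carrier G then conv k p x else 0)"
    unfolding pd_cone_def by auto
  have bp: "bdd p" unfolding p by (rule bdd_pd[OF g])
  have cc: "c * cnj c = 1" using c complex_norm_square[of c] by simp
  define g' where "g' y = g y + c * g (b \<otimes> y)" for y
  have gs: "bdd (\<lambda>y. g (d \<otimes> y))" if "d \<in> carrier G" for d using bdd_translate[OF g that] .
  have g': "bdd g'" unfolding g'_def by (intro bounded_fun_on_add bounded_fun_on_mult bounded_fun_on_const g gs b)
  \<comment> \<open>Substituting \<open>e \<otimes> y\<close> for \<open>y\<close> by invariance:
    only the quotient \<open>d \<otimes> inv e\<close> matters.\<close>
  have corr: "M (\<lambda>y. g (d \<otimes> y) * cnj (g (e \<otimes> y))) = p (d \<otimes> inv e)"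
    if de: "d \<in> carrier G" "e \<in> carrier G" for d e
  proof -
    have "M (\<lambda>y. g (d \<otimes> y) * cnj (g (e \<otimes> y))) = M (\<lambda>y. g ((d \<otimes> inv e) \<otimes> (e \<otimes> y)) * cnj (g (e \<otimes> y)))"
      by (rule mean_cong) (use de in \<open>simp add: m_assoc[symmetric], simp add: m_assoc\<close>)
    also have "\<dots> = M (\<lambda>y. g ((d \<otimes> inv e) \<otimes> y) * cnj (g y))"
      using mean_translate[of e "\<lambda>y. g ((d \<otimes> inv e) \<otimes> y) * cnj (g y)"] de
        bounded_fun_on_mult[OF gs bounded_fun_on_cnj[OF g], of "d \<otimes> inv e"] by simp
    finally show ?thesis unfolding p using de by simp
  qed
  have "split_fun c b p = (\<lambda>x. if x \<in> carrier G then M (\<lambda>y. g' (x \<otimes> y) * cnj (g' y)) else 0)"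
  proof
    fix x
    show "split_fun c b p x = (if x \<in> carrier G then M (\<lambda>y. g' (x \<otimes> y) * cnj (g' y)) else 0)"
    proof (cases "x \<in> carrier G")
      case x: True
      have bb: "bdd (\<lambda>y. e * (g (d \<otimes> y) * cnj (g (d' \<otimes> y))))" if "d \<in> carrier G" "d' \<in> carrier G" for d d' e
        by (intro bounded_fun_on_mult bounded_fun_on_const bounded_fun_on_cnj gs that)
      have "M (\<lambda>y. g' (x \<otimes> y) * cnj (g' y)) =
        M (\<lambda>y. (1 * (g (x \<otimes> y) * cnj (g (\<one> \<otimes> y))) + 1 * (g ((b \<otimes> x) \<otimes> y) * cnj (g (b \<otimes> y))))
          + (c * (g ((b \<otimes> x) \<otimes> y) * cnj (g (\<one> \<otimes> y))) + cnj c * (g (x \<otimes> y) * cnj (g (b \<otimes> y)))))"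
      proof (rule mean_cong)
        fix y assume y: "y \<in> carrier G"
        have "(G0 + c * G1) * (H0 + cnj c * H1) = (1 * (G0 * H0) + 1 * (G1 * H1)) + (c * (G1 * H0) + cnj c * (G0 * H1))" for G0 G1 H0 H1
          using cc by (simp add: algebra_simps)
        from this[of "g (x \<otimes> y)" "g (b \<otimes> x \<otimes> y)" "cnj (g y)" "cnj (g (b \<otimes> y))"]
        show "g' (x \<otimes> y) * cnj (g' y) =
          (1 * (g (x \<otimes> y) * cnj (g (\<one> \<otimes> y))) + 1 * (g ((b \<otimes> x) \<otimes> y) * cnj (g (b \<otimes> y))))
          + (c * (g ((b \<otimes> x) \<otimes> y) * cnj (g (\<one> \<otimes> y))) + cnj c * (g (x \<otimes> y) * cnj (g (b \<otimes> y))))"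
          unfolding g'_def using x y b by (simp add: m_assoc)
      qed
      also have "\<dots> = (1 * p (x \<otimes> inv \<one>) + 1 * p ((b \<otimes> x) \<otimes> inv b))
          + (c * p ((b \<otimes> x) \<otimes> inv \<one>) + cnj c * p (x \<otimes> inv b))"
        using x b by (simp only: mean_add bounded_fun_on_add bb mean_scale[OF bb[where e = 1, unfolded mult_1]] corr m_closed one_closed)
      also have "(b \<otimes> x) \<otimes> inv b = x" using x b by (metis inv_closed m_assoc m_comm r_inv r_one)
      finally show ?thesis
        unfolding split_fun_def using x b by (simp add: m_comm)
    qed (simp add: split_fun_def)
  qed
  moreover have "split_fun c b q = (\<lambda>x. if x \<in> carrier G then conv k (split_fun c b p) x else 0)"
  proof
    fix x
    show "split_fun c b q x = (if x \<in> carrier G then conv k (split_fun c b p) x else 0)"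
    proof (cases "x \<in> carrier G")
      case x: True
      have bb: "bdd (\<lambda>y. e * (k (x \<otimes> inv y) * p (y \<otimes> d)))" if "d \<in> carrier G" for d e
        by (intro bounded_fun_on_mult bounded_fun_on_const bounded_fun_on_comp[OF k] bounded_fun_on_comp[OF bp])
          (use x that in auto)
      have sh: "M (\<lambda>y. k (x \<otimes> inv y) * p (y \<otimes> d)) = conv k p (x \<otimes> d)" if d: "d \<in> carrier G" for d
      proof -
        have "M (\<lambda>y. k (x \<otimes> inv y) * p (y \<otimes> d)) = M (\<lambda>y. k ((x \<otimes> d) \<otimes> inv (y \<otimes> d)) * p (y \<otimes> d))"
        proof (rule mean_cong)
          fix y assume y: "y \<in> carrier G"
          have "(x \<otimes> d) \<otimes> inv (y \<otimes> d) = (x \<otimes> inv y) \<otimes> (d \<otimes> inv d)"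
            unfolding inv_mult[OF y d] using x y d by (simp only: m_ac m_closed inv_closed)
          then have "(x \<otimes> d) \<otimes> inv (y \<otimes> d) = x \<otimes> inv y" using x y d by simp
          then show "k (x \<otimes> inv y) * p (y \<otimes> d) = k ((x \<otimes> d) \<otimes> inv (y \<otimes> d)) * p (y \<otimes> d)" by simp
        qed
        also have "\<dots> = M (\<lambda>y. k ((x \<otimes> d) \<otimes> inv y) * p y)"
          by (rule mean_translate_right[OF d bdd_conv_integrand[OF k bp]]) (use x d in simp)
        finally show ?thesis unfolding conv_def .
      qed
      have "conv k (split_fun c b p) x = M (\<lambda>y. (2 * (k (x \<otimes> inv y) * p (y \<otimes> \<one>))
          + c * (k (x \<otimes> inv y) * p (y \<otimes> b))) + cnj c * (k (x \<otimes> inv y) * p (y \<otimes> inv b)))"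
        unfolding conv_def by (rule mean_cong) (simp add: split_fun_def algebra_simps)
      also have "\<dots> = 2 * conv k p (x \<otimes> \<one>) + c * conv k p (x \<otimes> b) + cnj c * conv k p (x \<otimes> inv b)"
        using b by (simp only: mean_add bounded_fun_on_add bb mean_scale[OF bb[where e = 1, unfolded mult_1]] sh
            one_closed inv_closed)
      finally show ?thesis using x b by (simp add: split_fun_def[of c b "\<lambda>x. if x \<in> carrier G then conv k p x else 0"] q)
    qed (simp add: split_fun_def)
  qed
  ultimately show ?thesis
    unfolding pd_cone_def mem_Collect_eq prod.case using g' by blast
qed

definition scale_fun :: "real \<Rightarrow> ('a \<Rightarrow> complex) \<Rightarrow> 'a \<Rightarrow> complex" where
  "scale_fun s p x = of_real s * p x"

lemma conv_scale: "bdd k \<Longrightarrow> bdd p \<Longrightarrow> x \<in> carrier G \<Longrightarrow> conv k (\<lambda>y. s * p y) x = s * conv k p x"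
  unfolding conv_def using mean_scale[OF bdd_conv_integrand[of k p x], of s]
  by (simp add: mult.left_commute)

lemma pd_cone_scale:
  assumes k: "bdd k" and s: "0 \<le> s" and z: "(p, q) \<in> pd_cone k"
  shows "(scale_fun s p, scale_fun s q) \<in> pd_cone k"
proof -
  from z obtain g where g: "bdd g"
    and p: "p = (\<lambda>x. if x \<in> carrier G then M (\<lambda>y. g (x \<otimes> y) * cnj (g y)) else 0)"
    and q: "q = (\<lambda>x. if x \<in> carrier G then conv k p x else 0)"
    unfolding pd_cone_def by auto
  have bp: "bdd p" unfolding p by (rule bdd_pd[OF g])
  define g' where "g' y = of_real (sqrt s) * g y" for y
  have g': "bdd g'" unfolding g'_def using g by auto
  have ss: "complex_of_real (sqrt s) * complex_of_real (sqrt s) = of_real s"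
    using s by (simp flip: of_real_mult)
  have "scale_fun s p = (\<lambda>x. if x \<in> carrier G then M (\<lambda>y. g' (x \<otimes> y) * cnj (g' y)) else 0)"
  proof
    fix x
    have "M (\<lambda>y. g' (x \<otimes> y) * cnj (g' y)) = of_real s * M (\<lambda>y. g (x \<otimes> y) * cnj (g y))" if x: "x \<in> carrier G"
    proof -
      have "M (\<lambda>y. g' (x \<otimes> y) * cnj (g' y)) = M (\<lambda>y. of_real s * (g (x \<otimes> y) * cnj (g y)))"
        unfolding g'_def ss[symmetric] by (simp add: mult_ac)
      also have "\<dots> = of_real s * M (\<lambda>y. g (x \<otimes> y) * cnj (g y))"
        by (rule mean_scale) (intro bounded_fun_on_mult bounded_fun_on_cnj bdd_translate g x)
      finally show ?thesis .
    qed
    then show "scale_fun s p x = (if x \<in> carrier G then M (\<lambda>y. g' (x \<otimes> y) * cnj (g' y)) else 0)"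
      unfolding scale_fun_def p by simp
  qed
  moreover have "scale_fun s q = (\<lambda>x. if x \<in> carrier G then conv k (scale_fun s p) x else 0)"
    using conv_scale[OF k bp] unfolding scale_fun_def q by auto
  ultimately show ?thesis
    unfolding pd_cone_def mem_Collect_eq prod.case using g' by blast
qed

text \<open>Every clause is a closed pointwise condition and so passes to the closure. The first is
  Cauchy-Schwarz in the form 2ab <= a^2 + b^2, invariance making both squares equal in mean; the
  third is equicontinuity, with a modulus that depends only on \<open>k\<close>.\<close>

lemma pd_cone_bounds:
  assumes k: "bdd k" "\<forall>x\<in>carrier G. cmod (k x) \<le> 1" and z: "(p, q) \<in> pd_cone k"
  shows "cmod (p x) \<le> Re (p \<one>)"
    and "cmod (q x) \<le> Re (p \<one>)"
    and "x \<in> carrier G \<Longrightarrow> x' \<in> carrier G \<Longrightarrow> near k e x x' \<Longrightarrow> cmod (q x' - q x) \<le> e * Re (p \<one>)"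
    and "x \<in> carrier G \<Longrightarrow> p (inv x) = cnj (p x)"
    and "x \<notin> carrier G \<Longrightarrow> p x = 0 \<and> q x = 0"
proof -
  from z obtain g where g: "bdd g"
    and p: "p = (\<lambda>x. if x \<in> carrier G then M (\<lambda>y. g (x \<otimes> y) * cnj (g y)) else 0)"
    and q: "q = (\<lambda>x. if x \<in> carrier G then conv k p x else 0)"
    unfolding pd_cone_def by auto
  have bp: "bdd p" unfolding p by (rule bdd_pd[OF g])
  have p1: "p \<one> = M (\<lambda>y. of_real ((cmod (g y))\<^sup>2))"
    unfolding p by (auto intro!: mean_cong simp: complex_norm_square[symmetric])
  have p1': "Re (p \<one>) = msq g" unfolding msq_def p1 ..
  have "cmod (p x) \<le> msq g" if x: "x \<in> carrier G" for x
  proof -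
    \<comment> \<open>A unimodular factor turning \<open>p x\<close> into its modulus, because
      positivity of the mean speaks about real parts.\<close>
    define u where "u = (if p x = 0 then 1 else cnj (p x) / cmod (p x))"
    have u: "cmod u = 1" "u * p x = cmod (p x)"
      unfolding u_def by (auto simp: norm_divide complex_norm_square[symmetric] power2_eq_square field_simps)
    have bg: "bdd (\<lambda>y. g (x \<otimes> y) * cnj (g y))"
      by (intro bounded_fun_on_mult bounded_fun_on_cnj bdd_translate g x)
    have bs: "bdd (\<lambda>y. of_real ((cmod (g (x \<otimes> y)))\<^sup>2))" by (rule bdd_msq[OF bdd_translate[OF g x]])
    have "cmod (p x) = Re (u * p x)" unfolding u(2) by simp
    also have "\<dots> = Re (M (\<lambda>y. u * (g (x \<otimes> y) * cnj (g y))))"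
      unfolding mean_scale[OF bg] p using x by simp
    also have "\<dots> \<le> Re (M (\<lambda>y. (1/2) * (of_real ((cmod (g (x \<otimes> y)))\<^sup>2) + of_real ((cmod (g y))\<^sup>2))))"
    proof (rule mean_Re_mono)
      fix y
      have "Re (u * (g (x \<otimes> y) * cnj (g y))) \<le> cmod (u * (g (x \<otimes> y) * cnj (g y)))"
        by (rule complex_Re_le_cmod)
      also have "\<dots> = cmod (g (x \<otimes> y)) * cmod (g y)" using u by (simp add: norm_mult)
      also have "\<dots> \<le> (1/2) * ((cmod (g (x \<otimes> y)))\<^sup>2 + (cmod (g y))\<^sup>2)"
        using sum_squares_bound[of "cmod (g (x \<otimes> y))" "cmod (g y)"] by simp
      finally show "Re (u * (g (x \<otimes> y) * cnj (g y)))
          \<le> Re ((1/2) * (of_real ((cmod (g (x \<otimes> y)))\<^sup>2) + of_real ((cmod (g y))\<^sup>2)))" by simp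
    qed (intro bounded_fun_on_mult bounded_fun_on_add bounded_fun_on_const bg bs bdd_msq[OF g])+
    also have "M (\<lambda>y. (1/2) * (of_real ((cmod (g (x \<otimes> y)))\<^sup>2) + of_real ((cmod (g y))\<^sup>2))) =
        (1/2) * (M (\<lambda>y. of_real ((cmod (g (x \<otimes> y)))\<^sup>2)) + M (\<lambda>y. of_real ((cmod (g y))\<^sup>2)))"
      unfolding mean_scale[OF bounded_fun_on_add[OF bs bdd_msq[OF g]]] mean_add[OF bs bdd_msq[OF g]] ..
    also have "M (\<lambda>y. of_real ((cmod (g (x \<otimes> y)))\<^sup>2)) = M (\<lambda>y. of_real ((cmod (g y))\<^sup>2))"
      by (rule mean_translate[OF x bdd_msq[OF g]])
    finally show ?thesis unfolding msq_def by simp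
  qed
  then have A: "cmod (p x) \<le> Re (p \<one>)" for x
    using p1' msq_nonneg[OF g] unfolding p by (cases "x \<in> carrier G") auto
  then show "cmod (p x) \<le> Re (p \<one>)" .
  have nn: "0 \<le> Re (p \<one>)" using A[of \<one>] norm_ge_zero order_trans by blast
  have "cmod (conv k p x) \<le> 1 * Re (p \<one>)" if "x \<in> carrier G" for x
    unfolding conv_def using that A k(2) by (intro mean_bound) (simp only: norm_mult, intro mult_mono, auto)
  then show "cmod (q x) \<le> Re (p \<one>)" unfolding q using nn by simp
  show "cmod (q x' - q x) \<le> e * Re (p \<one>)" if x: "x \<in> carrier G" "x' \<in> carrier G" and n: "near k e x x'"
  proof -
    have "q x' - q x = M (\<lambda>y. k (x' \<otimes> inv y) * p y - k (x \<otimes> inv y) * p y)"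
      unfolding q conv_def using x by (simp add: mean_diff bdd_conv_integrand k bp)
    also have "cmod \<dots> \<le> e * Re (p \<one>)"
    proof (rule mean_bound)
      fix y assume y: "y \<in> carrier G"
      have "cmod (k (x' \<otimes> inv y) - k (x \<otimes> inv y)) \<le> e" using n y unfolding near_def by simp
      then have "cmod ((k (x' \<otimes> inv y) - k (x \<otimes> inv y)) * p y) \<le> e * Re (p \<one>)"
        unfolding norm_mult using A[of y] order_trans[OF norm_ge_zero] by (intro mult_mono) auto
      then show "cmod (k (x' \<otimes> inv y) * p y - k (x \<otimes> inv y) * p y) \<le> e * Re (p \<one>)"
        by (simp add: left_diff_distrib)
    qed
    finally show ?thesis .
  qed
  show "p (inv x) = cnj (p x)" if x: "x \<in> carrier G"
  proof -
    have bg: "bdd (\<lambda>y. g (inv x \<otimes> y) * cnj (g y))"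
      by (intro bounded_fun_on_mult bounded_fun_on_cnj bdd_translate g inv_closed x)
    have "p (inv x) = M (\<lambda>y. g (inv x \<otimes> (x \<otimes> y)) * cnj (g (x \<otimes> y)))"
      unfolding p using x mean_translate[OF x bg] by simp
    also have "\<dots> = M (\<lambda>y. cnj (g (x \<otimes> y) * cnj (g y)))"
      by (rule mean_cong) (use x in \<open>simp add: m_assoc[symmetric] mult.commute\<close>)
    also have "\<dots> = cnj (M (\<lambda>y. g (x \<otimes> y) * cnj (g y)))"
      by (rule mean_cnj) (intro bounded_fun_on_mult bounded_fun_on_cnj bdd_translate g x)
    finally show ?thesis unfolding p using x by simp
  qed
  show "p x = 0 \<and> q x = 0" if "x \<notin> carrier G" unfolding p q using that by simp
qed

end

lemma continuous_on_realI:
  fixes f :: "'z::topological_space \<Rightarrow> real"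
  assumes "\<And>z e. z \<in> S \<Longrightarrow> e > 0 \<Longrightarrow> \<exists>U. open U \<and> z \<in> U \<and> (\<forall>z'\<in>U \<inter> S. \<bar>f z' - f z\<bar> < e)"
  shows "continuous_on S f"
  unfolding continuous_on_def
proof (intro ballI tendstoI)
  fix z e assume "z \<in> S" "(0::real) < e"
  then obtain U where "open U" "z \<in> U" "\<forall>z'\<in>U \<inter> S. \<bar>f z' - f z\<bar> < e" using assms by blast
  then show "\<forall>\<^sub>F z' in at z within S. dist (f z') (f z) < e"
    unfolding eventually_at_topological dist_real_def by blast
qed

section \<open>Closure of the cone and the extremal problem\<close>

context compact_abelian_group_mean
begin

lemma closure_pd_cone_split:
  assumes "bdd k" "cmod c = 1" "b \<in> carrier G" "z \<in> closure (pd_cone k)"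
  shows "(split_fun c b (fst z), split_fun c b (snd z)) \<in> closure (pd_cone k)"
proof -
  have 1: "continuous_on S (\<lambda>z. split_fun c b (fst z) x)" "continuous_on S (\<lambda>z. split_fun c b (snd z) x)"
    for S :: "(('a \<Rightarrow> complex) \<times> ('a \<Rightarrow> complex)) set" and x
    unfolding split_fun_def
    by (cases "x \<in> carrier G"; simp;
        intro continuous_on_add continuous_on_mult continuous_on_const continuous_on_fst_eval continuous_on_snd_eval)+
  have "(\<lambda>z. (split_fun c b (fst z), split_fun c b (snd z))) ` closure (pd_cone k) \<subseteq> closure (pd_cone k)"
  proof (rule image_closure_subset)
    show "continuous_on (closure (pd_cone k)) (\<lambda>z. (split_fun c b (fst z), split_fun c b (snd z)))"
      by (intro continuous_on_Pair continuous_on_coordinatewise_then_product 1)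
    show "(\<lambda>z. (split_fun c b (fst z), split_fun c b (snd z))) ` pd_cone k \<subseteq> closure (pd_cone k)"
      using pd_cone_split[OF assms(1-3)] closure_subset by fastforce
  qed simp
  then show ?thesis using assms(4) by blast
qed

lemma closure_pd_cone_scale:
  assumes "bdd k" "0 \<le> s" "z \<in> closure (pd_cone k)"
  shows "(scale_fun s (fst z), scale_fun s (snd z)) \<in> closure (pd_cone k)"
proof -
  have "(\<lambda>z. (scale_fun s (fst z), scale_fun s (snd z))) ` closure (pd_cone k) \<subseteq> closure (pd_cone k)"
  proof (rule image_closure_subset)
    show "continuous_on (closure (pd_cone k)) (\<lambda>z. (scale_fun s (fst z), scale_fun s (snd z)))"
      unfolding scale_fun_def
      by (intro continuous_on_Pair continuous_on_coordinatewise_then_product continuous_on_mult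
          continuous_on_const continuous_on_fst_eval continuous_on_snd_eval)
    show "(\<lambda>z. (scale_fun s (fst z), scale_fun s (snd z))) ` pd_cone k \<subseteq> closure (pd_cone k)"
      using pd_cone_scale[OF assms(1,2)] closure_subset by fastforce
  qed simp
  then show ?thesis using assms(3) by blast
qed

lemma closure_pd_cone_bounds:
  assumes k: "bdd k" "\<forall>x\<in>carrier G. cmod (k x) \<le> 1" and z: "z \<in> closure (pd_cone k)"
  shows "cmod (fst z x) \<le> Re (fst z \<one>)"
    and "cmod (snd z x) \<le> Re (fst z \<one>)"
    and "x \<in> carrier G \<Longrightarrow> x' \<in> carrier G \<Longrightarrow> near k e x x' \<Longrightarrow>
      cmod (snd z x' - snd z x) \<le> e * Re (fst z \<one>)"
    and "x \<in> carrier G \<Longrightarrow> fst z (inv x) = cnj (fst z x)"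
    and "x \<notin> carrier G \<Longrightarrow> fst z x = 0" "x \<notin> carrier G \<Longrightarrow> snd z x = 0"
proof -
  note b = pd_cone_bounds[OF k]
  note cont = continuous_on_norm continuous_on_Re continuous_on_diff continuous_on_mult continuous_on_const
    continuous_on_cnj continuous_on_fst_eval continuous_on_snd_eval
  have "closure (pd_cone k) \<subseteq> {z. \<forall>x. True \<longrightarrow> cmod (fst z x) \<le> Re (fst z \<one>)}"
    by (rule closure_minimal[OF _ closed_pointwise_le]) (use b(1) in fastforce, intro cont, intro cont)
  then show "cmod (fst z x) \<le> Re (fst z \<one>)" using z by blast
  have "closure (pd_cone k) \<subseteq> {z. \<forall>x. True \<longrightarrow> cmod (snd z x) \<le> Re (fst z \<one>)}"
    by (rule closure_minimal[OF _ closed_pointwise_le]) (use b(2) in fastforce, intro cont, intro cont)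
  then show "cmod (snd z x) \<le> Re (fst z \<one>)" using z by blast
  have "closure (pd_cone k) \<subseteq> {z. \<forall>i. (fst i \<in> carrier G \<and> fst (snd i) \<in> carrier G \<and>
      near k (snd (snd i)) (fst i) (fst (snd i))) \<longrightarrow>
      cmod (snd z (fst (snd i)) - snd z (fst i)) \<le> snd (snd i) * Re (fst z \<one>)}"
    by (rule closure_minimal[OF _ closed_pointwise_le]) (use b(3) in fastforce, intro cont, intro cont)
  then show "cmod (snd z x' - snd z x) \<le> e * Re (fst z \<one>)"
    if "x \<in> carrier G" "x' \<in> carrier G" "near k e x x'" using z that by auto
  have "closure (pd_cone k) \<subseteq> {z. \<forall>x. x \<in> carrier G \<longrightarrow> fst z (inv x) = cnj (fst z x)}"
    by (rule closure_minimal[OF _ closed_pointwise_eq]) (use b(4) in fastforce, intro cont, intro cont)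
  then show "fst z (inv x) = cnj (fst z x)" if "x \<in> carrier G" using z that by blast
  have "closure (pd_cone k) \<subseteq> {z. \<forall>x. x \<notin> carrier G \<longrightarrow> fst z x = 0}"
    by (rule closure_minimal[OF _ closed_pointwise_eq]) (use b(5) in fastforce, intro cont, intro cont)
  then show "fst z x = 0" if "x \<notin> carrier G" using z that by blast
  have "closure (pd_cone k) \<subseteq> {z. \<forall>x. x \<notin> carrier G \<longrightarrow> snd z x = 0}"
    by (rule closure_minimal[OF _ closed_pointwise_eq]) (use b(5) in fastforce, intro cont, intro cont)
  then show "snd z x = 0" if "x \<notin> carrier G" using z that by blast
qed

text \<open>The equicontinuity bound of the second components survives pointwise limits.\<close>

lemma continuous_closure_pd_cone_snd:
  assumes k: "continuous_map T euclidean k" "\<forall>x\<in>carrier G. cmod (k x) \<le> 1"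
    and z: "z \<in> closure (pd_cone k)"
  shows "continuous_map T euclidean (snd z)"
proof (rule continuous_map_complexI)
  fix x and e :: real assume x: "x \<in> topspace T" and e: "e > 0"
  note b = closure_pd_cone_bounds[OF bdd_continuous[OF k(1)] k(2) z]
  define r where "r = Re (fst z \<one>)"
  have r: "0 \<le> r" unfolding r_def using b(1)[of \<one>] norm_ge_zero order_trans by blast
  \<comment> \<open>The summand 1 keeps the denominator positive and makes \<open>e' * r < e\<close>
    strict.\<close>
  define e' where "e' = e / (r + 1)"
  have e': "e' > 0" "e' * r < e" unfolding e'_def using r e by (auto simp: field_simps)
  obtain U where U: "openin T U" "x \<in> U" "\<And>y. y \<in> U \<Longrightarrow> near k e' x y"
    using near_neighbourhood[OF k(1) _ e'(1)] x topspace_T by metis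
  have "cmod (snd z y - snd z x) < e" if "y \<in> U" for y
    using b(3)[OF _ _ U(3)[OF that]] x that openin_subset[OF U(1)] e'(2) unfolding topspace_T r_def
    by fastforce
  then show "\<exists>U. openin T U \<and> x \<in> U \<and> (\<forall>y\<in>U. cmod (snd z y - snd z x) < e)" using U by blast
qed

text \<open>On a unitary character \<open>p\<close> this is multiplication by
  \<open>1 - Re (p a)\<close>; if it does not kill the character, then \<open>p a\<close> differs
  from 1.\<close>

definition sdiff :: "'a \<Rightarrow> ('a \<Rightarrow> complex) \<Rightarrow> 'a \<Rightarrow> complex" where
  "sdiff a f x = f x - (f (x \<otimes> a) + f (x \<otimes> inv a)) / 2"

lemma continuous_sdiff:
  assumes "continuous_map T euclidean f" "a \<in> carrier G"
  shows "continuous_map T euclidean (sdiff a f)"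
proof -
  have tr: "continuous_map T euclidean (\<lambda>x. f (x \<otimes> c))" if "c \<in> carrier G" for c
    using continuous_map_compose[OF continuous_map_translate(2)[OF that] assms(1)] by (simp add: o_def)
  have "continuous_map T euclidean (\<lambda>x. f x - (f (x \<otimes> a) + f (x \<otimes> inv a)) * (1/2))"
    by (intro continuous_map_diff continuous_map_add continuous_map_complex_mult tr assms inv_closed) simp
  then show ?thesis unfolding sdiff_def[abs_def] by simp
qed

text \<open>The weights are chosen so that the bounds \<open>(2 + t)^2 * msq u\<close> and
  \<open>(2 - t)^2 * msq u\<close> for the two mean squares on the right make the whole right side
  0.\<close>

lemma msq_parallelogram:
  assumes u: "bdd u" and v: "bdd v"
  shows "4 * msq (\<lambda>x. v x - of_real t * u x) =
    (2 - t) * msq (\<lambda>x. 2 * u x + v x) + (2 + t) * msq (\<lambda>x. 2 * u x - v x) - 4 * (4 - t\<^sup>2) * msq u"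
proof -
  let ?s = "\<lambda>f x. complex_of_real ((cmod (f x))\<^sup>2)"
  have b: "bdd (\<lambda>x. 2 * u x + v x)" "bdd (\<lambda>x. 2 * u x - v x)" "bdd (\<lambda>x. v x - of_real t * u x)"
    by (intro bounded_fun_on_add bounded_fun_on_diff bounded_fun_on_mult bounded_fun_on_const u v)+
  note s = bdd_msq[OF b(1)] bdd_msq[OF b(2)] bdd_msq[OF b(3)] bdd_msq[OF u]
  have "4 * (cmod (b - of_real t * a))\<^sup>2 = (2 - t) * (cmod (2 * a + b))\<^sup>2 + (2 + t) * (cmod (2 * a - b))\<^sup>2
      - 4 * (4 - t\<^sup>2) * (cmod a)\<^sup>2" for a b
    unfolding cmod_power2 by simp (simp add: power2_eq_square algebra_simps)
  then have pt: "complex_of_real 4 * ?s (\<lambda>x. v x - of_real t * u x) y =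
      (of_real (2 - t) * ?s (\<lambda>x. 2 * u x + v x) y + of_real (2 + t) * ?s (\<lambda>x. 2 * u x - v x) y)
      - of_real (4 * (4 - t\<^sup>2)) * ?s u y" for y
    by (simp only: flip: of_real_mult of_real_add of_real_diff)
  have "complex_of_real 4 * M (?s (\<lambda>x. v x - of_real t * u x)) =
      (of_real (2 - t) * M (?s (\<lambda>x. 2 * u x + v x)) + of_real (2 + t) * M (?s (\<lambda>x. 2 * u x - v x)))
      - of_real (4 * (4 - t\<^sup>2)) * M (?s u)"
    unfolding mean_scale[OF s(1), symmetric] mean_scale[OF s(2), symmetric] mean_scale[OF s(3), symmetric]
      mean_scale[OF s(4), symmetric] pt
      mean_add[OF bounded_fun_on_mult[OF bounded_fun_on_const s(1)] bounded_fun_on_mult[OF bounded_fun_on_const s(2)], symmetric]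
    by (rule mean_diff) (intro bounded_fun_on_add bounded_fun_on_mult[OF bounded_fun_on_const] s)+
  from arg_cong[OF this, of Re] show ?thesis unfolding msq_def
    by (simp only: minus_complex.sel plus_complex.sel Re_complex_of_real Im_complex_of_real times_complex.sel
        mult_zero_left diff_0_right)
qed

text \<open>Under \<open>fst z \<one> = 1\<close> the bounds put both components into unit discs, so
  Tychonoff applies.\<close>

lemma compact_normalised_pd_cone:
  assumes k: "bdd k" "\<forall>x\<in>carrier G. cmod (k x) \<le> 1"
  shows "compact {z \<in> closure (pd_cone k). fst z \<one> = 1}"
proof -
  have box: "compact ({p. \<forall>x. p x \<in> cball (0::complex) 1} \<times> {q. \<forall>x. q x \<in> cball (0::complex) 1} ::
      (('a \<Rightarrow> complex) \<times> ('a \<Rightarrow> complex)) set)"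
    by (intro compact_Times compact_PiE_UNIV) simp_all
  have "closed {z :: ('a \<Rightarrow> complex) \<times> ('a \<Rightarrow> complex). fst z \<one> = 1}"
    by (intro closed_Collect_eq continuous_on_fst_eval continuous_on_const)
  then have "closed (closure (pd_cone k) \<inter> {z. fst z \<one> = 1})" by (intro closed_Int closed_closure)
  from compact_Int_closed[OF box this] show ?thesis
  proof (rule back_subst[where P = compact])
    show "{p. \<forall>x. p x \<in> cball 0 1} \<times> {q. \<forall>x. q x \<in> cball 0 1} \<inter> (closure (pd_cone k) \<inter> {z. fst z \<one> = 1})
        = {z \<in> closure (pd_cone k). fst z \<one> = 1}"
      using closure_pd_cone_bounds(1,2)[OF k] by fastforce
  qed
qed

text \<open>The mean itself need not be continuous for pointwise convergence; equicontinuity turns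
  closeness at the finitely many points of a net into uniform closeness, and that suffices.\<close>

lemma continuous_on_msq_sdiff:
  assumes k: "continuous_map T euclidean k" "\<forall>x\<in>carrier G. cmod (k x) \<le> 1"
    and a: "a \<in> carrier G"
  shows "continuous_on {z \<in> closure (pd_cone k). fst z \<one> = 1} (\<lambda>z. msq (sdiff a (snd z)))"
proof (rule continuous_on_realI)
  note bk = bdd_continuous[OF k(1)]
  fix z and e :: real assume z: "z \<in> {z \<in> closure (pd_cone k). fst z \<one> = 1}" and e: "e > 0"
  \<comment> \<open>The error grows to \<open>3 * d\<close> on the group, to \<open>6 * d\<close>
    after \<open>sdiff\<close>, and to \<open>24 * d\<close> on squaring numbers of modulus at most
    2; this is \<open>e / 2\<close>.\<close>
  define d where "d = e / 48"
  have d: "d > 0" unfolding d_def using e by simp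
  obtain R where R: "finite R" "R \<subseteq> carrier G" "\<And>x. x \<in> carrier G \<Longrightarrow> \<exists>r\<in>R. near k d r x"
    using near_finite_net[OF k(1) d] by blast
  define U :: "(('a \<Rightarrow> complex) \<times> ('a \<Rightarrow> complex)) set" where "U = (\<Inter>r\<in>R. {z'. cmod (snd z' r - snd z r) < d})"
  have "open U" unfolding U_def
    by (intro open_INT ballI open_Collect_less continuous_on_norm continuous_on_diff continuous_on_const
        continuous_on_snd_eval R(1))
  moreover have "z \<in> U" unfolding U_def using d by simp
  moreover have "\<bar>msq (sdiff a (snd z')) - msq (sdiff a (snd z))\<bar> < e"
    if z': "z' \<in> U \<inter> {z \<in> closure (pd_cone k). fst z \<one> = 1}" for z'
  proof -
    define q where "q = snd z"
    define q' where "q' = snd z'"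
    have zc: "z \<in> closure (pd_cone k)" "z' \<in> closure (pd_cone k)" and n: "fst z \<one> = 1" "fst z' \<one> = 1"
      using z z' by auto
    note B = closure_pd_cone_bounds[OF bk k(2) zc(1), unfolded n] 
    note B' = closure_pd_cone_bounds[OF bk k(2) zc(2), unfolded n]
    have close: "cmod (q' x - q x) \<le> 3 * d" if x: "x \<in> carrier G" for x
    proof -
      obtain r where r: "r \<in> R" "near k d r x" using R(3)[OF x] by blast
      have "r \<in> carrier G" using r R by auto
      have "cmod (q x - q r) \<le> d" "cmod (q' x - q' r) \<le> d" "cmod (q' r - q r) < d"
        using B(3)[OF \<open>r \<in> carrier G\<close> x r(2)] B'(3)[OF \<open>r \<in> carrier G\<close> x r(2)] z' r(1)
        unfolding q_def q'_def U_def by auto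
      then show ?thesis by norm
    qed
    have cl: "cmod (sdiff a q' x - sdiff a q x) \<le> 6 * d" if x: "x \<in> carrier G" for x
    proof -
      have "sdiff a q' x - sdiff a q x = (q' x - q x) - (1/2) * (q' (x \<otimes> a) - q (x \<otimes> a))
          - (1/2) * (q' (x \<otimes> inv a) - q (x \<otimes> inv a))"
        unfolding sdiff_def by (simp add: field_simps)
      also have "cmod \<dots> \<le> cmod (q' x - q x) + cmod ((1/2) * (q' (x \<otimes> a) - q (x \<otimes> a)))
          + cmod ((1/2) * (q' (x \<otimes> inv a) - q (x \<otimes> inv a)))"
        by (intro order_trans[OF norm_triangle_ineq4] add_right_mono norm_triangle_ineq4)
      also have "\<dots> \<le> 3 * d + (1/2) * (3 * d) + (1/2) * (3 * d)"
        unfolding norm_mult by (intro add_mono mult_mono close) (use x a d in auto)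
      finally show ?thesis by simp
    qed
    have le2: "cmod (sdiff a f x) \<le> 2" if "\<And>x. cmod (f x) \<le> 1" for f x
    proof -
      have "cmod (sdiff a f x) \<le> cmod (f x) + (cmod (f (x \<otimes> a)) + cmod (f (x \<otimes> inv a))) / 2"
        unfolding sdiff_def by (rule order_trans[OF norm_triangle_ineq4]) (simp add: norm_triangle_ineq norm_divide divide_right_mono)
      also have "\<dots> \<le> 1 + (1 + 1) / 2" by (intro add_mono divide_right_mono that) simp
      finally show ?thesis by simp
    qed
    have qb: "cmod (q x) \<le> 1" "cmod (q' x) \<le> 1" for x using B(2) B'(2) unfolding q_def q'_def by auto
    have bq: "bdd (sdiff a q)" "bdd (sdiff a q')"
      by (intro bounded_fun_onI[of _ _ 2] le2 qb)+
    have "msq (sdiff a q') - msq (sdiff a q) =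
        Re (M (\<lambda>x. of_real ((cmod (sdiff a q' x))\<^sup>2) - of_real ((cmod (sdiff a q x))\<^sup>2)))"
      unfolding msq_def mean_diff[OF bdd_msq[OF bq(2)] bdd_msq[OF bq(1)]] by simp
    also have "\<bar>\<dots>\<bar> \<le> cmod (M (\<lambda>x. of_real ((cmod (sdiff a q' x))\<^sup>2) - of_real ((cmod (sdiff a q x))\<^sup>2)))"
      by (rule abs_Re_le_cmod)
    also have "\<dots> \<le> 4 * (6 * d)"
    proof (rule mean_bound)
      fix x assume x: "x \<in> carrier G"
      let ?s = "cmod (sdiff a q' x)" and ?t = "cmod (sdiff a q x)"
      have "\<bar>?s\<^sup>2 - ?t\<^sup>2\<bar> = \<bar>?s + ?t\<bar> * \<bar>?s - ?t\<bar>"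
        unfolding abs_mult[symmetric] by (simp add: power2_eq_square algebra_simps)
      also have "\<dots> \<le> 4 * (6 * d)"
        by (intro mult_mono) (use le2[of q' x, OF qb(2)] le2[of q x, OF qb(1)] cl[OF x]
            norm_triangle_ineq3[of "sdiff a q' x" "sdiff a q x"] in \<open>auto\<close>)
      finally show "cmod (of_real (?s\<^sup>2) - of_real (?t\<^sup>2)) \<le> 4 * (6 * d)"
        unfolding of_real_diff[symmetric] norm_of_real .
    qed
    finally show ?thesis unfolding q_def q'_def d_def using e by simp
  qed
  ultimately show "\<exists>U. open U \<and> z \<in> U \<and> (\<forall>z'\<in>U \<inter> {z \<in> closure (pd_cone k). fst z \<one> = 1}.
      \<bar>msq (sdiff a (snd z')) - msq (sdiff a (snd z))\<bar> < e)" by blast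
qed

text \<open>Splitting \<open>z\<close> by \<open>c\<close> and by \<open>-c\<close> gives elements
  of the closed cone with values \<open>2 + t\<close> and \<open>2 - t\<close> at the unit;
  maximality bounds their mean squares, and \<open>msq_parallelogram\<close> forces
  \<open>v c = t * u\<close>. Taking \<open>c = 1\<close> and \<open>c = \<i>\<close> isolates
  \<open>u (x \<otimes> b)\<close>.\<close>

lemma extremal_pair_multiplicative:
  assumes k: "continuous_map T euclidean k" "\<forall>x\<in>carrier G. cmod (k x) \<le> 1"
    and a: "a \<in> carrier G"
    and z: "z \<in> closure (pd_cone k)" "fst z \<one> = 1"
    and max: "\<And>z'. z' \<in> closure (pd_cone k) \<Longrightarrow> fst z' \<one> = 1 \<Longrightarrow>
      msq (sdiff a (snd z')) \<le> msq (sdiff a (snd z))"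
    and b: "b \<in> carrier G" and x: "x \<in> carrier G"
  shows "sdiff a (snd z) (x \<otimes> b) = fst z b * sdiff a (snd z) x"
proof -
  note bk = bdd_continuous[OF k(1)]
  define p q u where "p = fst z" and "q = snd z" and "u = sdiff a (snd z)"
  note B = closure_pd_cone_bounds[OF bk k(2) z(1), folded p_def q_def]
  have p1: "p \<one> = 1" unfolding p_def by (rule z(2))
  have cu: "continuous_map T euclidean u"
    unfolding u_def by (rule continuous_sdiff[OF continuous_closure_pd_cone_snd[OF k z(1)] a])
  note bu = bdd_continuous[OF cu]
  define v where "v c y = c * u (y \<otimes> b) + cnj c * u (y \<otimes> inv b)" for c y
  have cv: "continuous_map T euclidean (v c)" for c
  proof -
    have "continuous_map T euclidean (\<lambda>x. u (x \<otimes> d))" if "d \<in> carrier G" for d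
      using continuous_map_compose[OF continuous_map_translate(2)[OF that] cu] by (simp add: o_def)
    then show ?thesis
      unfolding v_def[abs_def] by (intro continuous_map_add continuous_map_complex_mult) (use b in auto)
  qed
  have main: "v c x = of_real (2 * Re (c * p b)) * u x" if c: "cmod c = 1" for c
  proof -
    define t where "t = 2 * Re (c * p b)"
    have pb: "p (inv b) = cnj (p b)" by (rule B(4)[OF b])
    have split1: "split_fun d b p \<one> = of_real (2 + 2 * Re (d * p b))" for d
      unfolding split_fun_def using b p1 pb by (simp add: complex_eq_iff)
    have split_u: "sdiff a (split_fun d b q) y = 2 * u y + v d y" if "y \<in> carrier G" for d y
    proof -
      have com: "y \<otimes> c \<otimes> b = y \<otimes> b \<otimes> c" "y \<otimes> c \<otimes> inv b = y \<otimes> inv b \<otimes> c" if "c \<in> carrier G" for c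
        using that \<open>y \<in> carrier G\<close> b by (simp_all add: m_ac)
      show ?thesis
        unfolding u_def v_def sdiff_def split_fun_def q_def[symmetric] using that a b
        by (simp add: com field_simps)
    qed
    \<comment> \<open>Maximality is applied to the split pair divided by its value \<open>w\<close>
      at the unit; the square appears because \<open>msq\<close> is quadratic.\<close>
    have est: "0 \<le> 2 + 2 * Re (d * p b)"
        "msq (\<lambda>y. 2 * u y + v d y) \<le> (2 + 2 * Re (d * p b))\<^sup>2 * msq u" if d: "cmod d = 1" for d
    proof -
      define w where "w = 2 + 2 * Re (d * p b)"
      define z' where "z' = (split_fun d b p, split_fun d b q)"
      have z': "z' \<in> closure (pd_cone k)"
        unfolding z'_def p_def q_def by (rule closure_pd_cone_split[OF bk d b z(1)])
      have z'1: "fst z' \<one> = of_real w" unfolding z'_def w_def by (simp only: fst_conv split1)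
      note B' = closure_pd_cone_bounds[OF bk k(2) z', unfolded z'1]
      show w0: "0 \<le> 2 + 2 * Re (d * p b)"
        using order_trans[OF norm_ge_zero B'(1)] unfolding w_def by simp
      have ms: "msq (\<lambda>y. 2 * u y + v d y) = msq (sdiff a (snd z'))"
        by (rule msq_cong) (simp add: z'_def split_u)
      have bz': "bdd (sdiff a (snd z'))"
        by (rule bdd_continuous[OF continuous_sdiff[OF continuous_closure_pd_cone_snd[OF k z'] a]])
      show "msq (\<lambda>y. 2 * u y + v d y) \<le> (2 + 2 * Re (d * p b))\<^sup>2 * msq u"
      \<comment> \<open>With value 0 at the unit no normalisation is possible, but then the bounds
        annihilate the second component.\<close>
      proof (cases "w = 0")
        case True
        then have "snd z' y = 0" for y using B'(2)[of y] by simp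
        then have "msq (sdiff a (snd z')) = 0" unfolding sdiff_def msq_def by simp
        then show ?thesis unfolding ms using msq_nonneg[OF bu] by simp
      next
        case False
        then have w: "w > 0" using w0 unfolding w_def by simp
        define z'' where "z'' = (scale_fun (1/w) (fst z'), scale_fun (1/w) (snd z'))"
        have "z'' \<in> closure (pd_cone k)"
          unfolding z''_def by (rule closure_pd_cone_scale[OF bk _ z']) (use w in simp)
        moreover have "fst z'' \<one> = 1" unfolding z''_def scale_fun_def using z'1 w by simp
        ultimately have "msq (sdiff a (snd z'')) \<le> msq u" unfolding u_def by (rule max)
        moreover have "msq (sdiff a (snd z'')) = msq (\<lambda>y. of_real (1/w) * sdiff a (snd z') y)"
          by (rule msq_cong) (simp add: z''_def scale_fun_def sdiff_def algebra_simps add_divide_distrib)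
        moreover have "\<dots> = (1/w)\<^sup>2 * msq (sdiff a (snd z'))"
          unfolding msq_scale[OF bz'] using w by (simp add: norm_divide)
        ultimately have "(1/w)\<^sup>2 * msq (sdiff a (snd z')) \<le> msq u" by simp
        then have "w\<^sup>2 * ((1/w)\<^sup>2 * msq (sdiff a (snd z'))) \<le> w\<^sup>2 * msq u"
          by (rule mult_left_mono) simp
        then show ?thesis unfolding ms w_def[symmetric] using w by (simp add: power_divide)
      qed
    qed
    have e1: "0 \<le> 2 + t" "msq (\<lambda>y. 2 * u y + v c y) \<le> (2 + t)\<^sup>2 * msq u"
      using est[OF c] unfolding t_def by auto
    have "cmod (- c) = 1" using c by simp
    note e2' = est[OF this]
    have vm: "v (- c) y = - v c y" for y unfolding v_def by simp
    have e2: "0 \<le> 2 - t" "msq (\<lambda>y. 2 * u y - v c y) \<le> (2 - t)\<^sup>2 * msq u"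
    proof -
      have eq: "2 + 2 * Re (- c * p b) = 2 - t" unfolding t_def by simp
      show "0 \<le> 2 - t" "msq (\<lambda>y. 2 * u y - v c y) \<le> (2 - t)\<^sup>2 * msq u"
        using e2' unfolding eq vm by simp_all
    qed
    have "4 * msq (\<lambda>y. v c y - of_real t * u y) \<le>
      (2 - t) * ((2 + t)\<^sup>2 * msq u) + (2 + t) * ((2 - t)\<^sup>2 * msq u) - 4 * (4 - t\<^sup>2) * msq u"
      unfolding msq_parallelogram[OF bu bdd_continuous[OF cv]]
      by (intro diff_right_mono add_mono mult_left_mono e1 e2)
    also have "\<dots> = 0" by (simp add: power2_eq_square algebra_simps)
    finally have "msq (\<lambda>y. v c y - of_real t * u y) \<le> 0" by simp
    moreover have "continuous_map T euclidean (\<lambda>y. v c y - of_real t * u y)"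
      by (intro continuous_map_diff continuous_map_complex_mult cv cu) simp
    ultimately have "v c x - of_real t * u x = 0"
      using msq_pos[of "\<lambda>y. v c y - of_real t * u y" x] x by (meson not_less)
    then show ?thesis unfolding t_def by simp
  qed
  have "u (x \<otimes> b) + u (x \<otimes> inv b) = of_real (2 * Re (p b)) * u x"
    using main[of 1] unfolding v_def by simp
  moreover have "\<i> * u (x \<otimes> b) - \<i> * u (x \<otimes> inv b) = of_real (2 * Re (\<i> * p b)) * u x"
    using main[of \<i>] unfolding v_def by simp
  then have "u (x \<otimes> b) - u (x \<otimes> inv b) = \<i> * of_real (2 * Im (p b)) * u x"
    by (simp add: complex_eq_iff)
  ultimately have "2 * u (x \<otimes> b) = (of_real (2 * Re (p b)) + \<i> * of_real (2 * Im (p b))) * u x"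
    by (simp add: algebra_simps)
  also have "of_real (2 * Re (p b)) + \<i> * of_real (2 * Im (p b)) = 2 * p b"
    by (simp add: complex_eq_iff)
  finally show ?thesis unfolding u_def p_def by simp
qed

text \<open>Convolution commutes with translation, so the operator can be moved to \<open>k\<close>,
  whose values at the unit, at \<open>a\<close> and at \<open>inv a\<close> will be
  prescribed.\<close>

lemma sdiff_conv:
  assumes k: "bdd k" and p: "bdd p" and a: "a \<in> carrier G" and x: "x \<in> carrier G"
  shows "sdiff a (conv k p) x = conv (sdiff a k) p x"
proof -
  have bk: "bdd (\<lambda>y. e * (k (d \<otimes> inv y) * p y))" if "d \<in> carrier G" for d e
    by (intro bounded_fun_on_mult[OF bounded_fun_on_const] bdd_conv_integrand k p that)
  have xa: "x \<otimes> a \<in> carrier G" "x \<otimes> inv a \<in> carrier G" using x a by auto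
  have com: "x \<otimes> inv y \<otimes> d = x \<otimes> d \<otimes> inv y" if "y \<in> carrier G" "d \<in> carrier G" for y d
    using x that by (simp add: m_ac)
  have "conv (sdiff a k) p x = M (\<lambda>y. 1 * (k (x \<otimes> inv y) * p y)
      - ((1/2) * (k (x \<otimes> a \<otimes> inv y) * p y) + (1/2) * (k (x \<otimes> inv a \<otimes> inv y) * p y)))"
    unfolding conv_def sdiff_def by (rule mean_cong) (simp add: com[of _ a] com[of _ "inv a"] a
        left_diff_distrib distrib_right add_divide_distrib)
  also have "\<dots> = M (\<lambda>y. 1 * (k (x \<otimes> inv y) * p y))
      - M (\<lambda>y. (1/2) * (k (x \<otimes> a \<otimes> inv y) * p y) + (1/2) * (k (x \<otimes> inv a \<otimes> inv y) * p y))"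
    by (rule mean_diff[OF bk[OF x] bounded_fun_on_add[OF bk[OF xa(1)] bk[OF xa(2)]]])
  also have "M (\<lambda>y. (1/2) * (k (x \<otimes> a \<otimes> inv y) * p y) + (1/2) * (k (x \<otimes> inv a \<otimes> inv y) * p y))
    = M (\<lambda>y. (1/2) * (k (x \<otimes> a \<otimes> inv y) * p y)) + M (\<lambda>y. (1/2) * (k (x \<otimes> inv a \<otimes> inv y) * p y))"
    by (rule mean_add[OF bk[OF xa(1)] bk[OF xa(2)]])
  finally have E: "conv (sdiff a k) p x = M (\<lambda>y. 1 * (k (x \<otimes> inv y) * p y))
      - (M (\<lambda>y. (1/2) * (k (x \<otimes> a \<otimes> inv y) * p y)) + M (\<lambda>y. (1/2) * (k (x \<otimes> inv a \<otimes> inv y) * p y)))" .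
  show ?thesis
    unfolding E mean_scale[OF bdd_conv_integrand[OF k p x]] mean_scale[OF bdd_conv_integrand[OF k p xa(1)]]
      mean_scale[OF bdd_conv_integrand[OF k p xa(2)]]
    by (simp add: sdiff_def conv_def add_divide_distrib)
qed

text \<open>\<open>sdiff a k\<close> is 1 at the unit. The autocorrelation \<open>p\<close> of the
  indicator of a small \<open>W\<close> vanishes unless \<open>sdiff a k (inv y)\<close> has real
  part at least 1/2, so applying \<open>sdiff a\<close> to the convolution gives real part at least
  half of \<open>Re (M p)\<close> at the unit.\<close>

lemma pd_cone_sdiff_nonzero:
  assumes k: "continuous_map T euclidean k" "\<forall>x\<in>carrier G. cmod (k x) \<le> 1"
    and a: "a \<in> carrier G" and k1: "k \<one> = 1" "k a = 0" "k (inv a) = 0"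
  shows "\<exists>z\<in>closure (pd_cone k). fst z \<one> = 1 \<and> 0 < msq (sdiff a (snd z))"
proof -
  note bk = bdd_continuous[OF k(1)]
  have cdk: "continuous_map T euclidean (sdiff a k)" by (rule continuous_sdiff[OF k(1) a])
  define D where "D = {w \<in> topspace (prod_topology T T). 1/2 < Re (sdiff a k (snd w \<otimes> inv (fst w)))}"
  have "continuous_map (prod_topology T T) euclidean (\<lambda>w. sdiff a k (snd w \<otimes> inv (fst w)))"
    by (rule continuous_map_compose[OF _ cdk, unfolded o_def];
        intro continuous_map_mult_comp continuous_map_inv_comp continuous_map_fst continuous_map_snd)
  then have "openin (prod_topology T T) D"
    unfolding D_def
    by (intro openin_continuous_less(2) continuous_map_euclidean_compose[where g = Re])
      (auto intro: continuous_on_Re)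
  moreover have "(\<one>, \<one>) \<in> D"
    unfolding D_def using topspace_T a k1 by (simp add: sdiff_def)
  ultimately obtain U V where UV: "openin T U" "openin T V" "\<one> \<in> U" "\<one> \<in> V" "U \<times> V \<subseteq> D"
    unfolding openin_prod_topology_alt by metis
  define W where "W = U \<inter> V"
  have W: "openin T W" "\<one> \<in> W" unfolding W_def using UV by auto
  have WD: "1/2 < Re (sdiff a k (z \<otimes> inv x))" if "x \<in> W" "z \<in> W" for x z
  proof -
    have "(x, z) \<in> D" using that UV(5) unfolding W_def by auto
    then show ?thesis unfolding D_def by simp
  qed
  have Wc: "x \<in> carrier G" if "x \<in> W" for x using openin_subset[OF W(1)] that topspace_T by auto
  define g where "g y = (if y \<in> W then 1 else 0 :: complex)" for y
  have bg: "bdd g" unfolding g_def by (rule bdd_indicator)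
  define c0 where "c0 = Re (M g)"
  have c0: "c0 > 0" unfolding c0_def g_def by (rule mean_indicator_pos[OF W])
  have Mg: "M g = of_real c0"
    using mean_real[OF bg] unfolding c0_def g_def by (simp add: complex_eq_iff)
  define p where "p x = (if x \<in> carrier G then M (\<lambda>y. g (x \<otimes> y) * cnj (g y)) else 0)" for x
  define q where "q x = (if x \<in> carrier G then conv k p x else 0)" for x
  have pq: "(p, q) \<in> pd_cone k"
    unfolding pd_cone_def using bg p_def[abs_def] q_def[abs_def] by blast
  have bp: "bdd p" unfolding p_def by (rule bdd_pd[OF bg])
  have bgg: "bdd (\<lambda>y. g (x \<otimes> y) * cnj (g y))" if "x \<in> carrier G" for x
    by (intro bounded_fun_on_mult bounded_fun_on_cnj bdd_translate bg that)
  have p1: "p \<one> = of_real c0"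
    unfolding p_def Mg[symmetric] by (auto intro!: mean_cong simp: g_def)
  have Re_p: "0 \<le> Re (p y)" and Im_p: "Im (p y) = 0" for y
    unfolding p_def using mean_Re_nonneg[OF bgg] mean_real[OF bgg] by (auto simp: g_def)
  have supp: "p y = 0 \<or> 1/2 \<le> Re (sdiff a k (inv y))" if y: "y \<in> carrier G" for y
  proof (cases "\<exists>z\<in>carrier G. y \<otimes> z \<in> W \<and> z \<in> W")
    case True
    then obtain z where z: "z \<in> carrier G" "y \<otimes> z \<in> W" "z \<in> W" by blast
    have "z \<otimes> inv (y \<otimes> z) = inv y"
      using y z m_lcomm[of z "inv y" "inv z"] by (simp add: inv_mult)
    then show ?thesis using WD[OF z(2,3)] by simp
  next
    case False
    then have "M (\<lambda>z. g (y \<otimes> z) * cnj (g z)) = M (\<lambda>_. 0)"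
      by (intro mean_cong) (auto simp: g_def)
    then show ?thesis unfolding p_def using y by simp
  qed
  \<comment> \<open>Positivity of \<open>M p\<close> is obtained without interchanging two means:
    finitely many translates of \<open>W\<close> cover the group, so the corresponding translates of
    \<open>p\<close> sum to at least \<open>c0\<close> everywhere.\<close>
  obtain C where C: "finite C" "C \<subseteq> carrier G" "\<And>y. y \<in> carrier G \<Longrightarrow> \<exists>c\<in>C. c \<otimes> y \<in> W"
    using finite_translates_cover[OF W] by blast
  have "Re (M (\<lambda>_. of_real c0)) \<le> card C * Re (M p)"
  proof (rule mean_cover_lower[OF C(1,2) bp bounded_fun_on_const])
    fix y assume y: "y \<in> carrier G"
    have "c0 \<le> Re (M (\<lambda>z. \<Sum>c\<in>C. g (c \<otimes> y \<otimes> z) * cnj (g z)))"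
      unfolding c0_def
    proof (rule mean_Re_mono[OF bg])
      show "bdd (\<lambda>z. \<Sum>c\<in>C. g (c \<otimes> y \<otimes> z) * cnj (g z))"
        by (rule bounded_fun_on_sum, rule bgg) (use C y in auto)
      fix z assume z: "z \<in> carrier G"
      obtain c where c: "c \<in> C" "c \<otimes> (y \<otimes> z) \<in> W" using C(3)[of "y \<otimes> z"] y z by auto
      then have "c \<otimes> y \<otimes> z \<in> W" using C y z by (simp add: m_assoc subset_iff)
      then have "Re (g z) \<le> Re (g (c \<otimes> y \<otimes> z) * cnj (g z))" unfolding g_def by auto
      also have "\<dots> \<le> (\<Sum>c\<in>C. Re (g (c \<otimes> y \<otimes> z) * cnj (g z)))"
        by (rule member_le_sum[OF c(1) _ C(1)]) (simp add: g_def)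
      finally show "Re (g z) \<le> Re (\<Sum>c\<in>C. g (c \<otimes> y \<otimes> z) * cnj (g z))" unfolding Re_sum .
    qed
    also have "M (\<lambda>z. \<Sum>c\<in>C. g (c \<otimes> y \<otimes> z) * cnj (g z)) = (\<Sum>c\<in>C. p (c \<otimes> y))"
    proof -
      have "M (\<lambda>z. \<Sum>c\<in>C. g (c \<otimes> y \<otimes> z) * cnj (g z)) = (\<Sum>c\<in>C. M (\<lambda>z. g (c \<otimes> y \<otimes> z) * cnj (g z)))"
        by (rule mean_sum, rule bgg) (use C y in auto)
      also have "\<dots> = (\<Sum>c\<in>C. p (c \<otimes> y))"
        unfolding p_def using C y by (intro sum.cong) auto
      finally show ?thesis .
    qed
    finally show "Re (of_real c0) \<le> (\<Sum>c\<in>C. Re (p (c \<otimes> y)))" by (simp add: Re_sum)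
  qed
  then have Mp: "0 < Re (M p)"
    using c0 mult_nonneg_nonpos[of "real (card C)" "Re (M p)"] by (cases "Re (M p) \<le> 0") auto
  have "Re ((1/2) * M p) = Re (M (\<lambda>y. (1/2) * p y))" unfolding mean_scale[OF bp] ..
  also have "\<dots> \<le> Re (M (\<lambda>y. sdiff a k (\<one> \<otimes> inv y) * p y))"
  proof (rule mean_Re_mono)
    show "bdd (\<lambda>y. sdiff a k (\<one> \<otimes> inv y) * p y)"
      by (rule bdd_conv_integrand[OF bdd_continuous[OF cdk] bp]) simp
    fix y assume y: "y \<in> carrier G"
    show "Re ((1/2) * p y) \<le> Re (sdiff a k (\<one> \<otimes> inv y) * p y)"
      using supp[OF y] Re_p[of y] Im_p[of y] mult_right_mono[of "1/2" "Re (sdiff a k (inv y))" "Re (p y)"] y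
      by auto
  qed (rule bounded_fun_on_mult[OF bounded_fun_on_const bp])
  also have "\<dots> = Re (sdiff a q \<one>)"
    using sdiff_conv[OF bk bp a one_closed] a unfolding q_def sdiff_def conv_def by simp
  finally have "sdiff a q \<one> \<noteq> 0" using Mp by auto
  moreover have clo: "(p, q) \<in> closure (pd_cone k)" using pq closure_subset by blast
  ultimately have pos: "0 < msq (sdiff a q)"
    using msq_pos[OF continuous_sdiff[OF continuous_closure_pd_cone_snd[OF k clo] a], of \<one>] by simp
  define z where "z = (scale_fun (1/c0) p, scale_fun (1/c0) q)"
  have "z \<in> closure (pd_cone k)"
    unfolding z_def using closure_pd_cone_scale[OF bk _ clo, of "1/c0"] c0 by simp
  moreover have "fst z \<one> = 1" unfolding z_def scale_fun_def using p1 c0 by simp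
  moreover have "msq (sdiff a (snd z)) = msq (\<lambda>x. of_real (1/c0) * sdiff a q x)"
    by (rule msq_cong) (simp add: z_def scale_fun_def sdiff_def algebra_simps add_divide_distrib)
  moreover have "\<dots> = (1/c0)\<^sup>2 * msq (sdiff a q)"
    unfolding msq_scale[OF bdd_continuous[OF continuous_sdiff[OF continuous_closure_pd_cone_snd[OF k clo, unfolded snd_conv] a]]]
    using c0 by (simp add: norm_divide)
  moreover have "0 < (1/c0)\<^sup>2 * msq (sdiff a q)" using pos c0 by simp
  ultimately show ?thesis by auto
qed

text \<open>At a maximiser, \<open>p\<close> is a scalar multiple of
  \<open>u = sdiff a (snd z)\<close>, hence multiplicative and continuous; the maximum is positive,
  so \<open>u\<close> is not zero, and this excludes \<open>p a = 1\<close>.\<close>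

lemma exists_character_ne_1_mean:
  assumes a: "a \<in> carrier G" "a \<noteq> \<one>"
  shows "\<exists>h. (\<forall>x\<in>carrier G. \<forall>y\<in>carrier G. h (x \<otimes> y) = h x * h y) \<and>
    (\<forall>x\<in>carrier G. cmod (h x) = 1) \<and> continuous_map T euclidean h \<and> h a \<noteq> (1::complex)"
proof -
  have sing: "closedin T {x}" if "x \<in> carrier G" for x
    using closedin_t1_singleton[OF Hausdorff_imp_t1_space[OF Hausdorff_T]] that topspace_T by simp
  have clA: "closedin T {a, inv a}"
    using closedin_Un[OF sing[of a] sing[of "inv a"]] a by (simp add: insert_commute)
  have ne: "inv a \<noteq> \<one>" using a by (metis inv_inv inv_one)
  \<comment> \<open>Values 1 at the unit and 0 at \<open>a\<close> and \<open>inv a\<close> make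
    \<open>sdiff a k \<one> = 1\<close>.\<close>
  obtain f where f: "continuous_map T (top_of_set {0..1}) f" "f ` {a, inv a} \<subseteq> {0::real}" "f ` {\<one>} \<subseteq> {1}"
    using Urysohn_lemma[OF compact_Hausdorff_or_regular_imp_normal_space[OF compact_T] clA sing[of \<one>], of 0 1]
      Hausdorff_T a ne by (auto simp: disjnt_def)
  define k where "k x = complex_of_real (f x)" for x
  have cf: "continuous_map T euclidean f" and fr: "f ` topspace T \<subseteq> {0..1}"
    using f(1) unfolding continuous_map_in_subtopology by (auto simp: image_subset_iff)
  have ck: "continuous_map T euclidean k"
    unfolding k_def by (rule continuous_map_euclidean_compose[OF cf]) (intro continuous_intros)
  have k1: "\<forall>x\<in>carrier G. cmod (k x) \<le> 1"
    using fr topspace_T unfolding k_def by (auto simp: image_subset_iff)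
  have kv: "k \<one> = 1" "k a = 0" "k (inv a) = 0" using f unfolding k_def by auto
  note bk = bdd_continuous[OF ck]
  define Q where "Q = {z \<in> closure (pd_cone k). fst z \<one> = 1}"
  obtain z0 where z0: "z0 \<in> Q" "0 < msq (sdiff a (snd z0))"
    using pd_cone_sdiff_nonzero[OF ck k1 a(1) kv] unfolding Q_def by blast
  have "\<exists>z\<in>Q. \<forall>z'\<in>Q. msq (sdiff a (snd z')) \<le> msq (sdiff a (snd z))"
  proof (rule continuous_attains_sup)
    show "compact Q" unfolding Q_def by (rule compact_normalised_pd_cone[OF bk k1])
    show "continuous_on Q (\<lambda>z. msq (sdiff a (snd z)))"
      unfolding Q_def by (rule continuous_on_msq_sdiff[OF ck k1 a(1)])
  qed (use z0 in auto)
  then obtain z where z: "z \<in> closure (pd_cone k)" "fst z \<one> = 1"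
    and max: "\<And>z'. z' \<in> closure (pd_cone k) \<Longrightarrow> fst z' \<one> = 1 \<Longrightarrow>
      msq (sdiff a (snd z')) \<le> msq (sdiff a (snd z))"
    unfolding Q_def by blast
  define p u where "p = fst z" and "u = sdiff a (snd z)"
  note B = closure_pd_cone_bounds[OF bk k1 z(1)]
  have p1: "p \<one> = 1" unfolding p_def by (rule z(2))
  have mult: "u (x \<otimes> b) = p b * u x" if "x \<in> carrier G" "b \<in> carrier G" for x b
    unfolding u_def p_def by (rule extremal_pair_multiplicative[OF ck k1 a(1) z max that(2,1)])
  have cq: "continuous_map T euclidean (snd z)" by (rule continuous_closure_pd_cone_snd[OF ck k1 z(1)])
  have cu: "continuous_map T euclidean u" unfolding u_def by (rule continuous_sdiff[OF cq a(1)])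
  have pos: "0 < msq u"
    using max[of z0] z0 unfolding Q_def u_def by auto
  have u1: "u \<one> \<noteq> 0"
  proof
    assume "u \<one> = 0"
    then have "u x = 0" if "x \<in> carrier G" for x using mult[of \<one> x] that by simp
    then have "msq u = msq (\<lambda>_. 0)" by (intro msq_cong) auto
    then show False using pos unfolding msq_def by simp
  qed
  have pu: "p x = u x * (1 / u \<one>)" if "x \<in> carrier G" for x using mult[of \<one> x] u1 that by simp
  have pm: "p (x \<otimes> y) = p x * p y" if "x \<in> carrier G" "y \<in> carrier G" for x y
    using mult[of x y] pu[of "x \<otimes> y"] pu[of x] that by simp
  have pn: "cmod (p x) = 1" if x: "x \<in> carrier G" for x
  proof -
    have le: "cmod (p y) \<le> 1" for y using B(1)[of y] z(2) unfolding p_def by simp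
    have "cmod (p x) * cmod (p (inv x)) = 1"
      using pm[of x "inv x"] x p1 by (simp flip: norm_mult)
    moreover have "cmod (p x) * cmod (p (inv x)) \<le> cmod (p x) * 1"
      by (rule mult_left_mono[OF le]) simp
    ultimately show ?thesis using le[of x] by simp
  qed
  \<comment> \<open>Continuity of \<open>p\<close> is recovered here from its proportionality to
    \<open>u\<close>; membership in the closure of the cone says nothing about it.\<close>
  have cp: "continuous_map T euclidean p"
  proof (rule continuous_map_eq)
    show "continuous_map T euclidean (\<lambda>x. u x * (1 / u \<one>))"
      by (intro continuous_map_complex_mult cu) simp
  qed (simp add: pu topspace_T)
  have "p a \<noteq> 1"
  proof
    assume pa: "p a = 1"
    \<comment> \<open>If \<open>p a = 1\<close>, the factor \<open>cnj (p x)\<close> is unchanged by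
      the translations in \<open>sdiff a\<close>, so \<open>sdiff a f\<close> is the constant
      \<open>u \<one>\<close>; by invariance its mean is \<open>M f - M f\<close>.\<close>
    define f where "f x = snd z x * cnj (p x)" for x
    have bf: "bdd f" unfolding f_def
      by (intro bounded_fun_on_mult bounded_fun_on_cnj bdd_continuous cq cp)
    have inv1: "p (inv a) = 1" using pm[of a "inv a"] a pa p1 by simp
    have bt: "bdd (\<lambda>x. f (x \<otimes> d))" if "d \<in> carrier G" for d
      by (rule bounded_fun_on_comp[OF bf]) (use that in simp)
    have bt2: "bdd (\<lambda>x. (1/2) * f (x \<otimes> d))" if "d \<in> carrier G" for d by (intro bounded_fun_on_mult bounded_fun_on_const bt that)
    have "u \<one> = M (\<lambda>_. u \<one>)" by simp
    also have "\<dots> = M (\<lambda>x. f x - ((1/2) * f (x \<otimes> a) + (1/2) * f (x \<otimes> inv a)))"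
    proof (rule mean_cong)
      fix x assume x: "x \<in> carrier G"
      have "u \<one> * (p x * cnj (p x)) = u \<one>"
        using pn[OF x] by (simp add: complex_norm_square[symmetric])
      moreover have "u x = u \<one> * p x" using mult[of \<one> x] x by simp
      ultimately have "u \<one> = u x * cnj (p x)" by (simp add: mult.assoc)
      then show "u \<one> = f x - ((1/2) * f (x \<otimes> a) + (1/2) * f (x \<otimes> inv a))"
        unfolding u_def sdiff_def f_def using pm x a pa inv1 by (simp add: field_simps)
    qed
    also have "\<dots> = M f - (M (\<lambda>x. (1/2) * f (x \<otimes> a)) + M (\<lambda>x. (1/2) * f (x \<otimes> inv a)))"
      unfolding mean_diff[OF bf bounded_fun_on_add[OF bt2[OF a(1)] bt2[OF inv_closed[OF a(1)]]]]
        mean_add[OF bt2[OF a(1)] bt2[OF inv_closed[OF a(1)]]] ..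
    also have "\<dots> = M f - ((1/2) * M f + (1/2) * M f)"
      unfolding mean_scale[OF bt[OF a(1)]] mean_scale[OF bt[OF inv_closed[OF a(1)]]]
        mean_translate_right[OF a(1) bf] mean_translate_right[OF inv_closed[OF a(1)] bf] ..
    finally show False using u1 by simp
  qed
  then show ?thesis using pm pn cp by blast
qed

end

theorem (in compact_abelian_group) exists_character_ne_1:
  assumes "a \<in> carrier G" "a \<noteq> \<one>"
  shows "\<exists>h. (\<forall>x\<in>carrier G. \<forall>y\<in>carrier G. h (x \<otimes> y) = h x * h y) \<and>
    (\<forall>x\<in>carrier G. cmod (h x) = 1) \<and> continuous_map T euclidean h \<and> h a \<noteq> (1::complex)"
proof -
  obtain M where "invariant_mean G M" using invariant_mean_exists by blast
  then interpret compact_abelian_group_mean G T M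
    by (simp add: compact_abelian_group_mean_def compact_abelian_group_axioms)
  show ?thesis by (rule exists_character_ne_1_mean[OF assms])
qed

section \<open>Characters of discrete abelian groups\<close>

context comm_group
begin

text \<open>The graph of a homomorphism from a subgroup to the circle. For relations, extension is
  inclusion and chains have unions; the last clause, a trivial fibre over the unit, makes the
  relation single-valued.\<close>

definition partial_character :: "('a \<times> complex) set \<Rightarrow> bool" where
  "partial_character g \<longleftrightarrow> g \<subseteq> carrier G \<times> sphere 0 1 \<and> (\<one>, 1) \<in> g \<and>
     (\<forall>x z y w. (x, z) \<in> g \<longrightarrow> (y, w) \<in> g \<longrightarrow> (x \<otimes> y, z * w) \<in> g) \<and>
     (\<forall>x z. (x, z) \<in> g \<longrightarrow> (inv x, inverse z) \<in> g) \<and>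
     (\<forall>z. (\<one>, z) \<in> g \<longrightarrow> z = 1)"

lemma partial_characterD:
  assumes "partial_character g"
  shows "(x, z) \<in> g \<Longrightarrow> x \<in> carrier G" "(x, z) \<in> g \<Longrightarrow> cmod z = 1" "(\<one>, 1) \<in> g"
    "(x, z) \<in> g \<Longrightarrow> (y, w) \<in> g \<Longrightarrow> (x \<otimes> y, z * w) \<in> g"
    "(x, z) \<in> g \<Longrightarrow> (inv x, inverse z) \<in> g" "(\<one>, z) \<in> g \<Longrightarrow> z = 1"
  using assms unfolding partial_character_def by auto

lemma partial_character_unique:
  assumes g: "partial_character g" and "(x, z) \<in> g" "(x, w) \<in> g"
  shows "z = w"
proof -
  have "(x \<otimes> inv x, z * inverse w) \<in> g"
    using partial_characterD(4)[OF g assms(2) partial_characterD(5)[OF g assms(3)]] .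
  then have "(\<one>, z * inverse w) \<in> g" using partial_characterD(1)[OF g assms(2)] by simp
  then have "z * inverse w = 1" by (rule partial_characterD(6)[OF g])
  moreover have "w \<noteq> 0" using partial_characterD(2)[OF g assms(3)] by auto
  ultimately show ?thesis by (simp add: field_simps)
qed

lemma partial_character_int_pow:
  assumes g: "partial_character g" and x: "(x, z) \<in> g"
  shows "(x [^] (k::int), z powi k) \<in> g"
proof -
  have nat: "(x [^] n, z ^ n) \<in> g" for n :: nat
  proof (induction n)
    case 0 then show ?case using partial_characterD(3)[OF g] by simp
  next
    case (Suc n)
    then have "(x [^] n \<otimes> x, z ^ n * z) \<in> g" using partial_characterD(4)[OF g _ x] by blast
    then show ?case by (simp add: mult.commute)
  qed
  then have pos: "(x [^] int n, z powi int n) \<in> g" for n by (simp add: int_pow_int)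
  show ?thesis
  proof (cases k rule: int_cases2)
    case (nonneg n)
    then show ?thesis using pos[of n] by simp
  next
    case (nonpos n)
    show ?thesis
      unfolding nonpos power_int_minus int_pow_neg[OF partial_characterD(1)[OF g x]]
      by (rule partial_characterD(5)[OF g pos])
  qed
qed

text \<open>The new graph lives over the subgroup generated by the old domain and \<open>x\<close>;
  \<open>compat\<close> ensures that powers of \<open>x\<close> lying in the old domain receive no
  second value.\<close>

lemma partial_character_extend:
  assumes g: "partial_character g" and x: "x \<in> carrier G" and \<zeta>: "cmod \<zeta> = 1"
    and compat: "\<And>(k::int) w. (x [^] k, w) \<in> g \<Longrightarrow> w = \<zeta> powi k"
  shows "\<exists>g'. partial_character g' \<and> g \<subseteq> g' \<and> (x, \<zeta>) \<in> g'"
proof -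
  define g' where "g' = {(y \<otimes> x [^] k, w * \<zeta> powi k) | y w (k::int). (y, w) \<in> g}"
  have \<zeta>0: "\<zeta> \<noteq> 0" using \<zeta> by auto
  have c: "y \<in> carrier G" if "(y, w) \<in> g" for y w using partial_characterD(1)[OF g that] .
  have "partial_character g'"
    unfolding partial_character_def
  proof (intro conjI allI impI)
    show "g' \<subseteq> carrier G \<times> sphere 0 1"
      unfolding g'_def using x c partial_characterD(2)[OF g] \<zeta> by (auto simp: norm_mult norm_power_int)
    have "(\<one> \<otimes> x [^] (0::int), 1 * \<zeta> powi 0) \<in> g'"
      unfolding g'_def using partial_characterD(3)[OF g] by blast
    then show "(\<one>, 1) \<in> g'" by simp
  next
    fix a z b w assume "(a, z) \<in> g'" "(b, w) \<in> g'"
    then obtain y1 w1 k1 y2 w2 k2 where e: "a = y1 \<otimes> x [^] (k1::int)" "z = w1 * \<zeta> powi k1" "(y1, w1) \<in> g"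
      "b = y2 \<otimes> x [^] (k2::int)" "w = w2 * \<zeta> powi k2" "(y2, w2) \<in> g"
      unfolding g'_def by blast
    have "(y1 \<otimes> x [^] k1) \<otimes> (y2 \<otimes> x [^] k2) = (y1 \<otimes> y2) \<otimes> (x [^] k1 \<otimes> x [^] k2)"
      using c[OF e(3)] c[OF e(6)] x by (simp only: m_ac m_closed int_pow_closed)
    then have "a \<otimes> b = (y1 \<otimes> y2) \<otimes> x [^] (k1 + k2)" unfolding e using x by (simp add: int_pow_mult)
    moreover have "z * w = (w1 * w2) * \<zeta> powi (k1 + k2)" unfolding e using \<zeta>0 by (simp add: power_int_add)
    ultimately show "(a \<otimes> b, z * w) \<in> g'"
      unfolding g'_def using partial_characterD(4)[OF g e(3) e(6)] by auto
  next
    fix a z assume "(a, z) \<in> g'"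
    then obtain y w k where e: "a = y \<otimes> x [^] (k::int)" "z = w * \<zeta> powi k" "(y, w) \<in> g"
      unfolding g'_def by auto
    have "inv a = inv y \<otimes> x [^] (- k)" unfolding e using c[OF e(3)] x by (simp add: inv_mult int_pow_neg)
    moreover have "inverse z = inverse w * \<zeta> powi (- k)" unfolding e by (simp add: power_int_minus)
    ultimately show "(inv a, inverse z) \<in> g'"
      unfolding g'_def using partial_characterD(5)[OF g e(3)] by auto
  next
    fix z assume "(\<one>, z) \<in> g'"
    then obtain y w k where e: "\<one> = y \<otimes> x [^] (k::int)" "z = w * \<zeta> powi k" "(y, w) \<in> g"
      unfolding g'_def by auto
    have "y = x [^] (- k)" using e(1) c[OF e(3)] x by (metis int_pow_closed int_pow_neg inv_equality inv_inv inv_closed)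
    then have "w = \<zeta> powi (- k)" using compat e(3) by blast
    then show "z = 1" unfolding e(2) using \<zeta>0 by (simp add: power_int_minus)
  qed
  moreover have "g \<subseteq> g'"
  proof clarify
    fix y w assume yw: "(y, w) \<in> g"
    then have "(y \<otimes> x [^] (0::int), w * \<zeta> powi 0) \<in> g'" unfolding g'_def by blast
    then show "(y, w) \<in> g'" using c[OF yw] by simp
  qed
  moreover have "(\<one> \<otimes> x [^] (1::int), 1 * \<zeta> powi 1) \<in> g'"
    unfolding g'_def using partial_characterD(3)[OF g] by blast
  ultimately show ?thesis using x by auto
qed

text \<open>If no positive power of \<open>x\<close> lies in the domain, the value is free and -1 is
  taken. Otherwise let \<open>n\<close> be the least such exponent: by division with remainder, any
  \<open>n\<close>-th root of the value at \<open>x [^] n\<close> is compatible, and since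
  \<open>n \<ge> 2\<close> a root other than 1 exists even when that value is 1.\<close>

lemma exists_compatible_value:
  assumes g: "partial_character g" and x: "x \<in> carrier G" "x \<notin> Domain g"
  shows "\<exists>\<zeta>. cmod \<zeta> = 1 \<and> \<zeta> \<noteq> 1 \<and> (\<forall>(k::int) w. (x [^] k, w) \<in> g \<longrightarrow> w = \<zeta> powi k)"
proof (cases "\<exists>n::nat. n > 0 \<and> x [^] n \<in> Domain g")
  case False
  have "w = (-1) powi k" if kw: "(x [^] k, w) \<in> g" for k :: int and w
  proof (cases "k = 0")
    case True
    then show ?thesis using kw partial_characterD(6)[OF g] by simp
  next
    case k: False
    have "(x [^] \<bar>k\<bar>, if k > 0 then w else inverse w) \<in> g"
      using kw partial_characterD(5)[OF g kw] x by (auto simp: int_pow_neg abs_if)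
    then have "(x [^] nat \<bar>k\<bar>, if k > 0 then w else inverse w) \<in> g"
      using int_pow_int[of G x "nat \<bar>k\<bar>"] by simp
    from DomainI[OF this] have "x [^] nat \<bar>k\<bar> \<in> Domain g" .
    moreover have "nat \<bar>k\<bar> > 0" using k by simp
    ultimately show ?thesis using False by blast
  qed
  then show ?thesis by (intro exI[of _ "-1"]) auto
next
  case True
  define n where "n = (LEAST n::nat. n > 0 \<and> x [^] n \<in> Domain g)"
  have n: "n > 0" "x [^] n \<in> Domain g" unfolding n_def using LeastI_ex[OF True] by auto
  have least: "\<not> (m > 0 \<and> x [^] m \<in> Domain g)" if "m < n" for m :: nat
    using not_less_Least that unfolding n_def by blast
  obtain w0 where w0: "(x [^] n, w0) \<in> g" using n(2) by auto
  have nw0: "cmod w0 = 1" by (rule partial_characterD(2)[OF g w0])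
  have n2: "n \<ge> 2"
  proof (rule ccontr)
    assume "\<not> n \<ge> 2"
    then have "n = 1" using n(1) by simp
    then show False using n(2) x by simp
  qed
  have "\<exists>\<zeta>. \<zeta> ^ n = w0 \<and> \<zeta> \<noteq> 1"
  proof (cases "w0 = 1")
    case True
    have "cis (2 * pi / n) \<noteq> 1"
    proof
      assume "cis (2 * pi / n) = 1"
      then have "cos (2 * pi / n) = 1" by (simp add: complex_eq_iff)
      moreover have "cos (2 * pi / n) < cos 0"
        by (rule cos_monotone_0_pi) (use n2 in \<open>auto simp: field_simps\<close>)
      ultimately show False by simp
    qed
    moreover have "cis (2 * pi / n) ^ n = 1" unfolding Complex.DeMoivre using n(1) by simp
    ultimately show ?thesis using True by blast
  next
    case False
    have "\<exists>\<zeta>. \<zeta> ^ n = w0"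
      by (intro exI[of _ "cis (Arg w0 / n)"])
        (use n(1) nw0 rcis_cmod_Arg[of w0] in \<open>simp add: Complex.DeMoivre rcis_def\<close>)
    then show ?thesis using False by auto
  qed
  then obtain \<zeta> where \<zeta>: "\<zeta> ^ n = w0" "\<zeta> \<noteq> 1" by blast
  have "cmod \<zeta> ^ n = 1" using \<zeta>(1) nw0 by (simp flip: norm_power)
  then have n\<zeta>: "cmod \<zeta> = 1" using n(1) power_eq_imp_eq_base[of "cmod \<zeta>" n 1] by simp
  have "w = \<zeta> powi k" if kw: "(x [^] k, w) \<in> g" for k :: int and w
  proof -
    define q r where "q = k div int n" and "r = k mod int n"
    have kqr: "k = int n * q + r" "0 \<le> r" "r < int n" unfolding q_def r_def using n(1) by auto
    have a: "(x [^] (int n * q), w0 powi q) \<in> g"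
      using partial_character_int_pow[OF g w0, of q] x by (simp add: int_pow_pow int_pow_int[symmetric])
    have "(x [^] k \<otimes> inv (x [^] (int n * q)), w * inverse (w0 powi q)) \<in> g"
      by (rule partial_characterD(4)[OF g kw partial_characterD(5)[OF g a]])
    moreover have "x [^] k \<otimes> inv (x [^] (int n * q)) = x [^] nat r"
      using kqr x by (simp flip: int_pow_diff add: int_pow_int[symmetric])
    ultimately have xr: "(x [^] nat r, w * inverse (w0 powi q)) \<in> g" by simp
    have "nat r < n" using kqr by linarith
    then have "nat r = 0" using least[of "nat r"] DomainI[OF xr] gr0I[of "nat r"] by blast
    then have "w * inverse (w0 powi q) = 1" using xr partial_characterD(6)[OF g] by simp
    moreover have "w0 powi q \<noteq> 0" using nw0 by auto
    ultimately have "w = w0 powi q" by (simp add: field_simps)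
    also have "\<dots> = \<zeta> powi (int n * q)" unfolding \<zeta>(1)[symmetric] by (simp add: power_int_mult)
    also have "int n * q = k" using kqr \<open>nat r = 0\<close> by simp
    finally show ?thesis .
  qed
  then show ?thesis using n\<zeta> \<zeta>(2) by blast
qed

text \<open>The value at \<open>a\<close> is fixed different from 1 before Zorn's lemma is applied;
  a maximal extension has full domain because any single element can be adjoined.\<close>

theorem exists_hom_circle_ne_1:
  assumes a: "a \<in> carrier G" "a \<noteq> \<one>"
  shows "\<exists>h. (\<forall>x\<in>carrier G. \<forall>y\<in>carrier G. h (x \<otimes> y) = h x * h y) \<and>
    (\<forall>x\<in>carrier G. cmod (h x) = 1) \<and> h a \<noteq> (1::complex)"
proof -
  have triv: "partial_character {(\<one>, 1)}" unfolding partial_character_def by auto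
  have "a \<notin> Domain {(\<one>, 1::complex)}" using a by auto
  from exists_compatible_value[OF triv a(1) this]
  obtain \<zeta> where \<zeta>: "cmod \<zeta> = 1" "\<zeta> \<noteq> 1" "\<And>(k::int) w. (a [^] k, w) \<in> {(\<one>, 1)} \<Longrightarrow> w = \<zeta> powi k"
    by blast
  obtain g0 where g0: "partial_character g0" "(a, \<zeta>) \<in> g0"
    using partial_character_extend[OF triv a(1) \<zeta>(1,3)] by blast
  define A where "A = {g. partial_character g \<and> g0 \<subseteq> g}"
  have "\<exists>g\<in>A. \<forall>g'\<in>A. g \<subseteq> g' \<longrightarrow> g' = g"
  proof (rule subset_Zorn_nonempty)
    show "A \<noteq> {}" unfolding A_def using g0 by auto
    fix C assume C: "C \<noteq> {}" "subset.chain A C"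
    have pc: "partial_character g" "g0 \<subseteq> g" if "g \<in> C" for g
      using C(2) that unfolding subset.chain_def A_def by auto
    have two: "\<exists>g\<in>C. u \<in> g \<and> v \<in> g" if uv: "u \<in> \<Union>C" "v \<in> \<Union>C" for u v
    proof -
      obtain X Y where XY: "X \<in> C" "u \<in> X" "Y \<in> C" "v \<in> Y" using uv by blast
      have "X \<subseteq> Y \<or> Y \<subseteq> X" using C(2) XY(1,3) unfolding subset_chain_def by blast
      then show ?thesis using XY by blast
    qed
    have "partial_character (\<Union>C)"
      unfolding partial_character_def
    proof (intro conjI allI impI)
      show "\<Union>C \<subseteq> carrier G \<times> sphere 0 1" using pc(1) unfolding partial_character_def by blast
      show "(\<one>, 1) \<in> \<Union>C" using C(1) pc(1) partial_characterD(3) by blast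
      show "(x \<otimes> y, z * w) \<in> \<Union>C" if "(x, z) \<in> \<Union>C" "(y, w) \<in> \<Union>C" for x z y w
        using two[OF that] pc(1) partial_characterD(4) by blast
      show "(inv x, inverse z) \<in> \<Union>C" if "(x, z) \<in> \<Union>C" for x z
        using that pc(1) partial_characterD(5) by blast
      show "z = 1" if "(\<one>, z) \<in> \<Union>C" for z using that pc(1) partial_characterD(6) by blast
    qed
    then show "\<Union>C \<in> A" unfolding A_def using C(1) pc(2) by blast
  qed
  then obtain g where g: "partial_character g" "g0 \<subseteq> g"
    and max: "\<And>g'. partial_character g' \<Longrightarrow> g \<subseteq> g' \<Longrightarrow> g' = g"
    unfolding A_def by auto
  have dom: "x \<in> Domain g" if x: "x \<in> carrier G" for x
  proof (rule ccontr)
    assume "x \<notin> Domain g"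
    then obtain \<xi> where "cmod \<xi> = 1" "\<And>(k::int) w. (x [^] k, w) \<in> g \<Longrightarrow> w = \<xi> powi k"
      using exists_compatible_value[OF g(1) x] by blast
    then obtain g' where "partial_character g'" "g \<subseteq> g'" "(x, \<xi>) \<in> g'"
      using partial_character_extend[OF g(1) x] by blast
    then show False using max \<open>x \<notin> Domain g\<close> by blast
  qed
  define h where "h x = (SOME z. (x, z) \<in> g)" for x
  have h: "(x, h x) \<in> g" if "x \<in> carrier G" for x
    unfolding h_def by (rule someI_ex) (use dom[OF that] in blast)
  have "h (x \<otimes> y) = h x * h y" if "x \<in> carrier G" "y \<in> carrier G" for x y
    by (rule partial_character_unique[OF g(1) h partial_characterD(4)[OF g(1) h h]]) (use that in auto)
  moreover have "cmod (h x) = 1" if "x \<in> carrier G" for x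
    using partial_characterD(2)[OF g(1) h[OF that]] .
  moreover have "h a = \<zeta>" by (rule partial_character_unique[OF g(1) h[OF a(1)]]) (use g0 g in auto)
  ultimately show ?thesis using \<zeta>(2) by blast
qed

end

section \<open>Abelian inverse monoids\<close>

lemma Tdot_simps [simp]:
  "carrier Tdot = {z. cmod z \<in> {0, 1}}" "mult Tdot = (*)" "one Tdot = 1"
  "opens Tdot = top_of_set {z. cmod z \<in> {0, 1}}"
  by (simp_all add: Tdot_def)

lemma Tdot_inverse_eq_cnj:
  fixes a b :: complex
  assumes "cmod a = 0 \<or> cmod a = 1" "a * b * a = a" "b * a * b = b"
  shows "b = cnj a"
proof (cases "a = 0")
  case False
  then have "a * b = 1" "a * cnj a = 1"
    using assms by (auto simp: complex_norm_square[symmetric])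
  then have "a * b = a * cnj a" by simp
  then show ?thesis using False by simp
qed (use assms(3) in simp)

lemma continuous_map_clopen_if:
  assumes "openin X A" "closedin X A" "continuous_map (subtopology X A) Y f" "c \<in> topspace Y"
  shows "continuous_map X Y (\<lambda>x. if x \<in> A then f x else c)"
proof (rule pasting_lemma[where I = UNIV and T = "\<lambda>b. if b then A else topspace X - A"
      and f = "\<lambda>b. if b then f else (\<lambda>_. c)"])
  show "\<exists>j. j \<in> UNIV \<and> x \<in> (if j then A else topspace X - A) \<and>
      (if x \<in> A then f x else c) = (if j then f else (\<lambda>_. c)) x" if "x \<in> topspace X" for x
    using that by (intro exI[of _ "x \<in> A"]) auto
qed (use assms in \<open>auto split: if_splits\<close>)

text \<open>The setting shared by \<open>S\<close>, its dual and its bidual: results about duals are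
  proved here once and instantiated again at \<open>dual_inverse_monoid S\<close>.\<close>

locale spaced_monoid = monoid S for S :: "('a, 'b) top_monoid_scheme" (structure) +
  assumes topspace_carrier: "topspace (opens S) = carrier S"
begin

abbreviation "\<T> \<equiv> opens S"

lemma dual_carrier_iff:
  "h \<in> dual_carrier S \<longleftrightarrow> h \<in> extensional (carrier S) \<and> (\<forall>x\<in>carrier S. cmod (h x) \<in> {0, 1}) \<and>
     (\<forall>x\<in>carrier S. \<forall>y\<in>carrier S. h (x \<otimes> y) = h x * h y) \<and> h \<one> = 1 \<and> continuous_map \<T> euclidean h"
  unfolding dual_carrier_def monoid_homs_def continuous_maps_def hom_def
  by (auto simp: continuous_map_in_subtopology topspace_carrier)

lemma dualD:
  assumes "h \<in> dual_carrier S"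
  shows "h \<in> extensional (carrier S)" "x \<in> carrier S \<Longrightarrow> cmod (h x) = 0 \<or> cmod (h x) = 1"
    "x \<in> carrier S \<Longrightarrow> y \<in> carrier S \<Longrightarrow> h (x \<otimes> y) = h x * h y" "h \<one> = 1"
    "continuous_map \<T> euclidean h"
  using assms unfolding dual_carrier_iff by auto

end

sublocale topological_monoid \<subseteq> spaced_monoid
  by unfold_locales (rule topspace_opens)

context topological_monoid
begin

lemma continuous_map_mult_comp:
  assumes "continuous_map Z \<T> f" "continuous_map Z \<T> g"
  shows "continuous_map Z \<T> (\<lambda>z. f z \<otimes> g z)"
  using continuous_map_compose[OF continuous_map_pairedI[OF assms] continuous_mult] by (simp add: o_def)

lemma continuous_map_translate:
  "c \<in> carrier S \<Longrightarrow> continuous_map \<T> \<T> (\<lambda>x. x \<otimes> c)"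
  by (intro continuous_map_mult_comp; simp add: topspace_opens continuous_map_id[unfolded id_def])

end

locale abelian_inverse_monoid = comm_monoid S for S :: "('a, 'b) top_monoid_scheme" (structure) +
  assumes unique_inverse: "x \<in> carrier S \<Longrightarrow> \<exists>!y. is_semigroup_inverse S x y"
begin

abbreviation sinv :: "'a \<Rightarrow> 'a" where "sinv \<equiv> semigroup_inverse S"

definition supp :: "'a \<Rightarrow> 'a" where "supp x = x \<otimes> sinv x"

lemma sinv_eqI: "x \<in> carrier S \<Longrightarrow> is_semigroup_inverse S x y \<Longrightarrow> sinv x = y"
  unfolding semigroup_inverse_def using unique_inverse by (rule the1_equality)

lemma sinv_inverse: "x \<in> carrier S \<Longrightarrow> is_semigroup_inverse S x (sinv x)"
  unfolding semigroup_inverse_def by (rule theI'[OF unique_inverse])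

lemma sinv_closed [simp, intro]: "x \<in> carrier S \<Longrightarrow> sinv x \<in> carrier S"
  using sinv_inverse unfolding is_semigroup_inverse_def by blast

lemma sinv_laws:
  assumes "x \<in> carrier S"
  shows "x \<otimes> sinv x \<otimes> x = x" "sinv x \<otimes> x \<otimes> sinv x = sinv x"
  using sinv_inverse[OF assms] unfolding is_semigroup_inverse_def by auto

lemma supp_closed [simp, intro]: "x \<in> carrier S \<Longrightarrow> supp x \<in> carrier S"
  unfolding supp_def by auto

lemma supp_mult_self: "x \<in> carrier S \<Longrightarrow> supp x \<otimes> x = x"
  unfolding supp_def by (rule sinv_laws)

lemma supp_idem: "x \<in> carrier S \<Longrightarrow> supp x \<otimes> supp x = supp x"
  unfolding supp_def using sinv_laws[of x] by (metis m_assoc m_closed sinv_closed)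

lemma sinv_mult: "x \<in> carrier S \<Longrightarrow> y \<in> carrier S \<Longrightarrow> sinv (x \<otimes> y) = sinv x \<otimes> sinv y"
proof (rule sinv_eqI)
  assume xy: "x \<in> carrier S" "y \<in> carrier S"
  have "x \<otimes> y \<otimes> (sinv x \<otimes> sinv y) \<otimes> (x \<otimes> y) = (x \<otimes> sinv x \<otimes> x) \<otimes> (y \<otimes> sinv y \<otimes> y)"
    "sinv x \<otimes> sinv y \<otimes> (x \<otimes> y) \<otimes> (sinv x \<otimes> sinv y) = (sinv x \<otimes> x \<otimes> sinv x) \<otimes> (sinv y \<otimes> y \<otimes> sinv y)"
    using xy by (simp_all only: m_ac m_closed sinv_closed)
  then show "is_semigroup_inverse S (x \<otimes> y) (sinv x \<otimes> sinv y)"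
    unfolding is_semigroup_inverse_def using xy by (simp add: sinv_laws)
qed simp

lemma sinv_sinv: "x \<in> carrier S \<Longrightarrow> sinv (sinv x) = x"
  by (rule sinv_eqI) (use sinv_laws in \<open>auto simp: is_semigroup_inverse_def\<close>)

lemma sinv_idem: "x \<in> carrier S \<Longrightarrow> x \<otimes> x = x \<Longrightarrow> sinv x = x"
  by (rule sinv_eqI) (auto simp: is_semigroup_inverse_def)

lemma supp_of_idem: "x \<in> carrier S \<Longrightarrow> x \<otimes> x = x \<Longrightarrow> supp x = x"
  unfolding supp_def by (simp add: sinv_idem)

lemma supp_mult: "x \<in> carrier S \<Longrightarrow> y \<in> carrier S \<Longrightarrow> supp (x \<otimes> y) = supp x \<otimes> supp y"
  unfolding supp_def by (simp add: sinv_mult m_ac)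

lemma supp_sinv: "x \<in> carrier S \<Longrightarrow> supp (sinv x) = supp x"
  unfolding supp_def by (simp add: sinv_sinv m_comm)

lemma supp_one: "supp \<one> = \<one>"
  by (simp add: supp_of_idem)

lemma supp_in_idempotents: "x \<in> carrier S \<Longrightarrow> supp x \<in> idempotents S"
  unfolding idempotents_def by (simp add: supp_idem)

lemma idempotents_mult:
  assumes "e \<in> idempotents S" "f \<in> idempotents S"
  shows "e \<otimes> f \<in> idempotents S"
proof -
  have c: "e \<in> carrier S" "f \<in> carrier S" and i: "e \<otimes> e = e" "f \<otimes> f = f"
    using assms unfolding idempotents_def by auto
  have "e \<otimes> f \<otimes> (e \<otimes> f) = (e \<otimes> e) \<otimes> (f \<otimes> f)" using c by (simp only: m_ac m_closed)
  then show ?thesis unfolding idempotents_def using c i by simp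
qed

definition max_subgroup :: "'a \<Rightarrow> ('a, 'b) top_monoid_scheme" where
  "max_subgroup e = S\<lparr>carrier := {s \<in> carrier S. supp s = e}, one := e\<rparr>"

lemma max_subgroup_simps [simp]:
  "carrier (max_subgroup e) = {s \<in> carrier S. supp s = e}" "mult (max_subgroup e) = mult S"
  "one (max_subgroup e) = e"
  unfolding max_subgroup_def by simp_all

lemma max_subgroup_comm_group:
  assumes e: "e \<in> idempotents S"
  shows "comm_group (max_subgroup e)"
proof -
  have e': "e \<in> carrier S" "e \<otimes> e = e" using e unfolding idempotents_def by auto
  show ?thesis
  proof (rule comm_groupI)
    fix x assume "x \<in> carrier (max_subgroup e)"
    then have "sinv x \<in> carrier (max_subgroup e)" "sinv x \<otimes> x = e"
      using m_comm[of "sinv x" x] by (auto simp: supp_sinv) (simp add: supp_def)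
    then show "\<exists>y\<in>carrier (max_subgroup e). y \<otimes>\<^bsub>max_subgroup e\<^esub> x = \<one>\<^bsub>max_subgroup e\<^esub>"
      by auto
  next
    fix x assume "x \<in> carrier (max_subgroup e)"
    then show "\<one>\<^bsub>max_subgroup e\<^esub> \<otimes>\<^bsub>max_subgroup e\<^esub> x = x"
      using supp_mult_self by auto
  qed (use e' in \<open>auto simp: supp_mult supp_of_idem m_ac\<close>)
qed

lemma max_subgroup_inv:
  assumes e: "e \<in> idempotents S" and x: "x \<in> carrier (max_subgroup e)"
  shows "m_inv (max_subgroup e) x = sinv x"
proof -
  interpret H: comm_group "max_subgroup e" by (rule max_subgroup_comm_group[OF e])
  have "sinv x \<in> carrier (max_subgroup e)" using x by (simp add: supp_sinv)
  moreover have "sinv x \<otimes> x = e" using x m_comm[of "sinv x" x] by (simp add: supp_def)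
  ultimately show ?thesis using x by (intro H.inv_equality) simp_all
qed

end

locale abelian_topological_inverse_monoid =
  topological_inverse_monoid S + comm_monoid S for S :: "('a, 'b) top_monoid_scheme" (structure)
begin

sublocale abelian_inverse_monoid S
  by unfold_locales (rule unique_semigroup_inverse)

lemma continuous_supp: "continuous_map \<T> \<T> supp"
  unfolding supp_def[abs_def]
  by (intro continuous_map_mult_comp continuous_inversion) (simp add: continuous_map_id[unfolded id_def])

lemma dual_sinv:
  assumes h: "h \<in> dual_carrier S" and x: "x \<in> carrier S"
  shows "h (sinv x) = cnj (h x)"
proof (rule Tdot_inverse_eq_cnj)
  show "h x * h (sinv x) * h x = h x" "h (sinv x) * h x * h (sinv x) = h (sinv x)"
    using sinv_laws[OF x] dualD(3)[OF h] x by (metis m_closed sinv_closed)+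
qed (rule dualD(2)[OF h x])

lemma dual_supp:
  assumes h: "h \<in> dual_carrier S" and x: "x \<in> carrier S"
  shows "h (supp x) = (if h x = 0 then 0 else 1)"
proof -
  have "h (supp x) = h x * cnj (h x)" unfolding supp_def using dual_sinv[OF h x] dualD(3)[OF h] x by simp
  then show ?thesis using dualD(2)[OF h x] by (auto simp: complex_norm_square[symmetric])
qed

text \<open>A product lies in the clopen set exactly when both factors do, so extension by 0 is
  multiplicative; multiplication by \<open>e\<close> sends that set into the maximal subgroup at
  \<open>e\<close>.\<close>

lemma extended_character_in_dual:
  assumes e: "e \<in> idempotents S"
    and up: "openin \<T> {s \<in> carrier S. supp s \<otimes> e = e}" "closedin \<T> {s \<in> carrier S. supp s \<otimes> e = e}"
    and c_mult: "\<And>x y. x \<in> carrier (max_subgroup e) \<Longrightarrow> y \<in> carrier (max_subgroup e) \<Longrightarrow> c (x \<otimes> y) = c x * c y"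
    and c_norm: "\<And>x. x \<in> carrier (max_subgroup e) \<Longrightarrow> cmod (c x) = 1"
    and c_cont: "continuous_map (subtopology \<T> (carrier (max_subgroup e))) euclidean c"
  shows "(\<lambda>s\<in>carrier S. if supp s \<otimes> e = e then c (e \<otimes> s) else 0) \<in> dual_carrier S"
proof -
  have e': "e \<in> carrier S" "e \<otimes> e = e" using e unfolding idempotents_def by auto
  define A where "A = {s \<in> carrier S. supp s \<otimes> e = e}"
  have eA: "e \<otimes> s \<in> carrier (max_subgroup e)" if "s \<in> A" for s
    using that e' m_comm[of e "supp s"] unfolding A_def by (simp add: supp_mult supp_of_idem)
  \<comment> \<open>Each of the idempotents \<open>supp x\<close> and \<open>supp y\<close> is
    absorbed by \<open>supp x \<otimes> supp y \<otimes> e\<close>.\<close>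
  have A_mult: "x \<otimes> y \<in> A \<longleftrightarrow> x \<in> A \<and> y \<in> A" if xy: "x \<in> carrier S" "y \<in> carrier S" for x y
  proof
    assume "x \<otimes> y \<in> A"
    then have *: "supp x \<otimes> supp y \<otimes> e = e" unfolding A_def using xy by (simp add: supp_mult)
    have "supp x \<otimes> e = supp x \<otimes> (supp x \<otimes> supp y \<otimes> e)" "supp y \<otimes> e = supp y \<otimes> (supp x \<otimes> supp y \<otimes> e)"
      using * by simp_all
    moreover have "supp x \<otimes> (supp x \<otimes> supp y \<otimes> e) = (supp x \<otimes> supp x) \<otimes> supp y \<otimes> e"
      "supp y \<otimes> (supp x \<otimes> supp y \<otimes> e) = supp x \<otimes> (supp y \<otimes> supp y) \<otimes> e"
      using xy e' by (simp_all only: m_ac m_closed supp_closed)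
    ultimately show "x \<in> A \<and> y \<in> A" unfolding A_def using * xy by (simp add: supp_idem)
  next
    assume "x \<in> A \<and> y \<in> A"
    then show "x \<otimes> y \<in> A" unfolding A_def using xy e' by (simp add: supp_mult m_assoc)
  qed
  have cm: "c (e \<otimes> (x \<otimes> y)) = c (e \<otimes> x) * c (e \<otimes> y)" if "x \<in> A" "y \<in> A" for x y
  proof -
    have "x \<in> carrier S" "y \<in> carrier S" using that unfolding A_def by auto
    then have "(e \<otimes> x) \<otimes> (e \<otimes> y) = (e \<otimes> e) \<otimes> (x \<otimes> y)" using e'(1) by (simp only: m_ac m_closed)
    then show ?thesis using c_mult[OF eA[OF that(1)] eA[OF that(2)]] e' by simp
  qed
  have ce: "c e = 1"
  proof -
    have "e \<in> carrier (max_subgroup e)" using e' by (simp add: supp_of_idem)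
    then have "c e * c e = c e" "cmod (c e) = 1" using c_mult[of e e] c_norm[of e] e' by auto
    then show ?thesis by auto
  qed
  define h where "h s = (if s \<in> A then c (e \<otimes> s) else 0)" for s
  have cont: "continuous_map \<T> euclidean h"
    unfolding h_def
  proof (rule continuous_map_clopen_if)
    show "openin \<T> A" "closedin \<T> A" unfolding A_def by (rule up)+
    have "continuous_map (subtopology \<T> A) \<T> (\<lambda>s. e \<otimes> s)"
      by (intro continuous_map_mult_comp)
        (use e' in \<open>simp_all add: topspace_opens continuous_map_from_subtopology[OF continuous_map_id[unfolded id_def]]\<close>)
    then have "continuous_map (subtopology \<T> A) (subtopology \<T> (carrier (max_subgroup e))) (\<lambda>s. e \<otimes> s)"
      by (rule continuous_map_into_subtopology) (use eA in auto)
    from continuous_map_compose[OF this c_cont]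
    show "continuous_map (subtopology \<T> A) euclidean (\<lambda>s. c (e \<otimes> s))" by (simp add: o_def)
  qed simp
  have eq: "(\<lambda>s\<in>carrier S. if supp s \<otimes> e = e then c (e \<otimes> s) else 0) x = h x" if "x \<in> carrier S" for x
    using that unfolding h_def A_def by simp
  show ?thesis
    unfolding dual_carrier_iff
  proof (intro conjI ballI)
    show "continuous_map \<T> euclidean (\<lambda>s\<in>carrier S. if supp s \<otimes> e = e then c (e \<otimes> s) else 0)"
      by (rule continuous_map_eq[OF cont]) (use eq topspace_opens in auto)
    fix x y assume xy: "x \<in> carrier S" "y \<in> carrier S"
    show "(\<lambda>s\<in>carrier S. if supp s \<otimes> e = e then c (e \<otimes> s) else 0) (x \<otimes> y) =
      (\<lambda>s\<in>carrier S. if supp s \<otimes> e = e then c (e \<otimes> s) else 0) x *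
      (\<lambda>s\<in>carrier S. if supp s \<otimes> e = e then c (e \<otimes> s) else 0) y"
      unfolding eq[OF xy(1)] eq[OF xy(2)] eq[OF m_closed[OF xy]] h_def using A_mult[OF xy] cm by auto
  next
    fix x assume x: "x \<in> carrier S"
    show "cmod ((\<lambda>s\<in>carrier S. if supp s \<otimes> e = e then c (e \<otimes> s) else 0) x) \<in> {0, 1}"
      unfolding eq[OF x] h_def using c_norm[OF eA] by auto
  next
    show "(\<lambda>s\<in>carrier S. if supp s \<otimes> e = e then c (e \<otimes> s) else 0) \<one> = 1"
      using ce e' by (simp add: supp_one)
  qed simp
qed

end

section \<open>Separation of points\<close>

lemma compact_space_indexed_fip:
  assumes X: "compact_space X" and C: "\<And>i. i \<in> I \<Longrightarrow> closedin X (C i)"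
    and fin: "\<And>J. finite J \<Longrightarrow> J \<subseteq> I \<Longrightarrow> \<exists>x\<in>topspace X. \<forall>i\<in>J. x \<in> C i"
  shows "\<exists>x\<in>topspace X. \<forall>i\<in>I. x \<in> C i"
proof (rule ccontr)
  assume "\<not> ?thesis"
  then have cover: "topspace X \<subseteq> (\<Union>i\<in>I. topspace X - C i)" by blast
  have "openin X (topspace X - C i)" if "i \<in> I" for i using C[OF that] by blast
  from compact_space_indexed_cover[OF X this cover]
  obtain J where J: "finite J" "J \<subseteq> I" "topspace X \<subseteq> (\<Union>i\<in>J. topspace X - C i)" .
  then show False using fin[OF J(1,2)] by blast
qed

lemma zero_dimensional_spaceI:
  assumes "\<And>U x. openin X U \<Longrightarrow> x \<in> U \<Longrightarrow> \<exists>V. openin X V \<and> closedin X V \<and> x \<in> V \<and> V \<subseteq> U"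
  shows "zero_dimensional_space X"
  unfolding zero_dimensional_space_def arbitrary_union_of_alt using assms by blast

lemma zero_dimensional_spaceE:
  assumes "zero_dimensional_space X" "openin X U" "x \<in> U"
  obtains V where "openin X V" "closedin X V" "x \<in> V" "V \<subseteq> U"
proof -
  obtain \<U> where "\<U> \<subseteq> {V. openin X V \<and> closedin X V}" "\<Union>\<U> = U"
    using assms(1,2) unfolding zero_dimensional_space_def union_of_def arbitrary_def by auto
  then show thesis using that assms(3) by blast
qed

context topological_monoid
begin

abbreviation "\<E> \<equiv> subtopology \<T> (idempotents S)"

lemma topspace_E: "topspace \<E> = idempotents S"
  unfolding topspace_subtopology topspace_opens by (auto simp: idempotents_def)

lemma closedin_idempotents: "closedin \<T> (idempotents S)"
proof -
  have "closedin \<T> {x \<in> topspace \<T>. x \<otimes> x = x}"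
    by (rule closedin_continuous_maps_eq[OF Hausdorff_opens continuous_map_mult_comp])
      (simp_all add: continuous_map_id[unfolded id_def])
  then show ?thesis unfolding topspace_opens idempotents_def .
qed

end

section \<open>Clopen principal filters of idempotents\<close>

context abelian_topological_inverse_monoid
begin

lemma continuous_E_mult:
  assumes "continuous_map Z \<E> f" "continuous_map Z \<E> g"
  shows "continuous_map Z \<E> (\<lambda>z. f z \<otimes> g z)"
proof -
  have "continuous_map Z \<T> f" "f \<in> topspace Z \<rightarrow> idempotents S"
    "continuous_map Z \<T> g" "g \<in> topspace Z \<rightarrow> idempotents S"
    using assms unfolding continuous_map_in_subtopology by auto
  then show ?thesis
    unfolding continuous_map_in_subtopology
    by (auto intro!: continuous_map_mult_comp idempotents_mult)
qed

text \<open>A clopen \<open>W\<close> need not be compatible with multiplication, but its congruence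
  is. The \<open>y\<close> with \<open>y \<otimes> e\<close> equivalent to \<open>e\<close> form a
  clopen filter; by compactness it has a least element, which is equivalent to \<open>e\<close> and
  hence lies in \<open>W\<close>.\<close>

lemma clopen_upset_below_compact:
  assumes comp: "compact_space \<T>" and W: "openin \<E> W" "closedin \<E> W" and e: "e \<in> W"
  shows "\<exists>f\<in>W. f \<otimes> e = f \<and> openin \<T> {s \<in> carrier S. supp s \<otimes> f = f} \<and>
    closedin \<T> {s \<in> carrier S. supp s \<otimes> f = f}"
proof -
  let ?E = "idempotents S"
  have compE: "compact_space \<E>"
    using closedin_compact_space[OF comp closedin_idempotents] compactin_subspace by blast
  have Ec: "x \<in> carrier S" "x \<otimes> x = x" if "x \<in> ?E" for x using that unfolding idempotents_def by auto
  have eE: "e \<in> ?E" using e openin_subset[OF W(1)] topspace_E by auto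
  have one: "\<one> \<in> ?E" unfolding idempotents_def by simp
  text \<open>The syntactic congruence of \<open>W\<close> has clopen classes by compactness.\<close>
  define eqv where "eqv x y \<longleftrightarrow> (\<forall>u\<in>?E. x \<otimes> u \<in> W \<longleftrightarrow> y \<otimes> u \<in> W)" for x y
  have eqv_refl: "eqv x x" and eqv_sym: "eqv x y \<Longrightarrow> eqv y x"
    and eqv_trans: "eqv x y \<Longrightarrow> eqv y z \<Longrightarrow> eqv x z" for x y z
    unfolding eqv_def by auto
  have eqv_mult: "eqv (x \<otimes> z) (y \<otimes> z)" if "eqv x y" "x \<in> ?E" "y \<in> ?E" "z \<in> ?E" for x y z
    using that idempotents_mult Ec unfolding eqv_def by (simp add: m_assoc)
  define Cl where "Cl = {y \<in> ?E. eqv y e}"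
  let ?P = "prod_topology \<E> \<E>"
  have tr: "continuous_map \<E> \<E> (\<lambda>y. y \<otimes> u)" if "u \<in> ?E" for u
    by (intro continuous_E_mult) (simp_all add: topspace_E that continuous_map_id[unfolded id_def] del: topspace_subtopology)
  have c1: "continuous_map ?P \<E> (\<lambda>p. fst p \<otimes> snd p)"
    by (intro continuous_E_mult continuous_map_fst continuous_map_snd)
  have c2: "continuous_map ?P \<E> (\<lambda>p. e \<otimes> snd p)"
    by (intro continuous_E_mult continuous_map_snd) (simp add: topspace_E eE del: topspace_subtopology)
  have op: "openin ?P {p \<in> topspace ?P. f p \<in> W}" "openin ?P {p \<in> topspace ?P. f p \<notin> W}"
    if "continuous_map ?P \<E> f" for f
  proof -
    show "openin ?P {p \<in> topspace ?P. f p \<in> W}" by (rule openin_continuous_map_preimage[OF that W(1)])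
    have "openin ?P (topspace ?P - {p \<in> topspace ?P. f p \<in> W})"
      by (rule openin_diff[OF openin_topspace closedin_continuous_map_preimage[OF that W(2)]])
    moreover have "topspace ?P - {p \<in> topspace ?P. f p \<in> W} = {p \<in> topspace ?P. f p \<notin> W}" by blast
    ultimately show "openin ?P {p \<in> topspace ?P. f p \<notin> W}" by simp
  qed
  \<comment> \<open>Membership in the class quantifies over all multipliers; the tube lemma over the
    compact semilattice makes this condition open.\<close>
  have "openin ?P ({p \<in> topspace ?P. fst p \<otimes> snd p \<in> W} \<inter> {p \<in> topspace ?P. e \<otimes> snd p \<in> W} \<union>
      {p \<in> topspace ?P. fst p \<otimes> snd p \<notin> W} \<inter> {p \<in> topspace ?P. e \<otimes> snd p \<notin> W})"
    by (intro openin_Un openin_Int op c1 c2)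
  from openin_forall_compact_space[OF compE this]
  have Cl_open: "openin \<E> Cl"
    by (rule back_subst[where P = "openin \<E>"])
      (auto simp: Cl_def eqv_def topspace_E simp del: topspace_subtopology)
  \<comment> \<open>The complement of the class is a union of open sets, one for each
    multiplier.\<close>
  have "openin \<E> (\<Union>u\<in>?E. {y \<in> ?E. (y \<otimes> u \<in> W) \<noteq> (e \<otimes> u \<in> W)})"
  proof (intro openin_Union ballI, clarify)
    fix u assume u: "u \<in> ?E"
    have a: "openin \<E> {y \<in> ?E. y \<otimes> u \<in> W}"
      using openin_continuous_map_preimage[OF tr[OF u] W(1)] unfolding topspace_E .
    have "openin \<E> (?E - {y \<in> ?E. y \<otimes> u \<in> W})"
      using openin_diff[OF openin_topspace closedin_continuous_map_preimage[OF tr[OF u] W(2)]]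
      unfolding topspace_E .
    moreover have "?E - {y \<in> ?E. y \<otimes> u \<in> W} = {y \<in> ?E. y \<otimes> u \<notin> W}" by blast
    ultimately show "openin \<E> {y \<in> ?E. (y \<otimes> u \<in> W) \<noteq> (e \<otimes> u \<in> W)}"
      using a by (cases "e \<otimes> u \<in> W") auto
  qed
  moreover have "(\<Union>u\<in>?E. {y \<in> ?E. (y \<otimes> u \<in> W) \<noteq> (e \<otimes> u \<in> W)}) = topspace \<E> - Cl"
    unfolding topspace_E Cl_def eqv_def by blast
  moreover have "Cl \<subseteq> topspace \<E>" unfolding topspace_E Cl_def by blast
  ultimately have Cl_closed: "closedin \<E> Cl" unfolding closedin_def by simp
  \<comment> \<open>In order terms: the elements that lie above \<open>e\<close> up to the
    congruence.\<close>
  define F where "F = {y \<in> ?E. eqv (y \<otimes> e) e}"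
  have F_alt: "F = {y \<in> topspace \<E>. y \<otimes> e \<in> Cl}"
    unfolding F_def Cl_def topspace_E using idempotents_mult eE by auto
  have F_open: "openin \<E> F" unfolding F_alt by (rule openin_continuous_map_preimage[OF tr[OF eE] Cl_open])
  have F_closed: "closedin \<E> F" unfolding F_alt by (rule closedin_continuous_map_preimage[OF tr[OF eE] Cl_closed])
  have FE: "y \<in> ?E" if "y \<in> F" for y using that unfolding F_def by auto
  have eF: "e \<in> F" unfolding F_def using eE Ec[OF eE] eqv_refl by simp
  have F_mult: "y \<otimes> z \<in> F" if "y \<in> F" "z \<in> F" for y z
  proof -
    have yz: "y \<in> ?E" "z \<in> ?E" using that FE by auto
    have "eqv (y \<otimes> e \<otimes> z) (e \<otimes> z)"
      using eqv_mult[of "y \<otimes> e" e z] that yz eE idempotents_mult unfolding F_def by auto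
    moreover have "y \<otimes> e \<otimes> z = y \<otimes> z \<otimes> e" "e \<otimes> z = z \<otimes> e" using Ec yz eE by (simp_all add: m_ac)
    ultimately have "eqv (y \<otimes> z \<otimes> e) e" using that(2) eqv_trans unfolding F_def by auto
    then show ?thesis unfolding F_def using yz idempotents_mult by auto
  qed
  have F_up: "y \<in> F" if "y \<otimes> z \<in> F" "y \<in> ?E" "z \<in> ?E" for y z
  proof -
    have k: "eqv (y \<otimes> z \<otimes> e) e" using that(1) unfolding F_def by auto
    have "eqv (y \<otimes> z \<otimes> e \<otimes> y) (e \<otimes> y)"
      by (rule eqv_mult[OF k]) (use that eE idempotents_mult in auto)
    moreover have "y \<otimes> z \<otimes> e \<otimes> y = (y \<otimes> y) \<otimes> z \<otimes> e"
      using Ec(1) that(2,3) eE by (simp only: m_ac m_closed)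
    moreover have "e \<otimes> y = y \<otimes> e" using Ec(1) that(2) eE by (simp add: m_comm)
    ultimately have "eqv (y \<otimes> z \<otimes> e) (y \<otimes> e)" using Ec(2)[OF that(2)] by simp
    then have "eqv (y \<otimes> e) e" using k eqv_sym eqv_trans by blast
    then show ?thesis unfolding F_def using that(2) by simp
  qed
  \<comment> \<open>Being below each \<open>z \<in> F\<close> is a closed condition; finitely many
    such conditions are met by a product, and compactness meets all of them.\<close>
  have "\<exists>f\<in>topspace \<E>. \<forall>z\<in>F. f \<in> {y \<in> F. y \<otimes> z = y}"
  proof (rule compact_space_indexed_fip[OF compE])
    fix z assume "z \<in> F"
    have "closedin \<E> {y \<in> topspace \<E>. y \<otimes> z = y}"
      by (rule closedin_continuous_maps_eq[OF Hausdorff_space_subtopology[OF Hausdorff_opens] tr])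
        (use FE \<open>z \<in> F\<close> in \<open>simp_all add: continuous_map_id[unfolded id_def]\<close>)
    from closedin_Int[OF F_closed this]
    show "closedin \<E> {y \<in> F. y \<otimes> z = y}"
      by (rule back_subst[where P = "closedin \<E>"]) (auto simp: F_alt)
  next
    fix J assume "finite J" "J \<subseteq> F"
    then have "\<exists>y\<in>F. \<forall>z\<in>J. y \<otimes> z = y"
    proof (induction J rule: finite_induct)
      case empty then show ?case using eF by auto
    next
      case (insert z J)
      then obtain y where y: "y \<in> F" "\<forall>z\<in>J. y \<otimes> z = y" by auto
      have zF: "z \<in> F" using insert.prems by auto
      have "(y \<otimes> z) \<otimes> z' = y \<otimes> z" if "z' \<in> insert z J" for z'
      proof -
        have z': "z' \<in> F" using that insert.prems by auto
        have cs: "y \<in> carrier S" "z \<in> carrier S" "z' \<in> carrier S" using FE Ec y(1) zF z' by auto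
        show ?thesis
        proof (cases "z' = z")
          case True
          then show ?thesis using Ec(2)[OF FE[OF zF]] cs by (simp add: m_assoc)
        next
          case False
          then have "y \<otimes> z' = y" using that y by auto
          moreover have "(y \<otimes> z) \<otimes> z' = (y \<otimes> z') \<otimes> z" using cs by (simp only: m_ac)
          ultimately show ?thesis by simp
        qed
      qed
      then show ?case using F_mult[OF y(1) zF] by blast
    qed
    then show "\<exists>f\<in>topspace \<E>. \<forall>z\<in>J. f \<in> {y \<in> F. y \<otimes> z = y}" using FE topspace_E by blast
  qed
  then obtain f where f: "f \<in> F" "\<And>z. z \<in> F \<Longrightarrow> f \<otimes> z = f" using eF by blast
  have "f \<in> W"
  proof -
    have "f \<otimes> e = f" using f(2)[OF eF] .
    then have "eqv f e" using f(1) unfolding F_def by simp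
    \<comment> \<open>The congruence is tested at the multiplier \<open>\<one>\<close>.\<close>
    then have "f \<otimes> \<one> \<in> W \<longleftrightarrow> e \<otimes> \<one> \<in> W" using one unfolding eqv_def by blast
    then show ?thesis using e Ec(1)[OF FE[OF f(1)]] Ec(1)[OF eE] by simp
  qed
  have "{s \<in> carrier S. supp s \<otimes> f = f} = {s \<in> topspace \<T>. supp s \<in> F}"
  proof -
    have "supp s \<otimes> f = f \<longleftrightarrow> supp s \<in> F" if s: "s \<in> carrier S" for s
    proof
      assume "supp s \<otimes> f = f"
      then show "supp s \<in> F" using F_up[of "supp s" f] f(1) FE supp_in_idempotents[OF s] by simp
    next
      assume "supp s \<in> F"
      then show "supp s \<otimes> f = f" using f(2) m_comm[of "supp s" f] s Ec(1)[OF FE[OF f(1)]] by simp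
    qed
    then show ?thesis unfolding topspace_opens by blast
  qed
  moreover have "continuous_map \<T> \<E> supp"
    using continuous_supp supp_in_idempotents unfolding continuous_map_in_subtopology topspace_opens by auto
  ultimately have "openin \<T> {s \<in> carrier S. supp s \<otimes> f = f}" "closedin \<T> {s \<in> carrier S. supp s \<otimes> f = f}"
    using openin_continuous_map_preimage[OF _ F_open] closedin_continuous_map_preimage[OF _ F_closed] by metis+
  then show ?thesis using \<open>f \<in> W\<close> f(2)[OF eF] by blast
qed

text \<open>In the discrete case every upset is clopen, so \<open>f = e\<close> serves.\<close>

lemma clopen_upset_below:
  assumes cd: "compact_space \<T> \<or> \<T> = discrete_topology (carrier S)"
    and zd: "zero_dimensional_space \<E>" and U: "openin \<T> U" and e: "e \<in> U" "e \<in> idempotents S"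
  shows "\<exists>f\<in>idempotents S. f \<in> U \<and> f \<otimes> e = f \<and> openin \<T> {s \<in> carrier S. supp s \<otimes> f = f} \<and>
    closedin \<T> {s \<in> carrier S. supp s \<otimes> f = f}"
  using cd
proof
  assume c: "compact_space \<T>"
  have "openin \<E> (U \<inter> idempotents S)" using U by (rule openin_subtopology_Int)
  then obtain W where W: "openin \<E> W" "closedin \<E> W" "e \<in> W" "W \<subseteq> U \<inter> idempotents S"
    using zero_dimensional_spaceE[OF zd] e by (metis IntI)
  show ?thesis using clopen_upset_below_compact[OF c W(1,2,3)] W(4) by blast
next
  assume d: "\<T> = discrete_topology (carrier S)"
  have "openin \<T> {s \<in> carrier S. supp s \<otimes> e = e}" "closedin \<T> {s \<in> carrier S. supp s \<otimes> e = e}"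
    unfolding d by auto
  then show ?thesis using e by (auto simp: idempotents_def)
qed

text \<open>In the compact case the maximal subgroup is closed, being the fibre of
  \<open>supp\<close> over \<open>e\<close>, and its inversion is the semigroup inversion.\<close>

lemma max_subgroup_character:
  assumes cd: "compact_space \<T> \<or> \<T> = discrete_topology (carrier S)"
    and e: "e \<in> idempotents S" and a: "a \<in> carrier (max_subgroup e)" "a \<noteq> e"
  obtains c where
    "\<And>x y. x \<in> carrier (max_subgroup e) \<Longrightarrow> y \<in> carrier (max_subgroup e) \<Longrightarrow> c (x \<otimes> y) = c x * c y"
    "\<And>x. x \<in> carrier (max_subgroup e) \<Longrightarrow> cmod (c x) = 1"
    "continuous_map (subtopology \<T> (carrier (max_subgroup e))) euclidean c" "c a \<noteq> 1"
proof -
  let ?H = "max_subgroup e"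
  let ?T = "subtopology \<T> (carrier ?H)"
  interpret H: comm_group ?H by (rule max_subgroup_comm_group[OF e])
  have "\<exists>c. (\<forall>x\<in>carrier ?H. \<forall>y\<in>carrier ?H. c (x \<otimes>\<^bsub>?H\<^esub> y) = c x * c y) \<and>
    (\<forall>x\<in>carrier ?H. cmod (c x) = 1) \<and> continuous_map ?T euclidean c \<and> c a \<noteq> (1::complex)"
    using cd
  proof
    assume comp: "compact_space \<T>"
    have tops: "topspace ?T = carrier ?H" using topspace_opens by auto
    have eq: "carrier ?H = {s \<in> topspace \<T>. supp s \<in> {e}}" using topspace_opens by auto
    have "closedin \<T> {e}"
      using closedin_t1_singleton[OF Hausdorff_imp_t1_space[OF Hausdorff_opens]] e topspace_opens
      unfolding idempotents_def by auto
    then have "closedin \<T> (carrier ?H)"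
      unfolding eq by (rule closedin_continuous_map_preimage[OF continuous_supp])
    then have cH: "compact_space ?T" using closedin_compact_space[OF comp] compactin_subspace by blast
    interpret compact_abelian_group ?H ?T
    proof unfold_locales
      show "topspace ?T = carrier ?H" by (rule tops)
      show "compact_space ?T" by (rule cH)
      show "Hausdorff_space ?T" by (rule Hausdorff_space_subtopology[OF Hausdorff_opens])
      have "continuous_map (prod_topology ?T ?T) \<T> (\<lambda>p. fst p \<otimes> snd p)"
        by (intro continuous_map_mult_comp continuous_map_into_fulltopology[OF continuous_map_fst]
            continuous_map_into_fulltopology[OF continuous_map_snd])
      then show "continuous_map (prod_topology ?T ?T) ?T (\<lambda>(x, y). x \<otimes>\<^bsub>?H\<^esub> y)"
        unfolding continuous_map_in_subtopology case_prod_beta max_subgroup_simps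
        using H.m_closed by (auto simp: topspace_opens)
      have "continuous_map ?T ?T sinv"
        unfolding continuous_map_in_subtopology
        using continuous_map_from_subtopology[OF continuous_inversion] by (auto simp: supp_sinv)
      then show "continuous_map ?T ?T (m_inv ?H)"
        by (rule continuous_map_eq) (use max_subgroup_inv[OF e] tops in auto)
    qed
    show ?thesis using exists_character_ne_1[of a] a by simp
  next
    assume d: "\<T> = discrete_topology (carrier S)"
    have "continuous_map ?T euclidean c" for c :: "'a \<Rightarrow> complex"
      unfolding d by (intro continuous_map_from_subtopology) simp
    then show ?thesis using H.exists_hom_circle_ne_1[of a] a by simp
  qed
  then show thesis using that by auto
qed

text \<open>Inequality of \<open>w \<otimes> u\<close> and \<open>w \<otimes> v\<close> is open in
  \<open>w\<close>, so if it holds at \<open>supp x\<close> it persists at some smaller idempotent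
  \<open>f\<close> with clopen filter. If the supports differ, the indicator of that filter
  separates; otherwise a character of the maximal subgroup at \<open>f\<close> does.\<close>

theorem dual_separates_points:
  assumes cd: "compact_space \<T> \<or> \<T> = discrete_topology (carrier S)"
    and zd: "zero_dimensional_space \<E>"
    and xy: "x \<in> carrier S" "y \<in> carrier S" "x \<noteq> y"
  shows "\<exists>h\<in>dual_carrier S. h x \<noteq> h y"
proof -
  have ne_open: "openin \<T> {w \<in> carrier S. w \<otimes> u \<noteq> w \<otimes> v}" if "u \<in> carrier S" "v \<in> carrier S" for u v
  proof -
    have "openin \<T> (topspace \<T> - {w \<in> topspace \<T>. w \<otimes> u = w \<otimes> v})"
      by (intro openin_diff openin_topspace closedin_continuous_maps_eq[OF Hausdorff_opens] continuous_map_translate that)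
    then show ?thesis by (rule back_subst[where P = "openin \<T>"]) (auto simp: topspace_opens)
  qed
  have idem: "e \<in> carrier S \<and> e \<otimes> e = e" if "e \<in> idempotents S" for e
    using that unfolding idempotents_def by simp
  have below: "\<exists>h\<in>dual_carrier S. h x \<noteq> h y"
    if xy: "x \<in> carrier S" "y \<in> carrier S" and ns: "supp x \<otimes> supp y \<noteq> supp x" for x y
  proof -
    have "supp x \<in> {w \<in> carrier S. w \<otimes> supp y \<noteq> w \<otimes> \<one>}" using xy ns by simp
    then obtain f where f: "f \<in> idempotents S" "f \<otimes> supp y \<noteq> f \<otimes> \<one>" "f \<otimes> supp x = f"
      "openin \<T> {s \<in> carrier S. supp s \<otimes> f = f}" "closedin \<T> {s \<in> carrier S. supp s \<otimes> f = f}"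
      using clopen_upset_below[OF cd zd ne_open[of "supp y" \<one>], of "supp x"] supp_in_idempotents xy by auto
    have "(\<lambda>s\<in>carrier S. if supp s \<otimes> f = f then 1 else 0) \<in> dual_carrier S"
      by (rule extended_character_in_dual[OF f(1,4,5), of "\<lambda>_. 1"]) auto
    moreover have "supp x \<otimes> f = f" "supp y \<otimes> f \<noteq> f"
      using f idem[OF f(1)] xy m_comm[of "supp x" f] m_comm[of "supp y" f] by auto
    ultimately show ?thesis using xy by (intro bexI) auto
  qed
  show ?thesis
  proof (cases "supp x = supp y")
    case False
    have "supp x \<otimes> supp y \<noteq> supp x \<or> supp y \<otimes> supp x \<noteq> supp y"
      using False m_comm[of "supp x" "supp y"] xy by auto
    then show ?thesis using below[OF xy(1,2)] below[OF xy(2,1)] by metis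
  next
    case True
    have "supp x \<otimes> x \<noteq> supp x \<otimes> y" using supp_mult_self[OF xy(1)] supp_mult_self[OF xy(2)] True xy(3) by simp
    then obtain f where f: "f \<in> idempotents S" "f \<otimes> x \<noteq> f \<otimes> y" "f \<otimes> supp x = f"
      "openin \<T> {s \<in> carrier S. supp s \<otimes> f = f}" "closedin \<T> {s \<in> carrier S. supp s \<otimes> f = f}"
      using clopen_upset_below[OF cd zd ne_open[OF xy(1,2)], of "supp x"] supp_in_idempotents xy by auto
    let ?H = "max_subgroup f"
    interpret H: comm_group ?H by (rule max_subgroup_comm_group[OF f(1)])
    have fx: "f \<otimes> x \<in> carrier ?H" "f \<otimes> y \<in> carrier ?H"
      using idem[OF f(1)] xy f(3) True by (auto simp: supp_mult supp_of_idem)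
    \<comment> \<open>A quotient in the maximal subgroup; it differs from the identity
      \<open>f\<close>, so some character is not 1 there.\<close>
    define a where "a = (f \<otimes> x) \<otimes>\<^bsub>?H\<^esub> inv\<^bsub>?H\<^esub> (f \<otimes> y)"
    have a: "a \<in> carrier ?H" unfolding a_def by (intro H.m_closed H.inv_closed fx)
    have ay: "a \<otimes>\<^bsub>?H\<^esub> (f \<otimes> y) = f \<otimes> x"
      unfolding a_def using fx by (simp only: H.m_assoc H.inv_closed H.l_inv H.r_one)
    have "a \<noteq> f"
    proof
      assume "a = f"
      then have "f \<otimes> x = f \<otimes> y" using ay H.l_one[OF fx(2)] by simp
      then show False using f(2) by simp
    qed
    then obtain c where c: "\<And>x y. x \<in> carrier ?H \<Longrightarrow> y \<in> carrier ?H \<Longrightarrow> c (x \<otimes> y) = c x * c y"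
      "\<And>x. x \<in> carrier ?H \<Longrightarrow> cmod (c x) = 1" "continuous_map (subtopology \<T> (carrier ?H)) euclidean c" "c a \<noteq> 1"
      using max_subgroup_character[OF cd f(1) a] by blast
    have "c (f \<otimes> x) = c a * c (f \<otimes> y)" using c(1)[OF a fx(2)] ay by simp
    then have "c (f \<otimes> x) \<noteq> c (f \<otimes> y)" using c(4) c(2)[OF fx(2)] by auto
    moreover have "supp x \<otimes> f = f" using f(3) m_comm[of "supp x" f] idem[OF f(1)] xy(1) by auto
    ultimately show ?thesis
      using extended_character_in_dual[OF f(1,4,5) c(1-3)] True xy by (intro bexI) auto
  qed
qed

end

section \<open>The dual and the canonical homomorphism\<close>

lemma dual_inverse_monoid_simps [simp]:
  "carrier (dual_inverse_monoid S) = dual_carrier S"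
  "mult (dual_inverse_monoid S) f g = (\<lambda>x\<in>carrier S. f x * g x)"
  "one (dual_inverse_monoid S) = (\<lambda>x\<in>carrier S. 1)"
  by (simp_all add: dual_inverse_monoid_def)

lemma opens_dual:
  "opens (dual_inverse_monoid S) =
     subtopology (compact_open_topology (opens S) (opens Tdot)) (dual_carrier S)"
  by (simp_all add: dual_inverse_monoid_def)

text \<open>The circle has no small subgroups: while |w - 1| < 1/2 one has |w + 1| \<ge> 3/2, so
  squaring multiplies the distance from 1 by at least 3/2.\<close>

lemma unit_powers_near_1_imp_eq_1:
  fixes z :: complex
  assumes "cmod z = 1" "\<And>n. cmod (z ^ n - 1) < 1/2"
  shows "z = 1"
proof -
  have grow: "(3/2) ^ k * cmod (z - 1) \<le> cmod (z ^ (2 ^ k) - 1)" for k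
  proof (induction k)
    case (Suc k)
    define w where "w = z ^ (2 ^ k)"
    have "3/2 \<le> cmod (w + 1)"
    proof -
      have "2 \<le> cmod (w + 1) + cmod (w - 1)"
        using norm_triangle_ineq4[of "w + 1" "w - 1"] by simp
      then show ?thesis using assms(2)[of "2 ^ k"] unfolding w_def by simp
    qed
    then have "(3/2) * cmod (w - 1) \<le> cmod (w + 1) * cmod (w - 1)" by (rule mult_right_mono) simp
    also have "\<dots> = cmod (w ^ 2 - 1)"
      unfolding norm_mult[symmetric] by (simp add: power2_eq_square algebra_simps)
    also have "w ^ 2 = z ^ (2 ^ Suc k)" unfolding w_def by (simp add: power_mult[symmetric] mult.commute)
    finally show ?case using Suc unfolding w_def by simp
  qed simp
  show ?thesis
  proof (rule ccontr)
    assume "z \<noteq> 1"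
    then have p: "0 < cmod (z - 1)" by simp
    obtain k where "1 / cmod (z - 1) < (3/2) ^ k" using real_arch_pow[of "3/2"] by auto
    then have "1 < (3/2) ^ k * cmod (z - 1)" using p by (simp add: field_simps)
    then show False using grow[of k] assms(2)[of "2 ^ k"] by simp
  qed
qed

text \<open>Exponent 1 rules out the pairing of 0 with a unimodular number; otherwise all powers of
  the quotient are near 1.\<close>

lemma Tdot_powers_close_imp_eq:
  fixes z w :: complex
  assumes "cmod z = 0 \<or> cmod z = 1" "cmod w = 0 \<or> cmod w = 1" "\<And>n. cmod (z ^ n - w ^ n) < 1/2"
  shows "z = w"
proof (cases "z = 0 \<or> w = 0")
  case True
  then show ?thesis using assms(1,2) assms(3)[of 1] by auto
next
  case False
  then have n: "cmod z = 1" "cmod w = 1" using assms by auto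
  have "z / w = 1"
  proof (rule unit_powers_near_1_imp_eq_1)
    fix k
    have "cmod ((z / w) ^ k - 1) = cmod ((z ^ k - w ^ k) / w ^ k)"
      using False by (simp add: power_divide diff_divide_distrib)
    also have "\<dots> < 1/2" using assms(3)[of k] n by (simp add: norm_divide norm_power)
    finally show "cmod ((z / w) ^ k - 1) < 1/2" .
  qed (use n in \<open>simp add: norm_divide\<close>)
  then show ?thesis using False by simp
qed

context spaced_monoid
begin

abbreviation "\<D> \<equiv> dual_inverse_monoid S"

lemma dual_eqI:
  "f \<in> dual_carrier S \<Longrightarrow> g \<in> dual_carrier S \<Longrightarrow> (\<And>x. x \<in> carrier S \<Longrightarrow> f x = g x) \<Longrightarrow> f = g"
  using dualD(1) extensionalityI by metis

lemma dual_one: "(\<lambda>x\<in>carrier S. 1) \<in> dual_carrier S"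
proof -
  have "continuous_map \<T> euclidean (\<lambda>x\<in>carrier S. 1 :: complex)"
    by (rule continuous_map_eq[of _ _ "\<lambda>_. 1"]) (auto simp: topspace_carrier)
  then show ?thesis unfolding dual_carrier_iff by auto
qed

lemma dual_mult:
  assumes f: "f \<in> dual_carrier S" and g: "g \<in> dual_carrier S"
  shows "(\<lambda>x\<in>carrier S. f x * g x) \<in> dual_carrier S"
proof -
  have "continuous_map \<T> euclidean (\<lambda>x\<in>carrier S. f x * g x)"
    by (rule continuous_map_eq[OF continuous_map_complex_mult[OF dualD(5)[OF f] dualD(5)[OF g]]])
      (auto simp: topspace_carrier)
  moreover have "cmod (f x * g x) = 0 \<or> cmod (f x * g x) = 1" if "x \<in> carrier S" for x
    using dualD(2)[OF f that] dualD(2)[OF g that] by (auto simp: norm_mult)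
  ultimately show ?thesis
    unfolding dual_carrier_iff using dualD(3,4)[OF f] dualD(3,4)[OF g] by auto
qed

lemma dual_cnj:
  assumes f: "f \<in> dual_carrier S"
  shows "(\<lambda>x\<in>carrier S. cnj (f x)) \<in> dual_carrier S"
proof -
  have "continuous_map \<T> euclidean (\<lambda>x\<in>carrier S. cnj (f x))"
    by (rule continuous_map_eq[OF continuous_map_euclidean_compose[OF dualD(5)[OF f], of cnj]])
      (auto simp: topspace_carrier intro: continuous_intros)
  then show ?thesis
    unfolding dual_carrier_iff using dualD(2-4)[OF f] by auto
qed

lemma dual_comm_monoid: "comm_monoid \<D>"
proof (rule comm_monoidI)
  fix f assume f: "f \<in> carrier \<D>"
  show "\<one>\<^bsub>\<D>\<^esub> \<otimes>\<^bsub>\<D>\<^esub> f = f"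
    by (rule dual_eqI) (use f dual_mult[OF dual_one, of f] in auto)
qed (auto simp: dual_mult dual_one mult_ac intro!: restrict_ext)

lemma topspace_dual: "topspace (opens \<D>) = dual_carrier S"
  by (auto simp: opens_dual dual_carrier_def)

lemma dual_spaced: "spaced_monoid \<D>"
proof -
  interpret D: comm_monoid \<D> by (rule dual_comm_monoid)
  show ?thesis by unfold_locales (simp only: topspace_dual dual_inverse_monoid_simps(1))
qed

lemma dual_open_subbasic:
  assumes "compactin \<T> K" "open U"
  shows "openin (opens \<D>) {h \<in> dual_carrier S. h ` K \<subseteq> U}"
proof -
  have K: "K \<subseteq> carrier S" using compactin_subset_topspace[OF assms(1)] topspace_carrier by simp
  have "openin (compact_open_topology \<T> (opens Tdot))
      {f \<in> continuous_maps \<T> (opens Tdot). f ` K \<subseteq> {z. cmod z \<in> {0, 1}} \<inter> U}"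
    unfolding compact_open_topology_def
  proof (rule topology_generated_by_Basis, intro CollectI exI conjI)
    show "compactin \<T> K" by fact
    show "openin (opens Tdot) ({z. cmod z \<in> {0, 1}} \<inter> U)"
      unfolding Tdot_simps(4) by (rule openin_open_Int[OF assms(2)])
  qed (rule refl)
  then have "openin (opens \<D>) ({f \<in> continuous_maps \<T> (opens Tdot). f ` K \<subseteq> {z. cmod z \<in> {0, 1}} \<inter> U} \<inter> dual_carrier S)"
    unfolding opens_dual by (rule openin_subtopology_Int)
  moreover have "{f \<in> continuous_maps \<T> (opens Tdot). f ` K \<subseteq> {z. cmod z \<in> {0, 1}} \<inter> U} \<inter> dual_carrier S
      = {h \<in> dual_carrier S. h ` K \<subseteq> U}"
  proof -
    have "h ` K \<subseteq> {z. cmod z \<in> {0, 1}}" if "h \<in> dual_carrier S" for h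
      using dualD(2)[OF that] K by auto
    moreover have "h \<in> continuous_maps \<T> (opens Tdot)" if "h \<in> dual_carrier S" for h
      using that unfolding dual_carrier_def by blast
    ultimately show ?thesis unfolding Int_subset_iff by blast
  qed
  ultimately show ?thesis by simp
qed

lemma continuous_map_into_dual:
  assumes f: "\<And>z. z \<in> topspace Z \<Longrightarrow> f z \<in> dual_carrier S"
    and op: "\<And>K U. compactin \<T> K \<Longrightarrow> open U \<Longrightarrow> openin Z {z \<in> topspace Z. f z ` K \<subseteq> U}"
  shows "continuous_map Z (opens \<D>) f"
  unfolding opens_dual
proof (rule continuous_map_into_subtopology)
  have cm: "f z \<in> continuous_maps \<T> (opens Tdot)" if "z \<in> topspace Z" for z
    using f[OF that] unfolding dual_carrier_def by auto
  show "continuous_map Z (compact_open_topology \<T> (opens Tdot)) f"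
    unfolding compact_open_topology_def
  proof (rule continuous_on_generated_topo)
    fix W assume "W \<in> {{f \<in> continuous_maps \<T> (opens Tdot). f ` K \<subseteq> U} |K U. compactin \<T> K \<and> openin (opens Tdot) U}"
    then obtain K U where KU: "W = {f \<in> continuous_maps \<T> (opens Tdot). f ` K \<subseteq> U}" "compactin \<T> K"
      "openin (opens Tdot) U" by blast
    obtain V where V: "open V" "U = {z. cmod z \<in> {0, 1}} \<inter> V" using KU(3) by (auto simp: openin_open)
    have K: "K \<subseteq> carrier S" using compactin_subset_topspace[OF KU(2)] topspace_carrier by simp
    have "f -` W \<inter> topspace Z = {z \<in> topspace Z. f z ` K \<subseteq> V}"
    proof -
      have "f z ` K \<subseteq> {z. cmod z \<in> {0, 1}}" if "z \<in> topspace Z" for z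
        using dualD(2)[OF f[OF that]] K by auto
      then show ?thesis unfolding KU(1) V(2) Int_subset_iff vimage_def using cm by blast
    qed
    then show "openin Z (f -` W \<inter> topspace Z)" using op[OF KU(2) V(1)] by simp
  next
    have "continuous_maps \<T> (opens Tdot) = {f \<in> continuous_maps \<T> (opens Tdot). f ` {} \<subseteq> {}}" by auto
    then have "continuous_maps \<T> (opens Tdot) \<in>
      {{f \<in> continuous_maps \<T> (opens Tdot). f ` K \<subseteq> U} |K U. compactin \<T> K \<and> openin (opens Tdot) U}"
      by blast
    then show "f ` topspace Z \<subseteq> \<Union>{{f \<in> continuous_maps \<T> (opens Tdot). f ` K \<subseteq> U} |K U.
        compactin \<T> K \<and> openin (opens Tdot) U}"
      using cm by blast
  qed
qed (use f in auto)

lemma continuous_dual_eval: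
  assumes "x \<in> carrier S"
  shows "continuous_map (opens \<D>) euclidean (\<lambda>h. h x)"
  unfolding continuous_map_def
proof (intro conjI allI impI)
  fix U :: "complex set" assume "openin euclidean U"
  then show "openin (opens \<D>) {h \<in> topspace (opens \<D>). h x \<in> U}"
    using dual_open_subbasic[of "{x}" U] assms topspace_carrier unfolding topspace_dual by simp
qed simp

lemma Hausdorff_dual: "Hausdorff_space (opens \<D>)"
  unfolding Hausdorff_space_def
proof (intro allI impI, elim conjE)
  fix f g assume fg: "f \<in> topspace (opens \<D>)" "g \<in> topspace (opens \<D>)" "f \<noteq> g"
  have "f \<in> dual_carrier S" "g \<in> dual_carrier S" using fg(1,2) by (simp_all only: topspace_dual)
  then obtain x where x: "x \<in> carrier S" "f x \<noteq> g x" using dual_eqI[of f g] fg(3) by blast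
  obtain U V :: "complex set" where UV: "open U" "open V" "f x \<in> U" "g x \<in> V" "U \<inter> V = {}"
    using hausdorff[OF x(2)] by blast
  have "openin (opens \<D>) {h \<in> topspace (opens \<D>). h x \<in> W}" if "open W" for W
    by (rule openin_continuous_map_preimage[OF continuous_dual_eval[OF x(1)]]) (use that in simp)
  then show "\<exists>A B. openin (opens \<D>) A \<and> openin (opens \<D>) B \<and> f \<in> A \<and> g \<in> B \<and> disjnt A B"
    using fg UV by (intro exI[of _ "{h \<in> topspace (opens \<D>). h x \<in> U}"]
        exI[of _ "{h \<in> topspace (opens \<D>). h x \<in> V}"] conjI) (auto simp: disjnt_def)
qed

lemma dual_nat_pow:
  assumes "h \<in> dual_carrier S" "x \<in> carrier S"
  shows "h (x [^] (n::nat)) = h x ^ n"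
  by (induction n) (simp_all add: dualD[OF assms(1)] assms(2))

text \<open>Compactness of \<open>S\<close> makes uniform closeness to \<open>f\<close> a
  neighbourhood; closeness at all powers of \<open>x\<close> then forces equality at
  \<open>x\<close>.\<close>

lemma dual_discrete_of_compact:
  assumes comp: "compact_space \<T>"
  shows "opens \<D> = discrete_topology (dual_carrier S)"
proof -
  have "openin (opens \<D>) {f}" if f: "f \<in> dual_carrier S" for f
  proof -
    \<comment> \<open>The values of \<open>f\<close> are sorted by a net of radius 1/8; mapping each
      compact piece into a ball of radius 1/4 leaves \<open>h\<close> within 3/8 < 1/2 of
      \<open>f\<close>.\<close>
    obtain R where R: "finite R" "cball (0::complex) 1 \<subseteq> (\<Union>t\<in>R. ball t (1/8))"
      using compact_imp_seq_compact[OF compact_cball, THEN seq_compact_imp_totally_bounded]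
      by (metis divide_pos_pos zero_less_numeral zero_less_one)
    define K where "K t = {x \<in> topspace \<T>. f x \<in> cball t (1/8)}" for t
    have K: "compactin \<T> (K t)" for t
      unfolding K_def
      by (rule closedin_compact_space[OF comp closedin_continuous_map_preimage[OF dualD(5)[OF f]]]) simp
    define N where "N = {h \<in> dual_carrier S. \<forall>t\<in>R. h ` K t \<subseteq> ball t (1/4)}"
    have N_eq: "N = topspace (opens \<D>) \<inter> (\<Inter>t\<in>R. {h \<in> dual_carrier S. h ` K t \<subseteq> ball t (1/4)})"
      unfolding N_def topspace_dual by auto
    have "openin (opens \<D>) N"
      unfolding N_eq
    proof (rule openin_Int_Inter)
      show "openin (opens \<D>) V" if "V \<in> (\<lambda>t. {h \<in> dual_carrier S. h ` K t \<subseteq> ball t (1/4)}) ` R" for V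
        using that dual_open_subbasic[OF K open_ball] by blast
    qed (use R(1) in auto)
    moreover have "f \<in> N" unfolding N_def using f by (auto simp: K_def)
    moreover have "h = f" if h: "h \<in> N" for h
    proof (rule dual_eqI)
      show hd: "h \<in> dual_carrier S" using h unfolding N_def by auto
      have close: "cmod (h x - f x) < 1/2" if x: "x \<in> carrier S" for x
      proof -
        have "f x \<in> cball 0 1" using dualD(2)[OF f x] by auto
        then obtain t where t: "t \<in> R" "f x \<in> ball t (1/8)" using R(2) by blast
        then have "x \<in> K t" unfolding K_def using x topspace_carrier by auto
        moreover have "h ` K t \<subseteq> ball t (1/4)" using h t(1) unfolding N_def by blast
        ultimately have "h x \<in> ball t (1/4)" by blast
        then show ?thesis using t(2) by (simp add: dist_norm) norm
      qed
      fix x assume x: "x \<in> carrier S"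
      show "h x = f x"
      proof (rule Tdot_powers_close_imp_eq)
        show "cmod (h x ^ n - f x ^ n) < 1/2" for n
          using close[of "x [^] n"] x by (simp add: dual_nat_pow[OF hd] dual_nat_pow[OF f])
      qed (use dualD(2)[OF hd x] dualD(2)[OF f x] in auto)
    qed (rule f)
    ultimately have "N = {f}" by blast
    then show ?thesis using \<open>openin (opens \<D>) N\<close> by simp
  qed
  then have "discrete_topology (dual_carrier S) = opens \<D>"
    unfolding discrete_topology_unique using topspace_dual by blast
  then show ?thesis by simp
qed

lemma canonical_hom_in_dual:
  assumes x: "x \<in> carrier S"
  shows "canonical_hom S x \<in> dual_carrier \<D>"
proof -
  interpret D: spaced_monoid \<D> by (rule dual_spaced)
  show ?thesis
    unfolding D.dual_carrier_iff canonical_hom_def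
  proof (intro conjI ballI)
    show "continuous_map (opens \<D>) euclidean (\<lambda>h\<in>carrier \<D>. h x)"
      by (rule continuous_map_eq[OF continuous_dual_eval[OF x]]) (simp only: topspace_dual, simp)
  qed (use x dual_one dual_mult dualD(2) in auto)
qed

lemma canonical_hom_monoid_hom: "canonical_hom S \<in> monoid_homs S (dual_inverse_monoid \<D>)"
proof -
  interpret D: spaced_monoid \<D> by (rule dual_spaced)
  have "canonical_hom S (x \<otimes> y) = canonical_hom S x \<otimes>\<^bsub>dual_inverse_monoid \<D>\<^esub> canonical_hom S y"
    if xy: "x \<in> carrier S" "y \<in> carrier S" for x y
  proof (rule D.dual_eqI)
    show "canonical_hom S (x \<otimes> y) \<in> dual_carrier \<D>" by (rule canonical_hom_in_dual[OF m_closed[OF xy]])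
    show "canonical_hom S x \<otimes>\<^bsub>dual_inverse_monoid \<D>\<^esub> canonical_hom S y \<in> dual_carrier \<D>"
      using D.dual_mult[OF canonical_hom_in_dual[OF xy(1)] canonical_hom_in_dual[OF xy(2)]] by simp
  qed (use xy in \<open>auto simp: canonical_hom_def dualD\<close>)
  moreover have "canonical_hom S \<one> = \<one>\<^bsub>dual_inverse_monoid \<D>\<^esub>"
  proof (rule D.dual_eqI)
    show "canonical_hom S \<one> \<in> dual_carrier \<D>" by (rule canonical_hom_in_dual[OF one_closed])
    show "\<one>\<^bsub>dual_inverse_monoid \<D>\<^esub> \<in> dual_carrier \<D>" using D.dual_one by simp
  qed (auto simp: canonical_hom_def dualD)
  ultimately show ?thesis unfolding monoid_homs_def hom_def using canonical_hom_in_dual by auto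
qed

lemma canonical_hom_bij:
  assumes sep: "\<And>x y. x \<in> carrier S \<Longrightarrow> y \<in> carrier S \<Longrightarrow> x \<noteq> y \<Longrightarrow> \<exists>h\<in>dual_carrier S. h x \<noteq> h y"
    and surj: "\<And>\<phi>. \<phi> \<in> dual_carrier \<D> \<Longrightarrow> \<exists>x\<in>carrier S. \<forall>h\<in>dual_carrier S. \<phi> h = h x"
  shows "inj_on (canonical_hom S) (carrier S)" "canonical_hom S ` carrier S = dual_carrier \<D>"
proof -
  interpret D: spaced_monoid \<D> by (rule dual_spaced)
  show "inj_on (canonical_hom S) (carrier S)"
  proof (rule inj_onI, rule ccontr)
    fix x y assume xy: "x \<in> carrier S" "y \<in> carrier S" "canonical_hom S x = canonical_hom S y" "x \<noteq> y"
    then obtain h where "h \<in> dual_carrier S" "h x \<noteq> h y" using sep by blast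
    then show False using fun_cong[OF xy(3), of h] unfolding canonical_hom_def by simp
  qed
  show "canonical_hom S ` carrier S = dual_carrier \<D>"
  proof (intro equalityI subsetI)
    fix \<phi> assume p: "\<phi> \<in> dual_carrier \<D>"
    then obtain x where x: "x \<in> carrier S" "\<forall>h\<in>dual_carrier S. \<phi> h = h x" using surj by blast
    have "\<phi> = canonical_hom S x"
      by (rule D.dual_eqI[OF p canonical_hom_in_dual[OF x(1)]]) (use x(2) in \<open>simp add: canonical_hom_def\<close>)
    then show "\<phi> \<in> canonical_hom S ` carrier S" using x(1) by blast
  qed (use canonical_hom_in_dual in blast)
qed

text \<open>The dual is discrete, so its compact sets are finite and evaluations vary continuously
  with the point; a continuous bijection from a compact space onto a Hausdorff one is a
  homeomorphism.\<close>

lemma reflexive_of_compact: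
  assumes comp: "compact_space \<T>"
    and sep: "\<And>x y. x \<in> carrier S \<Longrightarrow> y \<in> carrier S \<Longrightarrow> x \<noteq> y \<Longrightarrow> \<exists>h\<in>dual_carrier S. h x \<noteq> h y"
    and surj: "\<And>\<phi>. \<phi> \<in> dual_carrier \<D> \<Longrightarrow> \<exists>x\<in>carrier S. \<forall>h\<in>dual_carrier S. \<phi> h = h x"
  shows "reflexive S"
proof -
  interpret D: spaced_monoid \<D> by (rule dual_spaced)
  have inj: "inj_on (canonical_hom S) (carrier S)"
    by (rule canonical_hom_bij(1); rule sep surj; assumption)
  have onto: "canonical_hom S ` carrier S = dual_carrier \<D>"
    by (rule canonical_hom_bij(2); rule sep surj; assumption)
  have cont: "continuous_map \<T> (opens (dual_inverse_monoid \<D>)) (canonical_hom S)"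
  proof (rule D.continuous_map_into_dual)
    fix K U assume K: "compactin (opens \<D>) K" and U: "open (U :: complex set)"
    have fin: "finite K" "K \<subseteq> dual_carrier S"
      using K unfolding dual_discrete_of_compact[OF comp] by (auto simp: compactin_discrete_topology)
    have "{z \<in> topspace \<T>. canonical_hom S z ` K \<subseteq> U}
        = topspace \<T> \<inter> (\<Inter>h\<in>K. {z \<in> topspace \<T>. h z \<in> U})"
      using fin(2) by (auto simp: canonical_hom_def subset_iff)
    moreover have "openin \<T> \<dots>"
      by (intro openin_Int_Inter) (use fin U openin_continuous_map_preimage[OF dualD(5)] in auto)
    ultimately show "openin \<T> {z \<in> topspace \<T>. canonical_hom S z ` K \<subseteq> U}" by simp
  qed (use canonical_hom_in_dual topspace_carrier in auto)
  have "homeomorphic_map \<T> (opens (dual_inverse_monoid \<D>)) (canonical_hom S)"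
    by (rule continuous_imp_homeomorphic_map[OF cont comp D.Hausdorff_dual])
      (simp_all only: D.topspace_dual topspace_carrier onto inj)
  then show ?thesis
    unfolding reflexive_def topological_isomorphism_def
    using canonical_hom_monoid_hom inj onto by (simp add: bij_betw_def)
qed

text \<open>The bidual is discrete because the dual is compact, so a bijection is already a
  homeomorphism.\<close>

lemma reflexive_of_discrete:
  assumes disc: "\<T> = discrete_topology (carrier S)" and comp: "compact_space (opens \<D>)"
    and sep: "\<And>x y. x \<in> carrier S \<Longrightarrow> y \<in> carrier S \<Longrightarrow> x \<noteq> y \<Longrightarrow> \<exists>h\<in>dual_carrier S. h x \<noteq> h y"
    and surj: "\<And>\<phi>. \<phi> \<in> dual_carrier \<D> \<Longrightarrow> \<exists>x\<in>carrier S. \<forall>h\<in>dual_carrier S. \<phi> h = h x"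
  shows "reflexive S"
proof -
  interpret D: spaced_monoid \<D> by (rule dual_spaced)
  have inj: "inj_on (canonical_hom S) (carrier S)"
    by (rule canonical_hom_bij(1); rule sep surj; assumption)
  have onto: "canonical_hom S ` carrier S = dual_carrier \<D>"
    by (rule canonical_hom_bij(2); rule sep surj; assumption)
  have "homeomorphic_map \<T> (opens (dual_inverse_monoid \<D>)) (canonical_hom S)"
    unfolding disc D.dual_discrete_of_compact[OF comp] homeomorphic_map_def quotient_map_def
    using inj onto by (auto simp: openin_discrete_topology)
  then show ?thesis
    unfolding reflexive_def topological_isomorphism_def
    using canonical_hom_monoid_hom inj onto by (simp add: bij_betw_def)
qed

end

section \<open>Surjectivity of the canonical homomorphism\<close>

text \<open>The conjugate of \<open>h\<close> is its semigroup inverse in the dual, and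
  multiplicative maps into \<open>Tdot\<close> carry such inverses to complex conjugates.\<close>

lemma (in spaced_monoid) dual_dual_cnj:
  assumes \<phi>: "\<phi> \<in> dual_carrier \<D>" and h: "h \<in> dual_carrier S"
  shows "\<phi> (\<lambda>x\<in>carrier S. cnj (h x)) = cnj (\<phi> h)"
proof -
  interpret D: spaced_monoid \<D> by (rule dual_spaced)
  let ?m = "\<lambda>f g. \<lambda>x\<in>carrier S. f x * g x"
  define c where "c = (\<lambda>x\<in>carrier S. cnj (h x))"
  have c: "c \<in> dual_carrier S" unfolding c_def by (rule dual_cnj[OF h])
  have mul: "\<phi> (?m f g) = \<phi> f * \<phi> g" if "f \<in> dual_carrier S" "g \<in> dual_carrier S" for f g
    using D.dualD(3)[OF \<phi>, of f g] that by simp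
  have unit: "h x = 0 \<or> h x * cnj (h x) = 1" if "x \<in> carrier S" for x
    using dualD(2)[OF h that] by (auto simp: complex_norm_square[symmetric])
  have "?m (?m h c) h = h"
    by (rule dual_eqI[OF dual_mult[OF dual_mult[OF h c] h] h]) (use unit in \<open>auto simp: c_def\<close>)
  then have 1: "\<phi> h * \<phi> c * \<phi> h = \<phi> h"
    using mul[OF dual_mult[OF h c] h] mul[OF h c] by simp
  have "?m (?m h c) c = c"
    by (rule dual_eqI[OF dual_mult[OF dual_mult[OF h c] c] c]) (use unit in \<open>auto simp: c_def\<close>)
  then have 2: "\<phi> h * \<phi> c * \<phi> c = \<phi> c"
    using mul[OF dual_mult[OF h c] c] mul[OF h c] by simp
  have "cmod (\<phi> h) = 0 \<or> cmod (\<phi> h) = 1" using D.dualD(2)[OF \<phi>, of h] h by simp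
  moreover have "\<phi> c * \<phi> h * \<phi> c = \<phi> c" using 2 by (simp add: mult_ac)
  ultimately show ?thesis unfolding c_def[symmetric] using Tdot_inverse_eq_cnj 1 by blast
qed

section \<open>Compact case: approximating a bidual element by points\<close>

context abelian_topological_inverse_monoid
begin

text \<open>Where \<open>P\<close>, the product of the characters in \<open>A\<close> with
  \<open>\<phi> h \<noteq> 0\<close>, does not vanish, these are unimodular and
  \<open>character_approximation\<close> gives \<open>y\<close>. The characters killed by
  \<open>\<phi>\<close> are handled by an idempotent factor with value 1 under the former and 0
  under the latter.\<close>

lemma dual_dual_approximation:
  assumes \<phi>: "\<phi> \<in> dual_carrier \<D>" and A: "finite A" "A \<subseteq> dual_carrier S" and e: "e > 0"
  shows "\<exists>x\<in>carrier S. \<forall>h\<in>A. cmod (h x - \<phi> h) < e"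
proof -
  interpret D: spaced_monoid \<D> by (rule dual_spaced)
  let ?m = "\<lambda>f g. \<lambda>x\<in>carrier S. f x * g x" and ?c = "\<lambda>h. \<lambda>x\<in>carrier S. cnj (h x)"
  have mul: "\<phi> (?m f g) = \<phi> f * \<phi> g" if "f \<in> dual_carrier S" "g \<in> dual_carrier S" for f g
    using D.dualD(3)[OF \<phi>, of f g] that by simp
  have one: "\<phi> (\<lambda>x\<in>carrier S. 1) = 1" using D.dualD(4)[OF \<phi>] by simp
  define A1 where "A1 = {h \<in> A. \<phi> h \<noteq> 0}"
  define A0 where "A0 = {h \<in> A. \<phi> h = 0}"
  have fin: "finite A1" "finite A0" and sub: "A1 \<subseteq> dual_carrier S" "A0 \<subseteq> dual_carrier S"
    unfolding A1_def A0_def using A by auto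
  have "\<forall>h\<in>A1. \<phi> h \<noteq> 0" unfolding A1_def by auto
  with fin(1) sub(1) have "\<exists>P\<in>dual_carrier S. \<phi> P \<noteq> 0 \<and> (\<forall>x\<in>carrier S. P x \<noteq> 0 \<longrightarrow> (\<forall>h\<in>A1. h x \<noteq> 0))"
  proof (induction A1 rule: finite_induct)
    case empty
    show ?case
    proof (rule bexI[OF _ dual_one], intro conjI)
      show "\<phi> (\<lambda>x\<in>carrier S. 1) \<noteq> 0" unfolding one by simp
    qed simp
  next
    case (insert h B)
    then obtain P where P: "P \<in> dual_carrier S" "\<phi> P \<noteq> 0" "\<forall>x\<in>carrier S. P x \<noteq> 0 \<longrightarrow> (\<forall>h\<in>B. h x \<noteq> 0)"
      by auto
    have h: "h \<in> dual_carrier S" "\<phi> h \<noteq> 0" using insert.prems by auto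
    show ?case
    proof (rule bexI[OF _ dual_mult[OF h(1) P(1)]], intro conjI)
      show "\<phi> (?m h P) \<noteq> 0" unfolding mul[OF h(1) P(1)] using h(2) P(2) by simp
    qed (use P(3) in auto)
  qed
  then obtain P where P: "P \<in> dual_carrier S" "\<phi> P \<noteq> 0"
    and PA: "\<And>x h. x \<in> carrier S \<Longrightarrow> P x \<noteq> 0 \<Longrightarrow> h \<in> A1 \<Longrightarrow> h x \<noteq> 0" by blast
  \<comment> \<open>Nonvanishing of \<open>P\<close> is multiplicative and holds at the unit, so it
    cuts out a submonoid.\<close>
  define G where "G = S\<lparr>carrier := {y \<in> carrier S. P y \<noteq> 0}\<rparr>"
  have G_simps [simp]: "carrier G = {y \<in> carrier S. P y \<noteq> 0}" "mult G = mult S" "one G = one S"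
    unfolding G_def by simp_all
  have "comm_monoid G"
    by (rule comm_monoidI) (auto simp: dualD[OF P(1)] m_ac)
  then obtain M where "invariant_mean G M" using comm_monoid.invariant_mean_exists by blast
  then interpret IM: invariant_mean G M .
  \<comment> \<open>The family is enlarged from \<open>A1\<close> to all characters that are not
    killed by \<open>\<phi>\<close> and do not vanish where \<open>P\<close> is nonzero, which gives
    closure under products and conjugation.\<close>
  define X where "X = {h \<in> dual_carrier S. \<phi> h \<noteq> 0 \<and> (\<forall>y\<in>carrier S. P y \<noteq> 0 \<longrightarrow> h y \<noteq> 0)}"
  have XD: "h \<in> dual_carrier S" "\<phi> h \<noteq> 0" if "h \<in> X" for h using that unfolding X_def by auto
  have nrm: "cmod (\<phi> h) = 1" if "h \<in> X" for h using D.dualD(2)[OF \<phi>, of h] XD[OF that] by simp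
  interpret character_family G M X "\<lambda>h. h" ?m ?c
  proof unfold_locales
    show "X \<noteq> {}" using P unfolding X_def by auto
    show "?m f g \<in> X" if "f \<in> X" "g \<in> X" for f g
      using that mul dual_mult unfolding X_def by auto
    show "?c f \<in> X" if "f \<in> X" for f
      using that dual_dual_cnj[OF \<phi>] dual_cnj unfolding X_def by auto
    show "cmod (f y) = 1" if "f \<in> X" "y \<in> carrier G" for f y
      using that dualD(2)[of f y] unfolding X_def by auto
    show "f (y \<otimes>\<^bsub>G\<^esub> z) = f y * f z" if "f \<in> X" "y \<in> carrier G" "z \<in> carrier G" for f y z
      using that dualD(3)[of f y z] unfolding X_def by auto
    show "\<exists>z\<in>carrier G. \<forall>i\<in>X. i z = cnj (i y)" if "y \<in> carrier G" for y
      using that dual_sinv[OF P(1)] dual_sinv[OF XD(1)] by (intro bexI[of _ "sinv y"]) auto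
  qed auto
  have "\<exists>y\<in>carrier G. \<forall>i\<in>A1. cmod (i y - \<phi> i) < e"
  proof (rule character_approximation[OF _ _ nrm _ fin(1) _ e])
    show "\<phi> (?m f g) = \<phi> f * \<phi> g" if "f \<in> X" "g \<in> X" for f g using mul XD that by blast
    show "\<phi> (?c f) = cnj (\<phi> f)" if "f \<in> X" for f using dual_dual_cnj[OF \<phi> XD(1)[OF that]] .
    \<comment> \<open>A character that is 1 where \<open>P\<close> is nonzero satisfies
      \<open>f * P = P\<close>, and \<open>\<phi> P\<close> can be cancelled.\<close>
    show "\<phi> f = 1" if f: "f \<in> X" and triv: "\<And>y. y \<in> carrier G \<Longrightarrow> f y = 1" for f
    proof -
      have "?m f P = P"
        by (rule dual_eqI[OF dual_mult[OF XD(1)[OF f] P(1)] P(1)]) (use triv in \<open>fastforce\<close>)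
      then show ?thesis using mul[OF XD(1)[OF f] P(1)] P(2) by simp
    qed
    show "A1 \<subseteq> X" using sub(1) PA unfolding X_def A1_def by auto
  qed
  then obtain y where y: "y \<in> carrier S" "P y \<noteq> 0" "\<And>h. h \<in> A1 \<Longrightarrow> cmod (h y - \<phi> h) < e" by auto
  \<comment> \<open>If \<open>j\<close> were nonzero wherever \<open>P\<close> is, then |j|^2 P = P,
    and \<open>\<phi> j = 0\<close> would give \<open>\<phi> P = 0\<close>.\<close>
  have zero: "\<exists>z\<in>carrier S. P z \<noteq> 0 \<and> j z = 0" if j: "j \<in> A0" for j
  proof (rule ccontr)
    assume no: "\<not> ?thesis"
    have jd: "j \<in> dual_carrier S" "\<phi> j = 0" using j sub unfolding A0_def by auto
    have "?m (?m (?c j) j) P = P"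
    proof (rule dual_eqI[OF dual_mult[OF dual_mult[OF dual_cnj[OF jd(1)] jd(1)] P(1)] P(1)])
      fix x assume x: "x \<in> carrier S"
      show "?m (?m (?c j) j) P x = P x"
      proof (cases "P x = 0")
        case False
        then have "cmod (j x) = 1" using no x dualD(2)[OF jd(1) x] by auto
        then have "cnj (j x) * j x = 1" by (simp add: complex_norm_square[symmetric] mult.commute)
        then show ?thesis using x by simp
      qed (use x in simp)
    qed
    then have "\<phi> P = \<phi> (?c j) * \<phi> j * \<phi> P"
      using mul[OF dual_mult[OF dual_cnj[OF jd(1)] jd(1)] P(1)] mul[OF dual_cnj[OF jd(1)] jd(1)] by simp
    then show False using jd(2) P(2) by simp
  qed
  have "\<forall>j\<in>A0. \<exists>z\<in>carrier S. P z \<noteq> 0 \<and> j z = 0" using zero by blast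
  with fin(2) sub(2) have "\<exists>z\<in>carrier S. P z \<noteq> 0 \<and> (\<forall>j\<in>A0. j z = 0)"
  proof (induction A0 rule: finite_induct)
    case empty
    then show ?case using dualD(4)[OF P(1)] by (intro bexI[of _ \<one>]) auto
  next
    case (insert j B)
    then obtain z where z: "z \<in> carrier S" "P z \<noteq> 0" "\<forall>j\<in>B. j z = 0" by auto
    obtain w where w: "w \<in> carrier S" "P w \<noteq> 0" "j w = 0" using insert.prems by auto
    have "i (z \<otimes> w) = 0" if "i \<in> insert j B" for i
      using dualD(3)[of i z w] that insert.prems z w by auto
    moreover have "P (z \<otimes> w) \<noteq> 0" using dualD(3)[OF P(1)] z w by simp
    ultimately show ?case using z(1) w(1) by blast
  qed
  then obtain z where z: "z \<in> carrier S" "P z \<noteq> 0" "\<And>j. j \<in> A0 \<Longrightarrow> j z = 0" by blast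
  \<comment> \<open>\<open>supp z\<close> rather than \<open>z\<close>: characters take the value 0
    or 1 there, so the approximation at \<open>y\<close> is not disturbed.\<close>
  have "cmod (h (y \<otimes> supp z) - \<phi> h) < e" if h: "h \<in> A" for h
  proof (cases "h \<in> A1")
    case True
    then have "h (y \<otimes> supp z) = h y"
      using dualD(3)[of h y "supp z"] dual_supp[of h z] sub y(1) z(1) PA[OF z(1,2) True] by auto
    then show ?thesis using y(3)[OF True] by simp
  next
    case False
    then have h0: "h \<in> A0" "\<phi> h = 0" using h unfolding A1_def A0_def by auto
    then have "h (y \<otimes> supp z) = 0"
      using dualD(3)[of h y "supp z"] dual_supp[of h z] sub y(1) z(1) z(3)[OF h0(1)] by auto
    then show ?thesis using h0(2) e by simp
  qed
  then show ?thesis using y(1) z(1) by blast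
qed

text \<open>The closed sets where \<open>h x\<close> is within a given distance of
  \<open>\<phi> h\<close> have the finite intersection property by
  \<open>dual_dual_approximation\<close>.\<close>

theorem dual_dual_surj_compact:
  assumes comp: "compact_space \<T>" and \<phi>: "\<phi> \<in> dual_carrier \<D>"
  shows "\<exists>x\<in>carrier S. \<forall>h\<in>dual_carrier S. \<phi> h = h x"
proof -
  define I where "I = dual_carrier S \<times> {e::real. e > 0}"
  define C where "C = (\<lambda>(h, e). {x \<in> topspace \<T>. h x \<in> cball (\<phi> h) e})"
  have "\<exists>x\<in>topspace \<T>. \<forall>i\<in>I. x \<in> C i"
  proof (rule compact_space_indexed_fip[OF comp])
    fix i assume "i \<in> I"
    then obtain h e where i: "i = (h, e)" "h \<in> dual_carrier S" unfolding I_def by auto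
    show "closedin \<T> (C i)"
      unfolding C_def i(1) prod.case
      by (rule closedin_continuous_map_preimage[OF dualD(5)[OF i(2)]]) simp
  next
    fix J assume J: "finite J" "J \<subseteq> I"
    \<comment> \<open>Inserting 1 keeps the minimum defined for empty \<open>J\<close>.\<close>
    define e where "e = Min (insert 1 (snd ` J))"
    have e: "e > 0" unfolding e_def using J by (auto simp: I_def)
    have "finite (fst ` J)" "fst ` J \<subseteq> dual_carrier S" using J unfolding I_def by auto
    from dual_dual_approximation[OF \<phi> this e]
    obtain x where x: "x \<in> carrier S" "\<And>h. h \<in> fst ` J \<Longrightarrow> cmod (h x - \<phi> h) < e" by blast
    have "x \<in> C i" if "i \<in> J" for i
    proof -
      have "e \<le> snd i" unfolding e_def using J(1) that by (intro Min_le) auto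
      then show ?thesis
        using x(2)[of "fst i"] that x(1) topspace_carrier
        unfolding C_def by (auto simp: dist_norm norm_minus_commute case_prod_beta)
    qed
    then show "\<exists>x\<in>topspace \<T>. \<forall>i\<in>J. x \<in> C i" using x(1) unfolding topspace_carrier by blast
  qed
  then obtain x where x: "x \<in> carrier S" "\<And>i. i \<in> I \<Longrightarrow> x \<in> C i" using topspace_carrier by auto
  have "\<phi> h = h x" if h: "h \<in> dual_carrier S" for h
  proof (rule ccontr)
    assume "\<phi> h \<noteq> h x"
    then have d: "0 < dist (\<phi> h) (h x)" by simp
    then have "x \<in> C (h, dist (\<phi> h) (h x) / 2)" using h by (intro x(2)) (simp add: I_def)
    then show False using d unfolding C_def by simp
  qed
  then show ?thesis using x(1) by blast
qed

end

section \<open>Duals of discrete monoids and pointwise convergence\<close>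

context spaced_monoid
begin

context
  assumes disc: "\<T> = discrete_topology (carrier S)"
begin

lemma dual_carrier_discrete_iff:
  "h \<in> dual_carrier S \<longleftrightarrow> h \<in> extensional (carrier S) \<and> (\<forall>x\<in>carrier S. cmod (h x) \<in> {0, 1}) \<and>
     (\<forall>x\<in>carrier S. \<forall>y\<in>carrier S. h (x \<otimes> y) = h x * h y) \<and> h \<one> = 1"
  unfolding dual_carrier_iff using disc by auto

lemma compact_dual_carrier: "compact (dual_carrier S)"
proof -
  \<comment> \<open>Members of the dual are extensional, so outside the carrier the factor is the
    single point \<open>undefined\<close>.\<close>
  define B where "B x = (if x \<in> carrier S then {z::complex. cmod z \<in> {0, 1}} else {undefined})" for x
  have eq: "{z::complex. cmod z \<in> {0, 1}} = insert 0 (sphere 0 1)" by auto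
  have box: "compact {h. \<forall>x. h x \<in> B x}"
    by (rule compact_PiE_UNIV) (auto simp: B_def eq simp del: insert_iff intro: compact_insert)
  have "closed {h :: 'a \<Rightarrow> complex. \<forall>i. fst i \<in> carrier S \<and> snd i \<in> carrier S \<longrightarrow>
      h (fst i \<otimes> snd i) = h (fst i) * h (snd i)}"
    by (rule closed_pointwise_eq) (intro continuous_on_mult continuous_on_eval)+
  moreover have "closed {h :: 'a \<Rightarrow> complex. h \<one> = 1}"
    by (intro closed_Collect_eq continuous_on_eval continuous_on_const)
  ultimately have "closed ({h :: 'a \<Rightarrow> complex. \<forall>i. fst i \<in> carrier S \<and> snd i \<in> carrier S \<longrightarrow>
      h (fst i \<otimes> snd i) = h (fst i) * h (snd i)} \<inter> {h. h \<one> = 1})"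
    by (rule closed_Int)
  from compact_Int_closed[OF box this] show ?thesis
  proof (rule back_subst[where P = compact])
    show "{h. \<forall>x. h x \<in> B x} \<inter> ({h. \<forall>i. fst i \<in> carrier S \<and> snd i \<in> carrier S \<longrightarrow>
      h (fst i \<otimes> snd i) = h (fst i) * h (snd i)} \<inter> {h. h \<one> = 1}) = dual_carrier S"
      unfolding set_eq_iff dual_carrier_discrete_iff B_def extensional_def by (auto split: if_splits)
  qed
qed

text \<open>Compact subsets of a discrete space are finite, so subbasic compact-open sets are open
  for pointwise convergence.\<close>

lemma continuous_map_pointwise_dual: "continuous_map (top_of_set (dual_carrier S)) (opens \<D>) id"
proof (rule continuous_map_into_dual)
  fix K U assume K: "compactin \<T> K" and U: "open (U :: complex set)"
  have fin: "finite K" using K unfolding disc by (simp add: compactin_discrete_topology)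
  have "open (\<Inter>x\<in>K. {h. h x \<in> U})"
  proof (intro open_INT ballI fin)
    fix x
    have "open ((\<lambda>h. h x) -` U \<inter> UNIV)"
      by (rule continuous_on_open_vimage[THEN iffD1, OF _ continuous_on_eval, rule_format]) (use U in auto)
    then show "open {h. h x \<in> U}" by (simp add: vimage_def)
  qed
  then have "openin (top_of_set (dual_carrier S)) (dual_carrier S \<inter> (\<Inter>x\<in>K. {h. h x \<in> U}))"
    by (rule openin_open_Int)
  then show "openin (top_of_set (dual_carrier S)) {z \<in> topspace (top_of_set (dual_carrier S)). id z ` K \<subseteq> U}"
    by (rule back_subst[where P = "openin (top_of_set (dual_carrier S))"]) auto
qed simp

lemma compact_space_dual: "compact_space (opens \<D>)"
proof -
  have "compactin (top_of_set (dual_carrier S)) (dual_carrier S)"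
    using compact_dual_carrier by (simp add: compactin_subtopology)
  from image_compactin[OF this continuous_map_pointwise_dual] show ?thesis
    unfolding compact_space_def topspace_dual by simp
qed

text \<open>A basic neighbourhood in the product restricts finitely many coordinates; those outside
  the carrier hold automatically, since all members of the dual agree there.\<close>

lemma dual_dual_continuity:
  assumes \<psi>: "\<psi> \<in> dual_carrier \<D>" and e: "e \<in> dual_carrier S" and \<epsilon>: "\<epsilon> > 0"
  obtains F \<delta> where "finite F" "F \<subseteq> carrier S" "\<delta> > 0"
    "\<And>h. h \<in> dual_carrier S \<Longrightarrow> (\<And>x. x \<in> F \<Longrightarrow> cmod (h x - e x) < \<delta>) \<Longrightarrow> cmod (\<psi> h - \<psi> e) < \<epsilon>"
proof -
  interpret D: spaced_monoid \<D> by (rule dual_spaced)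
  have "continuous_map (top_of_set (dual_carrier S)) euclidean \<psi>"
    using continuous_map_compose[OF continuous_map_pointwise_dual D.dualD(5)[OF \<psi>]] by simp
  then have "openin (top_of_set (dual_carrier S)) {h \<in> dual_carrier S. \<psi> h \<in> ball (\<psi> e) \<epsilon>}"
    using openin_continuous_map_preimage[of "top_of_set (dual_carrier S)" euclidean \<psi> "ball (\<psi> e) \<epsilon>"] by simp
  then obtain W where W: "open W" "{h \<in> dual_carrier S. \<psi> h \<in> ball (\<psi> e) \<epsilon>} = dual_carrier S \<inter> W"
    unfolding openin_open by blast
  have "e \<in> {h \<in> dual_carrier S. \<psi> h \<in> ball (\<psi> e) \<epsilon>}" using e \<epsilon> by simp
  then have eW: "e \<in> W" unfolding W(2) by simp
  have "openin (product_topology (\<lambda>_. euclidean) UNIV) W"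
    using W(1) by (simp add: euclidean_product_topology)
  from product_topology_open_contains_basis[OF this eW]
  obtain Y where "e \<in> PiE UNIV Y" "\<forall>i. openin euclidean (Y i)"
    "finite {i. Y i \<noteq> topspace euclidean}" "PiE UNIV Y \<subseteq> W"
    by (elim exE conjE)
  then have Y: "e \<in> PiE UNIV Y" "\<And>i. open (Y i)" "finite {i. Y i \<noteq> UNIV}" "PiE UNIV Y \<subseteq> W"
    by simp_all
  define F where "F = {i \<in> carrier S. Y i \<noteq> UNIV}"
  have F: "finite F" "F \<subseteq> carrier S" unfolding F_def using Y(3) by auto
  have "\<exists>d>0. ball (e x) d \<subseteq> Y x" for x
  proof -
    have "e x \<in> Y x" using Y(1) by (simp add: PiE_def Pi_def)
    then show ?thesis using Y(2)[of x] unfolding open_contains_ball by blast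
  qed
  then obtain d where d: "\<And>x. d x > 0" "\<And>x. ball (e x) (d x) \<subseteq> Y x" by metis
  define \<delta> where "\<delta> = Min (insert 1 (d ` F))"
  have \<delta>: "\<delta> > 0" "\<And>x. x \<in> F \<Longrightarrow> \<delta> \<le> d x" unfolding \<delta>_def using F d by auto
  show thesis
  proof (rule that[OF F \<delta>(1)])
    fix h assume h: "h \<in> dual_carrier S" and close: "\<And>x. x \<in> F \<Longrightarrow> cmod (h x - e x) < \<delta>"
    have "h x \<in> Y x" for x
    proof (cases "x \<in> carrier S")
      case True
      show ?thesis
      proof (cases "x \<in> F")
        case True
        then have "h x \<in> ball (e x) (d x)"
          using close[OF True] \<delta>(2)[OF True] by (simp add: dist_norm norm_minus_commute)
        then show ?thesis using d(2) by blast
      qed (use True F_def in auto)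
    next
      case False
      then have "h x = e x" using dualD(1)[OF h] dualD(1)[OF e] by (simp add: extensional_def)
      then show ?thesis using Y(1) by auto
    qed
    then have "h \<in> W" using Y(4) by auto
    then have "\<psi> h \<in> ball (\<psi> e) \<epsilon>" using W(2) h by blast
    then show "cmod (\<psi> h - \<psi> e) < \<epsilon>" by (simp add: dist_norm norm_minus_commute)
  qed
qed

end

end

section \<open>Discrete case: continuous homomorphisms of the dual are evaluations\<close>

context abelian_topological_inverse_monoid
begin

text \<open>Near \<open>e\<close>, the infimum of the idempotent characters not killed by
  \<open>\<psi>\<close>, continuity lets finitely many points control \<open>\<psi>\<close>. They
  yield an idempotent \<open>s0\<close> such that \<open>\<psi> h \<noteq> 0\<close> holds exactly
  when \<open>h s0 \<noteq> 0\<close>; on the characters nonzero at \<open>s0\<close> the map is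
  Bohr continuous, hence evaluation at a point.\<close>

theorem dual_dual_surj_discrete:
  assumes disc: "\<T> = discrete_topology (carrier S)" and \<psi>: "\<psi> \<in> dual_carrier \<D>"
  shows "\<exists>x\<in>carrier S. \<forall>h\<in>dual_carrier S. \<psi> h = h x"
proof -
  interpret D: spaced_monoid \<D> by (rule dual_spaced)
  note dual_iff = dual_carrier_discrete_iff[OF disc]
  let ?m = "\<lambda>f g. \<lambda>x\<in>carrier S. f x * g x" and ?c = "\<lambda>h. \<lambda>x\<in>carrier S. cnj (h x)"
  have mul: "\<psi> (?m f g) = \<psi> f * \<psi> g" if "f \<in> dual_carrier S" "g \<in> dual_carrier S" for f g
    using D.dualD(3)[OF \<psi>, of f g] that by simp
  have one: "\<psi> (\<lambda>x\<in>carrier S. 1) = 1" using D.dualD(4)[OF \<psi>] by simp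
  have unit: "\<psi> h = 0 \<or> cmod (\<psi> h) = 1" if "h \<in> dual_carrier S" for h
    using D.dualD(2)[OF \<psi>, of h] that by simp
  have val: "h x = 0 \<or> h x * cnj (h x) = 1" if "h \<in> dual_carrier S" "x \<in> carrier S" for h x
    using dualD(2)[OF that] by (auto simp: complex_norm_square[symmetric])
  define I where "I = {d \<in> dual_carrier S. (\<forall>s\<in>carrier S. d s = 0 \<or> d s = 1) \<and> \<psi> d = 1}"
  have I: "d \<in> dual_carrier S" "s \<in> carrier S \<Longrightarrow> d s = 0 \<or> d s = 1" "\<psi> d = 1" if "d \<in> I" for d s
    using that unfolding I_def by auto
  have oneI: "(\<lambda>x\<in>carrier S. 1) \<in> I" using dual_one one unfolding I_def by simp
  have idemI: "d \<in> I" if "d \<in> dual_carrier S" "\<And>s. s \<in> carrier S \<Longrightarrow> d s = 0 \<or> d s = 1" "\<psi> d \<noteq> 0" for d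
  proof -
    have "?m d d = d"
      by (rule dual_eqI[OF dual_mult[OF that(1) that(1)] that(1)]) (use that(2) in fastforce)
    then have "\<psi> d * \<psi> d = \<psi> d" using mul[OF that(1) that(1)] by simp
    then have "\<psi> d = 1" using that(3) by simp
    then show ?thesis unfolding I_def using that by blast
  qed
  \<comment> \<open>The pointwise infimum of \<open>I\<close>; it is continuous because
    \<open>S\<close> is discrete.\<close>
  define e where "e = (\<lambda>s\<in>carrier S. if \<forall>d\<in>I. d s = 1 then 1 else 0 :: complex)"
  have e_val: "e s = 0 \<or> e s = 1" if "s \<in> carrier S" for s using that unfolding e_def by simp
  have e1: "d s = 1" if "s \<in> carrier S" "e s = 1" "d \<in> I" for s d
    using that unfolding e_def by (auto split: if_splits)
  have e: "e \<in> dual_carrier S"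
    unfolding dual_iff
  proof (intro conjI ballI)
    fix x y assume xy: "x \<in> carrier S" "y \<in> carrier S"
    have "(\<forall>d\<in>I. d (x \<otimes> y) = 1) \<longleftrightarrow> (\<forall>d\<in>I. d x = 1) \<and> (\<forall>d\<in>I. d y = 1)"
      using I(2)[OF _ xy(1)] I(2)[OF _ xy(2)] dualD(3)[OF I(1) xy] by fastforce
    then show "e (x \<otimes> y) = e x * e y" unfolding e_def using xy by auto
  qed (use dualD(4)[OF I(1)] in \<open>auto simp: e_def\<close>)
  \<comment> \<open>\<open>I\<close> is closed under products, so the infimum is attained on finite
    sets; with continuity this gives \<open>\<psi> e \<noteq> 0\<close>.\<close>
  have approx: "\<exists>d\<in>I. \<forall>s\<in>F. d s = e s" if "finite F" "F \<subseteq> carrier S" for F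
    using that
  proof (induction F rule: finite_induct)
    case empty then show ?case using oneI by blast
  next
    case (insert s F)
    then obtain d where d: "d \<in> I" "\<forall>s\<in>F. d s = e s" by auto
    have s: "s \<in> carrier S" using insert.prems by auto
    show ?case
    proof (cases "e s = 1")
      case True
      then show ?thesis using d e1[OF s True d(1)] by (intro bexI[OF _ d(1)]) auto
    next
      case False
      then obtain d' where d': "d' \<in> I" "d' s \<noteq> 1" unfolding e_def using s by (auto split: if_splits)
      then have d's: "d' s = 0" using I(2)[OF d'(1) s] by blast
      have m: "?m d d' \<in> I"
      proof (rule idemI[OF dual_mult[OF I(1)[OF d(1)] I(1)[OF d'(1)]]])
        show "?m d d' s = 0 \<or> ?m d d' s = 1" if "s \<in> carrier S" for s
          using that I(2)[OF d(1) that] I(2)[OF d'(1) that] by auto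
        show "\<psi> (?m d d') \<noteq> 0" using mul[OF I(1)[OF d(1)] I(1)[OF d'(1)]] I(3) d(1) d'(1) by simp
      qed
      have "?m d d' t = e t" if t: "t \<in> insert s F" for t
      proof (cases "t = s")
        case True then show ?thesis using d's e_val[OF s] False s by auto
      next
        case False
        then have tF: "t \<in> F" "t \<in> carrier S" using t insert.prems by auto
        then show ?thesis using d(2) e_val[OF tF(2)] e1[OF tF(2) _ d'(1)] by auto
      qed
      then show ?thesis using m by blast
    qed
  qed
  have "\<psi> e \<noteq> 0"
  proof
    assume 0: "\<psi> e = 0"
    obtain F \<delta> where F: "finite F" "F \<subseteq> carrier S" "\<delta> > 0"
      "\<And>h. h \<in> dual_carrier S \<Longrightarrow> (\<And>x. x \<in> F \<Longrightarrow> cmod (h x - e x) < \<delta>) \<Longrightarrow> cmod (\<psi> h - \<psi> e) < 1"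
      using dual_dual_continuity[OF disc \<psi> e zero_less_one] by blast
    obtain d where d: "d \<in> I" "\<forall>s\<in>F. d s = e s" using approx[OF F(1,2)] by blast
    have "cmod (\<psi> d - \<psi> e) < 1" by (rule F(4)[OF I(1)[OF d(1)]]) (use d F(3) in auto)
    then show False using 0 I(3)[OF d(1)] by simp
  qed
  then have eI: "e \<in> I" using idemI[OF e e_val] by blast
  have \<psi>e: "\<psi> e = 1" by (rule I(3)[OF eI])
  \<comment> \<open>Radius 1/2 serves twice: it keeps \<open>\<psi> h0\<close> away from 0, and it
    gives real part at least 1/2 in the Bohr condition.\<close>
  obtain F \<delta> where F: "finite F" "F \<subseteq> carrier S" "\<delta> > 0"
    "\<And>h. h \<in> dual_carrier S \<Longrightarrow> (\<And>x. x \<in> F \<Longrightarrow> cmod (h x - e x) < \<delta>) \<Longrightarrow> cmod (\<psi> h - \<psi> e) < 1/2"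
    using dual_dual_continuity[OF disc \<psi> e, of "1/2"] by auto
  text \<open>\<open>e\<close> is the least idempotent character on which \<open>\<psi>\<close> does not vanish; continuity of \<open>\<psi>\<close> makes
    the filter \<open>e = 1\<close> principal.\<close>
  have "\<exists>s0\<in>idempotents S. e s0 = 1 \<and> (\<forall>s\<in>F. e s = 1 \<longrightarrow> supp s \<otimes> s0 = s0)"
    using F(1,2)
  proof (induction F rule: finite_induct)
    case empty
    then show ?case using dualD(4)[OF e] by (intro bexI[of _ \<one>]) (auto simp: idempotents_def)
  next
    case (insert s B)
    then obtain s0 where s0: "s0 \<in> idempotents S" "e s0 = 1" "\<forall>s\<in>B. e s = 1 \<longrightarrow> supp s \<otimes> s0 = s0" by auto
    have s: "s \<in> carrier S" and s0c: "s0 \<in> carrier S" using insert.prems s0(1) unfolding idempotents_def by auto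
    show ?case
    proof (cases "e s = 1")
      case False
      then show ?thesis using s0 by (intro bexI[of _ s0]) auto
    next
      case True
      have es: "e (supp s) = 1" using dual_supp[OF e s] True by simp
      have "supp t \<otimes> (supp s \<otimes> s0) = supp s \<otimes> s0" if t: "t \<in> insert s B" "e t = 1" for t
      proof (cases "t = s")
        case True
        then show ?thesis using s s0c by (simp add: m_assoc[symmetric] supp_idem)
      next
        case False
        then have tc: "t \<in> carrier S" and ts: "supp t \<otimes> s0 = s0" using t s0(3) insert.prems by auto
        have "supp t \<otimes> (supp s \<otimes> s0) = supp s \<otimes> (supp t \<otimes> s0)" using tc s s0c by (simp only: m_ac supp_closed m_closed)
        then show ?thesis unfolding ts .
      qed
      moreover have "e (supp s \<otimes> s0) = 1" using dualD(3)[OF e supp_closed[OF s] s0c] es s0(2) by simp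
      moreover have "supp s \<otimes> s0 \<in> idempotents S" by (rule idempotents_mult[OF supp_in_idempotents[OF s] s0(1)])
      ultimately show ?thesis by blast
    qed
  qed
  then obtain s0 where s0: "s0 \<in> idempotents S" "e s0 = 1" "\<And>s. s \<in> F \<Longrightarrow> e s = 1 \<Longrightarrow> supp s \<otimes> s0 = s0" by blast
  have s0c: "s0 \<in> carrier S" "s0 \<otimes> s0 = s0" using s0(1) unfolding idempotents_def by auto
  \<comment> \<open>The indicator of the filter above \<open>s0\<close> agrees with \<open>e\<close>
    on \<open>F\<close>, so \<open>\<psi>\<close> does not kill it; hence it lies in
    \<open>I\<close> and dominates \<open>e\<close>, and the two coincide.\<close>
  define h0 where "h0 = (\<lambda>s\<in>carrier S. if supp s \<otimes> s0 = s0 then 1 else 0 :: complex)"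
  have h0: "h0 \<in> dual_carrier S"
    unfolding h0_def by (rule extended_character_in_dual[OF s0(1), of "\<lambda>_. 1"]) (auto simp: disc)
  have above: "e s = 1" if "s \<in> carrier S" "supp s \<otimes> s0 = s0" for s
  proof -
    have "e (supp s) * e s0 = e s0" using dualD(3)[OF e supp_closed[OF that(1)] s0c(1)] that(2) by simp
    then have "e s \<noteq> 0" using s0(2) dual_supp[OF e that(1)] by auto
    then show ?thesis using e_val[OF that(1)] by blast
  qed
  have "cmod (\<psi> h0 - \<psi> e) < 1/2"
  proof (rule F(4)[OF h0])
    fix x assume x: "x \<in> F"
    then have xc: "x \<in> carrier S" using F(2) by auto
    have "h0 x = e x" using s0(3)[OF x] above[OF xc] e_val[OF xc] xc unfolding h0_def by auto
    then show "cmod (h0 x - e x) < \<delta>" using F(3) by simp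
  qed
  then have "\<psi> h0 \<noteq> 0" using \<psi>e by auto
  then have h0I: "h0 \<in> I" by (intro idemI[OF h0]) (auto simp: h0_def)
  have principal: "supp s \<otimes> s0 = s0" if "s \<in> carrier S" "e s = 1" for s
  proof -
    have "h0 s = 1" by (rule e1[OF that h0I])
    then show ?thesis using that(1) unfolding h0_def by (simp split: if_splits)
  qed
  have nz: "\<psi> h \<noteq> 0 \<longleftrightarrow> h s0 \<noteq> 0" if h: "h \<in> dual_carrier S" for h
  proof -
    \<comment> \<open>\<open>q\<close> is |h|^2, the idempotent character with the same zeros as
      \<open>h\<close>, so its membership in \<open>I\<close> can be compared with
      \<open>e\<close>.\<close>
    define q where "q = ?m h (?c h)"
    have q: "q \<in> dual_carrier S" unfolding q_def by (rule dual_mult[OF h dual_cnj[OF h]])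
    have q_val: "q s = (if h s = 0 then 0 else 1)" if "s \<in> carrier S" for s
      unfolding q_def using val[OF h that] that by auto
    have \<psi>q: "\<psi> q = \<psi> h * cnj (\<psi> h)"
      unfolding q_def using mul[OF h dual_cnj[OF h]] dual_dual_cnj[OF \<psi> h] by simp
    show ?thesis
    proof
      assume "\<psi> h \<noteq> 0"
      then have "q \<in> I" using \<psi>q q_val by (intro idemI[OF q]) auto
      then have "q s0 = 1" using e1[OF s0c(1) s0(2)] by blast
      then show "h s0 \<noteq> 0" using q_val[OF s0c(1)] by auto
    next
      assume hs: "h s0 \<noteq> 0"
      have "?m q e = e"
      proof (rule dual_eqI[OF dual_mult[OF q e] e])
        fix s assume s: "s \<in> carrier S"
        show "?m q e s = e s"
        proof (cases "e s = 1")
          case True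
          have "h (supp s) * h s0 = h s0"
            using dualD(3)[OF h supp_closed[OF s] s0c(1)] principal[OF s True] by simp
          then have "h s \<noteq> 0" using hs dual_supp[OF h s] by auto
          then show ?thesis using s q_val[OF s] by simp
        next
          case False
          then show ?thesis using e_val[OF s] s by auto
        qed
      qed
      then have "\<psi> q = 1" using mul[OF q e] \<psi>e by simp
      then show "\<psi> h \<noteq> 0" using \<psi>q by auto
    qed
  qed
  have hs0: "h s0 = 1" if "h \<in> dual_carrier S" "h s0 \<noteq> 0" for h
    using dual_supp[OF that(1) s0c(1)] that(2) by (simp add: supp_of_idem s0c)
  define G where "G = \<D>\<lparr>carrier := {h \<in> dual_carrier S. h s0 \<noteq> 0}\<rparr>"
  have G_simps [simp]: "carrier G = {h \<in> dual_carrier S. h s0 \<noteq> 0}" "mult G f g = ?m f g"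
    "one G = (\<lambda>x\<in>carrier S. 1)" for f g
    unfolding G_def by simp_all
  have "comm_monoid G"
  proof (rule comm_monoidI)
    show "\<one>\<^bsub>G\<^esub> \<otimes>\<^bsub>G\<^esub> f = f" if "f \<in> carrier G" for f
    proof -
      have "f \<in> dual_carrier S" using that by simp
      then show ?thesis using dual_eqI[OF dual_mult[OF dual_one, of f], of f] by simp
    qed
  qed (use s0c dual_one dual_mult in \<open>auto simp: mult_ac intro!: restrict_ext\<close>)
  then obtain M where "invariant_mean G M" using comm_monoid.invariant_mean_exists by blast
  then interpret IM: invariant_mean G M .
  define X where "X = {x \<in> carrier S. supp x \<otimes> s0 = s0}"
  have X: "x \<in> carrier S" "supp x \<otimes> s0 = s0" if "x \<in> X" for x using that unfolding X_def by auto
  have Xnz: "h x \<noteq> 0" if "x \<in> X" "h \<in> carrier G" for x h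
  proof -
    have h: "h \<in> dual_carrier S" "h s0 \<noteq> 0" using that(2) by auto
    have "h (supp x) * h s0 = h s0" using dualD(3)[OF h(1) supp_closed[OF X(1)[OF that(1)]] s0c(1)] X(2)[OF that(1)] by simp
    then show ?thesis using h(2) dual_supp[OF h(1) X(1)[OF that(1)]] by auto
  qed
  \<comment> \<open>Here points are the indices and characters the arguments; conjugating a
    character provides the inverses for the pairing.\<close>
  interpret character_family G M X "\<lambda>x h. h x" "(\<otimes>)" sinv
  proof unfold_locales
    show "X \<noteq> {}" using s0c unfolding X_def by (auto simp: supp_of_idem)
    show "x \<otimes> y \<in> X" if "x \<in> X" "y \<in> X" for x y
      using that s0c unfolding X_def by (auto simp: supp_mult m_assoc)
    show "sinv x \<in> X" if "x \<in> X" for x using that unfolding X_def by (auto simp: supp_sinv)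
    show "h (x \<otimes> y) = h x * h y" if "x \<in> X" "y \<in> X" "h \<in> carrier G" for x y h
      using that X dualD(3) by auto
    show "h (sinv x) = cnj (h x)" if "x \<in> X" "h \<in> carrier G" for x h
      using that X dual_sinv by auto
    show "cmod (h x) = 1" if "x \<in> X" "h \<in> carrier G" for x h
      using Xnz[OF that] dualD(2)[of h x] that X by auto
    show "(g \<otimes>\<^bsub>G\<^esub> h) x = g x * h x" if "x \<in> X" "g \<in> carrier G" "h \<in> carrier G" for x g h
      using X(1)[OF that(1)] by simp
    show "\<exists>k\<in>carrier G. \<forall>x\<in>X. k x = cnj (h x)" if "h \<in> carrier G" for h
      using that X s0c dual_cnj by (intro bexI[of _ "?c h"]) auto
  qed
  have "\<exists>x\<in>X. \<forall>h\<in>carrier G. \<psi> h = h x"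
  proof (rule character_of_Bohr_continuous)
    show "\<psi> (g \<otimes>\<^bsub>G\<^esub> h) = \<psi> g * \<psi> h" if "g \<in> carrier G" "h \<in> carrier G" for g h
      using mul that by simp
    show "cmod (\<psi> h) = 1" if "h \<in> carrier G" for h
      using that nz[of h] unit[of h] by auto
    show "finite {x \<in> F. e x = 1}" "{x \<in> F. e x = 1} \<subseteq> X" "\<delta> > 0"
      using F s0(3) unfolding X_def by auto
    \<comment> \<open>Multiplying \<open>h\<close> by \<open>e\<close> removes the points of
      \<open>F\<close> with \<open>e x = 0\<close> from the comparison, and
      \<open>\<psi> e = 1\<close> leaves the value of \<open>\<psi>\<close> unchanged.\<close>
    fix h assume h: "h \<in> carrier G" and close: "\<And>x. x \<in> {x \<in> F. e x = 1} \<Longrightarrow> cmod (h x - 1) < \<delta>"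
    have hd: "h \<in> dual_carrier S" using h by simp
    have "cmod (\<psi> (?m h e) - \<psi> e) < 1/2"
    proof (rule F(4)[OF dual_mult[OF hd e]])
      fix x assume x: "x \<in> F"
      then have xc: "x \<in> carrier S" using F(2) by auto
      show "cmod (?m h e x - e x) < \<delta>"
        using close[of x] x xc e_val[OF xc] F(3) by (cases "e x = 1") auto
    qed
    then have "cmod (\<psi> h - 1) < 1/2" using mul[OF hd e] \<psi>e by simp
    then show "1/2 \<le> Re (\<psi> h)" using abs_Re_le_cmod[of "\<psi> h - 1"] by simp
  qed
  then obtain x where x: "x \<in> X" "\<And>h. h \<in> carrier G \<Longrightarrow> \<psi> h = h x" by blast
  \<comment> \<open>The factor \<open>s0\<close> makes the evaluation vanish at characters with
    \<open>h s0 = 0\<close>, in accordance with \<open>nz\<close>.\<close>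
  have "\<psi> h = h (s0 \<otimes> x)" if h: "h \<in> dual_carrier S" for h
  proof (cases "h s0 = 0")
    case True
    then show ?thesis using nz[OF h] dualD(3)[OF h s0c(1) X(1)[OF x(1)]] by simp
  next
    case False
    then show ?thesis using x(2)[of h] h hs0[OF h False] dualD(3)[OF h s0c(1) X(1)[OF x(1)]] by simp
  qed
  then show ?thesis using s0c(1) X(1)[OF x(1)] by blast
qed

end

section \<open>Consequences of reflexivity\<close>

context topological_monoid
begin

lemma reflexive_separates:
  assumes "reflexive S" "x \<in> carrier S" "y \<in> carrier S" "\<And>h. h \<in> dual_carrier S \<Longrightarrow> h x = h y"
  shows "x = y"
proof -
  have "inj_on (canonical_hom S) (carrier S)"
    using assms(1) unfolding reflexive_def topological_isomorphism_def bij_betw_def by simp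
  moreover have "canonical_hom S x = canonical_hom S y"
    unfolding canonical_hom_def by (rule restrict_ext) (use assms(4) in simp)
  ultimately show ?thesis using assms(2,3) by (meson inj_onD)
qed

lemma reflexive_comm_monoid:
  assumes "reflexive S"
  shows "comm_monoid S"
  by (rule monoid_comm_monoidI, rule reflexive_separates[OF assms]) (auto simp: dualD mult.commute)

text \<open>Conjugating an evaluation gives another continuous homomorphism on the dual;
  surjectivity of the canonical homomorphism supplies the point.\<close>

lemma reflexive_conjugate:
  assumes refl: "reflexive S" and x: "x \<in> carrier S"
  shows "\<exists>y\<in>carrier S. \<forall>h\<in>dual_carrier S. h y = cnj (h x)"
proof -
  interpret D: spaced_monoid \<D> by (rule dual_spaced)
  have "(\<lambda>h\<in>carrier \<D>. cnj (canonical_hom S x h)) \<in> dual_carrier \<D>"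
    by (rule D.dual_cnj[OF canonical_hom_in_dual[OF x]])
  then have "(\<lambda>h\<in>carrier \<D>. cnj (canonical_hom S x h)) \<in> canonical_hom S ` carrier S"
    using refl unfolding reflexive_def topological_isomorphism_def bij_betw_def by simp
  then obtain y where y: "y \<in> carrier S" "(\<lambda>h\<in>carrier \<D>. cnj (canonical_hom S x h)) = canonical_hom S y"
    by blast
  have "h y = cnj (h x)" if "h \<in> dual_carrier S" for h
    using fun_cong[OF y(2), of h] that by (simp add: canonical_hom_def)
  then show ?thesis using y(1) by blast
qed

text \<open>In \<open>Tdot\<close> the only semigroup inverse is the conjugate, and characters
  separate points; existence and uniqueness of inverses will both be read off from this.\<close>

lemma reflexive_is_semigroup_inverse_iff:
  assumes refl: "reflexive S" and x: "x \<in> carrier S" and y: "y \<in> carrier S"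
  shows "is_semigroup_inverse S x y \<longleftrightarrow> (\<forall>h\<in>dual_carrier S. h y = cnj (h x))"
proof
  assume inv: "is_semigroup_inverse S x y"
  show "\<forall>h\<in>dual_carrier S. h y = cnj (h x)"
  proof
    fix h assume h: "h \<in> dual_carrier S"
    have "h (x \<otimes> y \<otimes> x) = h x" "h (y \<otimes> x \<otimes> y) = h y"
      using inv unfolding is_semigroup_inverse_def by simp_all
    then show "h y = cnj (h x)"
      using x y dualD(3)[OF h] dualD(2)[OF h x] by (intro Tdot_inverse_eq_cnj) simp_all
  qed
next
  assume cj: "\<forall>h\<in>dual_carrier S. h y = cnj (h x)"
  have u: "h x * cnj (h x) * h x = h x" "cnj (h x) * h x * cnj (h x) = cnj (h x)"
    if h: "h \<in> dual_carrier S" for h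
    using dualD(2)[OF h x] complex_norm_square[of "h x"] by (auto simp: mult.commute)
  have "x \<otimes> y \<otimes> x = x" by (rule reflexive_separates[OF refl]) (use x y cj u dualD(3) in auto)
  moreover have "y \<otimes> x \<otimes> y = y" by (rule reflexive_separates[OF refl]) (use x y cj u dualD(3) in auto)
  ultimately show "is_semigroup_inverse S x y" using y unfolding is_semigroup_inverse_def by simp
qed

lemma reflexive_unique_inverse:
  assumes refl: "reflexive S" and x: "x \<in> carrier S"
  shows "\<exists>!y. is_semigroup_inverse S x y"
proof -
  obtain y where y: "y \<in> carrier S" "\<forall>h\<in>dual_carrier S. h y = cnj (h x)"
    using reflexive_conjugate[OF refl x] by blast
  show ?thesis
  proof (rule ex1I[of _ y])
    show "is_semigroup_inverse S x y" using reflexive_is_semigroup_inverse_iff[OF refl x y(1)] y(2) by blast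
    fix z assume z: "is_semigroup_inverse S x z"
    then have zc: "z \<in> carrier S" unfolding is_semigroup_inverse_def by simp
    show "z = y"
      by (rule reflexive_separates[OF refl zc y(1)])
        (use reflexive_is_semigroup_inverse_iff[OF refl x zc] z y(2) in simp)
  qed
qed

text \<open>Closed graph: the pairs of mutual inverses form a closed subset of the product, and
  projection along a compact factor is a closed map.\<close>

lemma continuous_inversion_of_compact:
  assumes comp: "compact_space \<T>" and uniq: "\<And>x. x \<in> carrier S \<Longrightarrow> \<exists>!y. is_semigroup_inverse S x y"
  shows "continuous_map \<T> \<T> (semigroup_inverse S)"
proof -
  let ?P = "prod_topology \<T> \<T>"
  have inv: "is_semigroup_inverse S x (semigroup_inverse S x)" if "x \<in> carrier S" for x
    unfolding semigroup_inverse_def by (rule theI'[OF uniq[OF that]])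
  have inv_eq: "semigroup_inverse S x = y" if "x \<in> carrier S" "is_semigroup_inverse S x y" for x y
    using uniq[OF that(1)] inv[OF that(1)] that(2) by blast
  have closed: "semigroup_inverse S x \<in> carrier S" if "x \<in> carrier S" for x
    using inv[OF that] unfolding is_semigroup_inverse_def by simp
  have c: "continuous_map ?P \<T> fst" "continuous_map ?P \<T> snd"
    by (rule continuous_map_fst, rule continuous_map_snd)
  define R where "R = {p \<in> topspace ?P. fst p \<otimes> snd p \<otimes> fst p = fst p} \<inter>
    {p \<in> topspace ?P. snd p \<otimes> fst p \<otimes> snd p = snd p}"
  have R: "closedin ?P R"
    unfolding R_def by (intro closedin_Int closedin_continuous_maps_eq[OF Hausdorff_opens] continuous_map_mult_comp c)
  have R_iff: "(x, y) \<in> R \<longleftrightarrow> x \<in> carrier S \<and> is_semigroup_inverse S x y" for x y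
    unfolding R_def is_semigroup_inverse_def by (auto simp: topspace_opens)
  show ?thesis
    unfolding continuous_map_closedin
  proof (intro conjI allI impI)
    fix C assume C: "closedin \<T> C"
    have "closedin ?P (R \<inter> {p \<in> topspace ?P. snd p \<in> C})"
      by (intro closedin_Int R closedin_continuous_map_preimage[OF c(2)] C)
    then have "closedin \<T> (fst ` (R \<inter> {p \<in> topspace ?P. snd p \<in> C}))"
      using Abstract_Topological_Spaces.closed_map_fst[OF comp] unfolding closed_map_def by blast
    moreover have "fst ` (R \<inter> {p \<in> topspace ?P. snd p \<in> C}) = {x \<in> topspace \<T>. semigroup_inverse S x \<in> C}"
    proof (intro equalityI subsetI)
      fix x assume "x \<in> fst ` (R \<inter> {p \<in> topspace ?P. snd p \<in> C})"
      then obtain y where "(x, y) \<in> R" "y \<in> C" by auto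
      then show "x \<in> {x \<in> topspace \<T>. semigroup_inverse S x \<in> C}"
        using inv_eq R_iff topspace_opens by auto
    next
      fix x assume x: "x \<in> {x \<in> topspace \<T>. semigroup_inverse S x \<in> C}"
      then have "(x, semigroup_inverse S x) \<in> R \<inter> {p \<in> topspace ?P. snd p \<in> C}"
        using R_iff inv closed topspace_opens by auto
      then show "x \<in> fst ` (R \<inter> {p \<in> topspace ?P. snd p \<in> C})" by (rule image_eqI[rotated]) simp
    qed
    ultimately show "closedin \<T> {x \<in> topspace \<T>. semigroup_inverse S x \<in> C}" by simp
  qed (use closed topspace_opens in auto)
qed

text \<open>On idempotents characters take only the values 0 and 1, so their level sets are clopen;
  as characters separate points, compactness gives finitely many level sets whose intersection lies
  in \<open>U\<close>.\<close>

lemma idempotents_zero_dimensional_of_compact: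
  assumes comp: "compact_space \<T>"
    and sep: "\<And>x y. x \<in> carrier S \<Longrightarrow> y \<in> carrier S \<Longrightarrow> x \<noteq> y \<Longrightarrow> \<exists>h\<in>dual_carrier S. h x \<noteq> h y"
  shows "zero_dimensional_space (subtopology \<T> (idempotents S))"
proof (rule zero_dimensional_spaceI)
  let ?E = "subtopology \<T> (idempotents S)"
  note tE = topspace_E
  have compE: "compact_space ?E"
    using closedin_compact_space[OF comp closedin_idempotents] compactin_subspace by blast
  have val: "h x = 0 \<or> h x = 1" if "h \<in> dual_carrier S" "x \<in> idempotents S" for h x
  proof -
    have "x \<in> carrier S" "x \<otimes> x = x" using that(2) unfolding idempotents_def by auto
    then have "h x * h x = h x" using dualD(3)[OF that(1), of x x] by simp
    then show ?thesis by simp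
  qed
  fix U x assume U: "openin ?E U" and x: "x \<in> U"
  have xE: "x \<in> idempotents S" using openin_subset[OF U] x tE by auto
  define C where "C h = {y \<in> topspace ?E. h y = h x}" for h :: "'a \<Rightarrow> complex"
  have ch: "continuous_map ?E euclidean h" if "h \<in> dual_carrier S" for h
    by (rule continuous_map_from_subtopology[OF dualD(5)[OF that]])
  have C_closed: "closedin ?E (C h)" if "h \<in> dual_carrier S" for h
    using closedin_continuous_map_preimage[OF ch[OF that], of "{h x}"] unfolding C_def by simp
  have C_open: "openin ?E (C h)" if h: "h \<in> dual_carrier S" for h
  proof -
    have "h y = h x \<longleftrightarrow> h y \<in> ball (h x) 1" if "y \<in> idempotents S" for y
      using val[OF h that] val[OF h xE] by (auto simp: dist_norm)
    then have "C h = {y \<in> topspace ?E. h y \<in> ball (h x) 1}"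
      unfolding C_def tE by blast
    then show ?thesis using openin_continuous_map_preimage[OF ch[OF h], of "ball (h x) 1"] by simp
  qed
  have clU: "closedin ?E (topspace ?E - U)" using U by blast
  have "\<exists>J. finite J \<and> J \<subseteq> dual_carrier S \<and> topspace ?E \<inter> (\<Inter>h\<in>J. C h) \<subseteq> U"
  proof (rule ccontr)
    assume no: "\<not> ?thesis"
    have "\<exists>y\<in>topspace ?E. \<forall>h\<in>dual_carrier S. y \<in> C h - U"
    proof (rule compact_space_indexed_fip[OF compE])
      show "closedin ?E (C h - U)" if "h \<in> dual_carrier S" for h
        by (rule closedin_diff[OF C_closed[OF that] U])
      fix J assume J: "finite J" "J \<subseteq> dual_carrier S"
      then have "\<not> topspace ?E \<inter> (\<Inter>h\<in>J. C h) \<subseteq> U" using no by metis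
      then obtain y where "y \<in> topspace ?E" "\<forall>h\<in>J. y \<in> C h" "y \<notin> U"
        unfolding subset_iff Int_iff INT_iff by metis
      then show "\<exists>y\<in>topspace ?E. \<forall>h\<in>J. y \<in> C h - U" by (intro bexI[of _ y]) simp_all
    qed
    then obtain y where y: "y \<in> idempotents S" "\<forall>h\<in>dual_carrier S. y \<in> C h - U"
      unfolding tE by (elim bexE)
    \<comment> \<open>The constant character supplies at least one index, so \<open>y\<close> does
      lie outside \<open>U\<close>.\<close>
    have "y \<notin> U" using bspec[OF y(2) dual_one] by simp
    then have "x \<noteq> y" using x by blast
    moreover have "x \<in> carrier S" "y \<in> carrier S" using xE y(1) unfolding idempotents_def by auto
    ultimately obtain h where h: "h \<in> dual_carrier S" "h x \<noteq> h y" using sep by blast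
    then show False using bspec[OF y(2) h(1)] unfolding C_def by simp
  qed
  then obtain J where J: "finite J" "J \<subseteq> dual_carrier S" "topspace ?E \<inter> (\<Inter>h\<in>J. C h) \<subseteq> U" by blast
  define V where "V = topspace ?E \<inter> \<Inter>(C ` J)"
  have "openin ?E V" unfolding V_def
    by (rule openin_Int_Inter[OF _ openin_topspace]) (use J C_open in blast)+
  moreover have "closedin ?E V"
  proof -
    have "openin ?E (\<Union>h\<in>J. topspace ?E - C h)"
      by (rule openin_Union) (use C_closed J(2) in blast)
    moreover have "V = topspace ?E - (\<Union>h\<in>J. topspace ?E - C h)" unfolding V_def by blast
    ultimately show ?thesis by (simp only: closedin_diff closedin_topspace)
  qed
  moreover have "x \<in> V" unfolding V_def C_def tE using xE by blast
  moreover have "V \<subseteq> U" using J(3) unfolding V_def .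
  ultimately show "\<exists>V. openin ?E V \<and> closedin ?E V \<and> x \<in> V \<and> V \<subseteq> U" by blast
qed

end

theorem theorem4:
  fixes S :: "'a top_monoid"
  assumes "topological_monoid S"
    and "compact_space (opens S) \<or> opens S = discrete_topology (carrier S)"
  shows "reflexive S \<longleftrightarrow>
    comm_monoid S \<and> topological_inverse_monoid S \<and>
    zero_dimensional_space (subtopology (opens S) (idempotents S))"
proof -
  interpret topological_monoid S by (rule assms(1))
  show ?thesis
  proof
    assume refl: "reflexive S"
    note uniq = reflexive_unique_inverse[OF refl]
    have sep: "\<exists>h\<in>dual_carrier S. h x \<noteq> h y" if "x \<in> carrier S" "y \<in> carrier S" "x \<noteq> y" for x y
      using reflexive_separates[OF refl that(1,2)] that(3) by blast
    have "continuous_map (opens S) (opens S) (semigroup_inverse S)"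
      using assms(2)
    proof
      assume "compact_space (opens S)"
      then show ?thesis by (rule continuous_inversion_of_compact[OF _ uniq])
    next
      assume d: "opens S = discrete_topology (carrier S)"
      have "semigroup_inverse S x \<in> carrier S" if "x \<in> carrier S" for x
        using theI'[OF uniq[OF that]] unfolding semigroup_inverse_def is_semigroup_inverse_def by blast
      then show ?thesis unfolding d by auto
    qed
    then have "topological_inverse_monoid S"
      using uniq by unfold_locales auto
    moreover have "zero_dimensional_space (subtopology (opens S) (idempotents S))"
      using assms(2)
    proof
      assume "compact_space (opens S)"
      then show ?thesis by (rule idempotents_zero_dimensional_of_compact[OF _ sep])
    next
      assume d: "opens S = discrete_topology (carrier S)"
      have "closedin (subtopology (opens S) (idempotents S)) U" if "openin (subtopology (opens S) (idempotents S)) U" for U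
        using that unfolding d subtopology_discrete_topology by simp
      then show ?thesis by (intro zero_dimensional_spaceI) blast
    qed
    ultimately show "comm_monoid S \<and> topological_inverse_monoid S \<and>
        zero_dimensional_space (subtopology (opens S) (idempotents S))"
      using reflexive_comm_monoid[OF refl] by blast
  next
    assume rhs: "comm_monoid S \<and> topological_inverse_monoid S \<and>
        zero_dimensional_space (subtopology (opens S) (idempotents S))"
    then interpret abelian_topological_inverse_monoid S
      by (simp add: abelian_topological_inverse_monoid_def)
    have sep: "\<exists>h\<in>dual_carrier S. h x \<noteq> h y" if "x \<in> carrier S" "y \<in> carrier S" "x \<noteq> y" for x y
      using dual_separates_points[OF assms(2) _ that] rhs by blast
    show "reflexive S"
      using assms(2)
    proof
      assume c: "compact_space (opens S)"
      show ?thesis by (rule reflexive_of_compact[OF c sep dual_dual_surj_compact[OF c]])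
    next
      assume d: "opens S = discrete_topology (carrier S)"
      show ?thesis
        by (rule reflexive_of_discrete[OF d compact_space_dual[OF d] sep dual_dual_surj_discrete[OF d]])
    qed
  qed
qed

end
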